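(* Let $\mathsf X=\mathbb R^d$, $\mathsf Y=\mathbb R^p$, let $\Theta$ be a compact metric space, and for each $\theta\in\Theta$ consider the Gaussian linear state space model $$X_{k+1}=A_\theta X_k+R_\theta U_k,\qquad Y_k=B_\theta X_k+S_\theta V_k,\qquad k\ge0,$$ where $(U_k,V_k)_{k\ge0}$ is an i.i.d. sequence of Gaussian vectors with zero mean and identity covariance matrix, independent of $X_0$, $U_k$ is $q$-dimensional, $V_k$ is $p$-dimensional, and $A_\theta\in\mathbb R^{d\times d}$, $R_\theta\in\mathbb R^{d\times q}$, $B_\theta\in\mathbb R^{p\times d}$, $S_\theta\in\mathbb R^{p\times p}$. Assume that for every $\theta\in\Theta$: (L1) the pair $[A_\theta,B_\theta]$ is observable and the pair $[A_\theta,R_\theta]$ is controllable, i.e. the observability matrix $\mathcal O_{\theta,d}$ (with block rows $B_\theta,B_\theta A_\theta,\dots,B_\theta A_\theta^{d-1}$) and the controllability matrix $\mathcal C_{\theta,d}=[R_\theta\ A_\theta R_\theta\cdots A_\theta^{d-1}R_\theta]$ have full rank; (L2) all eigenvalues of $A_\theta$ lie in the open unit disc of $\mathbb C$; (L3) $S_\theta$ has full rank; and that (L4) the functions $\theta\mapsto A_\theta,R_\theta,B_\theta,S_\theta$ are continuous on $\Theta$. Let $\theta^\star\in\Theta$. Then for every probability measure $\nu$ on $\mathbb R^d$, every approximate maximum likelihood estimator $(\hat\theta_{\nu,n})_{n\ge0}$ satisfies $\hat\theta_{\nu,n}\to[\theta^\star]$ as $n\to\infty$, $\bar{\mathbb 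P}_{\theta^\star}$-a.s.
   Context: Under the assumptions, for each $\theta$ the state chain $(X_k)$ with transition kernel $Q_\theta(x,\cdot)=N(A_\theta x,R_\theta R_\theta^T)$ has a unique invariant probability measure $\pi_\theta$; $\bar{\mathbb P}_\theta$ denotes the law of $(X_k,Y_k)_{k\ge0}$ for parameter $\theta$ with $X_0\sim\pi_\theta$, and $\bar{\mathbb P}^Y_\theta$ the marginal law of $(Y_k)_{k\ge0}$. The equivalence relation on $\Theta$ is $\theta\sim\theta'$ iff $\bar{\mathbb P}^Y_\theta=\bar{\mathbb P}^Y_{\theta'}$, and $[\theta]=\{\theta'\in\Theta:\theta'\sim\theta\}$. Let $g_\theta(x,\cdot)$ be the density of $N(B_\theta x,S_\theta S_\theta^T)$ with respect to Lebesgue measure on $\mathbb R^p$. For a probability measure $\nu$, the likelihood is $p^\nu(y_0^n;\theta)=\int\nu(dx_0)\,g_\theta(x_0,y_0)\prod_{u=1}^nQ_\theta(x_{u-1},dx_u)\,g_\theta(x_u,y_u)$, where $y_0^n=(y_0,\dots,y_n)$, and $\ell_{\nu,n}(\theta)=\log p^\nu(Y_0^n;\theta)$. An approximate maximum likelihood estimator is a sequence of universally measurable $\Theta$-valued functions $\hat\theta_{\nu,n}$ of $Y_0^n$ such that $n^{-1}\ell_{\nu,n}(\hat\theta_{\nu,n})\ge\sup_{\theta\in\Theta}n^{-1}\ell_{\nu,n}(\theta)-o_{\mathrm{a.s.}}(1)$, where $o_{\mathrm{a.s.}}(1)$ is a stochastic process converging to zero $\bar{\mathbb P}_{\theta^\star}$-a.s.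 as $n\to\infty$. Convergence $\hat\theta_{\nu,n}\to[\theta^\star]$ means that the distance of $\hat\theta_{\nu,n}$ to the set $[\theta^\star]$ tends to zero. *)

theory Defs
  imports "HOL-Probability.Probability"
begin

text \<open>The library's \<open>*\<close> on vectors and matrices is entrywise, so its powers are not matrix powers.\<close>

primrec matpow :: "real^'n^'n \<Rightarrow> nat \<Rightarrow> real^'n^'n" where
  "matpow M 0 = mat 1"
| "matpow M (Suc k) = M ** matpow M k"

definition full_rank :: "real^'n^'m \<Rightarrow> bool" where
  "full_rank M \<longleftrightarrow> rank M = min CARD('m) CARD('n)"

text \<open>The blocks are numbered by the index type \<open>'d\<close>, which \<^term>\<open>to_nat_on UNIV\<close> maps
  bijectively onto \<open>{..<CARD('d)}\<close>. So, up to the order of the blocks, the observability matrix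
  has the block rows \<open>B, BA, \<dots>, BA\<^sup>d\<^sup>-\<^sup>1\<close> and the controllability matrix the block columns
  \<open>R, AR, \<dots>, A\<^sup>d\<^sup>-\<^sup>1R\<close>.\<close>

definition observability_matrix :: "real^'d^'d \<Rightarrow> real^'d^'p \<Rightarrow> real^'d^('d \<times> 'p)" where
  "observability_matrix A B =
     (\<chi> i j. (B ** matpow A (to_nat_on (UNIV :: 'd set) (fst i))) $ snd i $ j)"

definition controllability_matrix :: "real^'d^'d \<Rightarrow> real^'q^'d \<Rightarrow> real^('d \<times> 'q)^'d" where
  "controllability_matrix A R =
     (\<chi> i j. (matpow A (to_nat_on (UNIV :: 'd set) (fst j)) ** R) $ i $ snd j)"

definition observable :: "real^'d^'d \<Rightarrow> real^'d^'p \<Rightarrow> bool" where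
  "observable A B \<longleftrightarrow> full_rank (observability_matrix A B)"

definition controllable :: "real^'d^'d \<Rightarrow> real^'q^'d \<Rightarrow> bool" where
  "controllable A R \<longleftrightarrow> full_rank (controllability_matrix A R)"

definition complex_eigenvalue :: "real^'d^'d \<Rightarrow> complex \<Rightarrow> bool" where
  "complex_eigenvalue A c \<longleftrightarrow>
     (\<exists>v :: complex^'d. v \<noteq> 0 \<and> map_matrix complex_of_real A *v v = c *s v)"

definition std_gaussian :: "'a::euclidean_space measure" where
  "std_gaussian = density lborel
     (\<lambda>x. ennreal ((2 * pi) powr (- real DIM('a) / 2) * exp (- (norm x)\<^sup>2 / 2)))"

text \<open>\<open>N(m, L L\<^sup>T)\<close>, possibly degenerate, as the law of \<open>m + L u\<close> with \<open>u\<close> standard Gaussian.\<close>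

definition gaussian :: "real^'n \<Rightarrow> real^'k^'n \<Rightarrow> (real^'n) measure" where
  "gaussian m L = distr std_gaussian borel (\<lambda>u. m + L *v u)"

text \<open>Lebesgue density of the nondegenerate Gaussian law with mean \<open>m\<close> and covariance \<open>C\<close>.\<close>

definition gaussian_density :: "real^'n \<Rightarrow> real^'n^'n \<Rightarrow> real^'n \<Rightarrow> real" where
  "gaussian_density m C y =
     exp (- ((y - m) \<bullet> (matrix_inv C *v (y - m))) / 2) / sqrt ((2 * pi) ^ CARD('n) * det C)"

text \<open>A noise path \<open>w\<close> has entries \<open>w k = (U\<^sub>k, V\<^sub>k)\<close>.\<close>

primrec state ::
  "real^'d^'d \<Rightarrow> real^'q^'d \<Rightarrow> real^'d \<Rightarrow> (nat \<Rightarrow> (real^'q) \<times> (real^'p)) \<Rightarrow> nat \<Rightarrow> real^'d" where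
  "state A R x w 0 = x"
| "state A R x w (Suc k) = A *v state A R x w k + R *v fst (w k)"

definition obs ::
  "real^'d^'d \<Rightarrow> real^'q^'d \<Rightarrow> real^'d^'p \<Rightarrow> real^'p^'p \<Rightarrow> real^'d \<Rightarrow>
   (nat \<Rightarrow> (real^'q) \<times> (real^'p)) \<Rightarrow> nat \<Rightarrow> real^'p" where
  "obs A R B S x w k = B *v state A R x w k + S *v snd (w k)"

definition path_law ::
  "real^'d^'d \<Rightarrow> real^'q^'d \<Rightarrow> real^'d^'p \<Rightarrow> real^'p^'p \<Rightarrow> (real^'d) measure \<Rightarrow>
   (nat \<Rightarrow> (real^'d) \<times> (real^'p)) measure" where
  "path_law A R B S \<mu> =
     distr (\<mu> \<Otimes>\<^sub>M (\<Pi>\<^sub>M k\<in>UNIV. (std_gaussian :: ((real^'q) \<times> (real^'p)) measure)))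
       (\<Pi>\<^sub>M k\<in>UNIV. borel \<Otimes>\<^sub>M borel)
       (\<lambda>(x, w) k. (state A R x w k, obs A R B S x w k))"

definition trans_kernel :: "real^'d^'d \<Rightarrow> real^'q^'d \<Rightarrow> real^'d \<Rightarrow> (real^'d) measure" where
  "trans_kernel A R x = gaussian (A *v x) R"

definition obs_density :: "real^'d^'p \<Rightarrow> real^'p^'p \<Rightarrow> real^'d \<Rightarrow> real^'p \<Rightarrow> real" where
  "obs_density B S x y = gaussian_density (B *v x) (S ** transpose S) y"

definition invariant_prob :: "real^'d^'d \<Rightarrow> real^'q^'d \<Rightarrow> (real^'d) measure \<Rightarrow> bool" where
  "invariant_prob A R \<pi> \<longleftrightarrow> prob_space \<pi> \<and> sets \<pi> = sets borel \<and>
     (\<forall>E\<in>sets borel. emeasure \<pi> E = (\<integral>\<^sup>+x. emeasure (trans_kernel A R x) E \<partial>\<pi>))"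

definition invariant_law :: "real^'d^'d \<Rightarrow> real^'q^'d \<Rightarrow> (real^'d) measure" where
  "invariant_law A R = (THE \<pi>. invariant_prob A R \<pi>)"

definition stationary_law ::
  "real^'d^'d \<Rightarrow> real^'q^'d \<Rightarrow> real^'d^'p \<Rightarrow> real^'p^'p \<Rightarrow>
   (nat \<Rightarrow> (real^'d) \<times> (real^'p)) measure" where
  "stationary_law A R B S = path_law A R B S (invariant_law A R)"

definition obs_path :: "(nat \<Rightarrow> 'x \<times> 'y) \<Rightarrow> nat \<Rightarrow> 'y" where
  "obs_path \<omega> k = snd (\<omega> k)"

definition stationary_obs_law ::
  "real^'d^'d \<Rightarrow> real^'q^'d \<Rightarrow> real^'d^'p \<Rightarrow> real^'p^'p \<Rightarrow> (nat \<Rightarrow> real^'p) measure" where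
  "stationary_obs_law A R B S =
     distr (stationary_law A R B S) (\<Pi>\<^sub>M k\<in>UNIV. borel) obs_path"

text \<open>\<open>lik_from A R B S n y x\<close> is the iterated integral
  \<open>g(x, y\<^sub>0) \<integral>Q(x, dx\<^sub>1) g(x\<^sub>1, y\<^sub>1) \<dots> \<integral>Q(x\<^sub>n\<^sub>-\<^sub>1, dx\<^sub>n) g(x\<^sub>n, y\<^sub>n)\<close>.\<close>

primrec lik_from ::
  "real^'d^'d \<Rightarrow> real^'q^'d \<Rightarrow> real^'d^'p \<Rightarrow> real^'p^'p \<Rightarrow> nat \<Rightarrow> (nat \<Rightarrow> real^'p) \<Rightarrow>
   real^'d \<Rightarrow> ennreal" where
  "lik_from A R B S 0 y x = ennreal (obs_density B S x (y 0))"
| "lik_from A R B S (Suc n) y x = ennreal (obs_density B S x (y 0)) *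
     (\<integral>\<^sup>+x'. lik_from A R B S n (\<lambda>k. y (Suc k)) x' \<partial>(trans_kernel A R x))"

definition likelihood ::
  "real^'d^'d \<Rightarrow> real^'q^'d \<Rightarrow> real^'d^'p \<Rightarrow> real^'p^'p \<Rightarrow> (real^'d) measure \<Rightarrow> nat \<Rightarrow>
   (nat \<Rightarrow> real^'p) \<Rightarrow> real" where
  "likelihood A R B S \<nu> n y = enn2real (\<integral>\<^sup>+x. lik_from A R B S n y x \<partial>\<nu>)"

definition log_likelihood ::
  "real^'d^'d \<Rightarrow> real^'q^'d \<Rightarrow> real^'d^'p \<Rightarrow> real^'p^'p \<Rightarrow> (real^'d) measure \<Rightarrow> nat \<Rightarrow>
   (nat \<Rightarrow> real^'p) \<Rightarrow> real" where
  "log_likelihood A R B S \<nu> n y = ln (likelihood A R B S \<nu> n y)"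

definition universally_measurable :: "'a measure \<Rightarrow> 'b measure \<Rightarrow> ('a \<Rightarrow> 'b) \<Rightarrow> bool" where
  "universally_measurable M N f \<longleftrightarrow>
     (\<forall>\<mu>. prob_space \<mu> \<and> sets \<mu> = sets M \<longrightarrow> f \<in> measurable (completion \<mu>) N)"

definition equiv_params ::
  "'t set \<Rightarrow> ('t \<Rightarrow> real^'d^'d) \<Rightarrow> ('t \<Rightarrow> real^'q^'d) \<Rightarrow> ('t \<Rightarrow> real^'d^'p) \<Rightarrow>
   ('t \<Rightarrow> real^'p^'p) \<Rightarrow> 't \<Rightarrow> 't set" where
  "equiv_params \<Theta> A R B S \<theta> = {\<theta>' \<in> \<Theta>.
     stationary_obs_law (A \<theta>') (R \<theta>') (B \<theta>') (S \<theta>') =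
     stationary_obs_law (A \<theta>) (R \<theta>) (B \<theta>) (S \<theta>)}"

text \<open>\<open>y\<^sub>0, \<dots>, y\<^sub>n\<close> as a point of the product space over \<open>{..n}\<close>.\<close>

definition obs_upto :: "nat \<Rightarrow> (nat \<Rightarrow> 'x \<times> 'y) \<Rightarrow> nat \<Rightarrow> 'y" where
  "obs_upto n \<omega> = restrict (obs_path \<omega>) {..n}"

text \<open>The process \<open>Z\<close> is the \<open>o(1)\<close> term; as the estimators are only universally measurable,
  it is a random variable on the completed probability space.\<close>

definition approx_mle ::
  "'t::metric_space set \<Rightarrow> ('t \<Rightarrow> real^'d^'d) \<Rightarrow> ('t \<Rightarrow> real^'q^'d) \<Rightarrow> ('t \<Rightarrow> real^'d^'p) \<Rightarrow>
   ('t \<Rightarrow> real^'p^'p) \<Rightarrow> 't \<Rightarrow> (real^'d) measure \<Rightarrow> (nat \<Rightarrow> (nat \<Rightarrow> real^'p) \<Rightarrow> 't) \<Rightarrow> bool" where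
  "approx_mle \<Theta> A R B S \<theta>star \<nu> est \<longleftrightarrow>
     (let P = stationary_law (A \<theta>star) (R \<theta>star) (B \<theta>star) (S \<theta>star);
          l = (\<lambda>n \<theta>. log_likelihood (A \<theta>) (R \<theta>) (B \<theta>) (S \<theta>) \<nu> n)
      in (\<forall>n. universally_measurable (\<Pi>\<^sub>M k\<in>{..n}. borel) (restrict_space borel \<Theta>) (est n)) \<and>
         (\<exists>Z. (\<forall>n. Z n \<in> borel_measurable (completion P)) \<and>
              (AE \<omega> in P. (\<lambda>n. Z n \<omega>) \<longlonglongrightarrow> (0::real)) \<and>
              (AE \<omega> in P. \<forall>n\<ge>1.
                 l n (est n (obs_upto n \<omega>)) (obs_upto n \<omega>) / real n \<ge>
                 (SUP \<theta>\<in>\<Theta>. l n \<theta> (obs_upto n \<omega>) / real n) - Z n \<omega>)))"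

end

theory Submission
  imports Defs "HOL-Computational_Algebra.Fundamental_Theorem_Algebra"
begin

text \<open>
  Under the initial law \<open>\<nu>\<close> and the true parameter, the likelihood \<open>p\<^sup>\<nu>(y\<^sub>0\<^sup>n; \<theta>\<^sup>*)\<close> is itself the density of
  the observations, so a likelihood integrated over a set of paths of small probability under \<open>\<theta>\<close>
  exceeds \<open>p\<^sup>\<nu>(y\<^sub>0\<^sup>n; \<theta>\<^sup>*)\<close> only with small probability (Markov, then Borel--Cantelli).  For
  \<open>\<theta>\<^sub>0\<close> not equivalent to \<open>\<theta>\<^sup>*\<close> some bounded Lipschitz function of finitely many observations has
  different stationary means.  Its averages over spaced windows concentrate by Hoeffding's inequality,
  because stability makes the windows almost independent; this gives path sets that are typical for
  \<open>\<theta>\<^sup>*\<close> and exponentially unlikely for \<open>\<theta>\<^sub>0\<close>.  For \<open>\<theta>\<close> close to \<open>\<theta>\<^sub>0\<close>, on paths with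
  \<open>\<Sum>k\<le>n. \<bar>y\<^sub>k\<bar>\<^sup>2 \<le> M n\<close>, the likelihood of \<open>\<theta>\<close> is at most \<open>exp (\<epsilon> n)\<close> times an exponentially
  weighted likelihood of \<open>\<theta>\<^sub>0\<close>, by a Lyapunov function for \<open>A\<close> and by observability, which controls
  the initial state.  Compactness of \<open>\<Theta>\<close> reduces the supremum to finitely many \<open>\<theta>\<^sub>0\<close>.  Finally, by
  controllability the observation laws for any two initial states have the same null sets, so what
  holds almost surely under \<open>\<nu>\<close> holds under the stationary law; no ergodic theorem is needed.
\<close>

subsection \<open>Geometric decay of powers of stable matrices\<close>

text \<open>The obstacle is that the log-likelihood is quadratic in an unbounded state: for two
  close parameters it is not within \<open>\<epsilon> n\<close> on all paths. The discrepancy is a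
  small multiple of the energy of the observations and of the noise that they require; the energy of
  the observations is bounded on typical paths, that of the noise is put into the weight. The weight
  costs little because \<open>exp (|s|^2 / 4)\<close> is integrable under the standard Gaussian law.
  The order of choices matters: the test function and the window length fix the rate
  \<open>\<kappa>\<close> of separation, then \<open>\<eta>\<close> is chosen small against
  \<open>\<kappa>\<close>, and only then the radius of the neighbourhood. The comparison is made
  path by path for all nearby parameters at once, so one measurable set of paths serves uncountably
  many parameters. Likelihoods are taken relative to i.i.d. standard Gaussian observations instead
  of Lebesgue measure. The reference law is then a probability measure on the noise space shared by
  all models, and the common factor cancels in differences of log-likelihoods.\<close>

lemma decay_of_shifted_decay:
  fixes T :: "complex^'d \<Rightarrow> complex^'d"
  assumes lin: "\<And>x y. T (x + y) = T x + T y" "\<And>c x. T (c *s x) = c *s T x"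
    and l: "norm l < 1"
    and dec: "0 < r" "r < 1" "\<And>k. norm ((T ^^ k) (T v - l *s v)) \<le> C * r ^ k"
  shows "\<exists>C r. 0 < r \<and> r < 1 \<and> (\<forall>k. norm ((T ^^ k) v) \<le> C * r ^ k)"
proof -
  define s where "s = max r (norm l)"
  \<comment> \<open>The norms satisfy a recursion with forcing \<open>C * r ^ k\<close> and factor
    \<open>norm l\<close>, which is resonant when \<open>r = norm l\<close>. A rate strictly above
    both absorbs the polynomial factor that a Jordan block would show; \<open>K * (t - s)\<close>
    pays for the forcing.\<close>
  define t where "t = (1 + s) / 2"
  have s: "0 < s" "s < 1" "r \<le> s" "norm l \<le> s" using dec l by (auto simp: s_def)
  have t: "s < t" "t < 1" "0 < t" using s by (auto simp: t_def)
  define K where "K = max (norm v) (C / (t - s))"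
  have C0: "C \<ge> 0" using order_trans[OF norm_ge_zero dec(3)[of 0]] by simp
  have K: "norm v \<le> K" "C / (t - s) \<le> K" by (auto simp: K_def)
  have K': "C \<le> K * (t - s)" using K(2) t by (simp add: field_simps)
  have K0: "K \<ge> 0" using K(1) norm_ge_zero order_trans by blast
  have lin_k: "(T ^^ k) (x + y) = (T ^^ k) x + (T ^^ k) y" "(T ^^ k) (c *s x) = c *s (T ^^ k) x" for k x y c
    by (induct k) (auto simp: lin)
  have "norm ((T ^^ k) v) \<le> K * t ^ k" for k
  proof (induct k)
    case 0 then show ?case using K by simp
  next
    case (Suc k)
    have "T v = (T v - l *s v) + l *s v" by simp
    then have "(T ^^ Suc k) v = (T ^^ k) ((T v - l *s v) + l *s v)"
      by (simp add: funpow_swap1)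
    also have "\<dots> = (T ^^ k) (T v - l *s v) + l *s (T ^^ k) v"
      by (simp only: lin_k)
    finally have "norm ((T ^^ Suc k) v) \<le> norm ((T ^^ k) (T v - l *s v)) + norm (l *s (T ^^ k) v)"
      by (metis norm_triangle_ineq)
    also have "norm (l *s (T ^^ k) v) = norm l * norm ((T ^^ k) v)"
      by (simp add: norm_vec_def norm_mult L2_set_right_distrib)
    also have "\<dots> \<le> s * (K * t ^ k)"
      using Suc s by (intro mult_mono) auto
    also have "norm ((T ^^ k) (T v - l *s v)) \<le> C * t ^ k"
      using dec(3)[of k] C0 power_mono[of r t k] dec(1) s t
      by (meson less_eq_real_def mult_left_mono order_trans)
    also have "C * t ^ k \<le> K * (t - s) * t ^ k"
      using K' t by (intro mult_right_mono) auto
    finally show ?case by (simp add: algebra_simps)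
  qed
  then show ?thesis using t by blast
qed

text \<open>Induction on the degree in place of a Jordan form. With \<open>p = (X - l) q\<close>,
  either \<open>q\<close> already annihilates \<open>v\<close>, or \<open>q(T) v\<close> is an
  eigenvector for \<open>l\<close>, which forces \<open>norm l < 1\<close>, and \<open>q\<close>
  annihilates \<open>T v - l v\<close>, whose decay carries over to \<open>v\<close>. Roots of
  \<open>p\<close> that are not eigenvalues end up in the first case.\<close>

lemma decay_of_annihilating_poly:
  fixes M :: "complex^'d^'d" and p :: "complex poly"
  defines "T \<equiv> (*v) M"
  assumes ev: "\<And>c w. w \<noteq> 0 \<Longrightarrow> M *v w = c *s w \<Longrightarrow> norm c < 1"
    and "p \<noteq> 0" "(\<Sum>i\<le>degree p. coeff p i *s (T ^^ i) v) = 0"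
  shows "\<exists>C r. 0 < r \<and> r < 1 \<and> (\<forall>k. norm ((T ^^ k) v) \<le> C * r ^ k)"
  using assms(3,4)
proof (induction "degree p" arbitrary: p v)
  case 0
  then have "coeff p 0 \<noteq> 0" by (metis leading_coeff_0_iff)
  with 0 have "v = 0" by simp
  have "(T ^^ k) 0 = 0" for k
    by (induct k) (auto simp: T_def)
  with \<open>v = 0\<close> show ?case by (intro exI[of _ 0] exI[of _ "1/2"]) auto
next
  case (Suc n)
  have lin: "T (x + y) = T x + T y" "T (c *s x) = c *s T x" for x y c
    by (auto simp: T_def algebra_simps vector_scalar_commute)
  have lin_sum: "T (sum g I) = (\<Sum>i\<in>I. T (g i))" for g and I :: "nat set"
    by (induct I rule: infinite_finite_induct) (auto simp: lin, simp_all add: T_def)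
  from Suc have "\<not> constant (poly p)"
    by (simp add: constant_degree)
  then obtain l where "poly p l = 0"
    using fundamental_theorem_of_algebra by blast
  then obtain q where q: "p = [:-l, 1:] * q"
    using poly_eq_0_iff_dvd by (metis dvdE)
  have q0: "q \<noteq> 0" using q Suc by auto
  have dq: "degree q = n"
    using Suc(2) q q0 by (simp add: degree_mult_eq del: mult_pCons_left)
  define D where "D x = (\<Sum>i\<le>n. coeff q i *s (T ^^ i) x)" for x
  have lin_k: "(T ^^ k) (x + y) = (T ^^ k) x + (T ^^ k) y" "(T ^^ k) (c *s x) = c *s (T ^^ k) x" for k x y c
    by (induct k) (auto simp: lin)
  have cp: "coeff p i = (if i = 0 then 0 else coeff q (i - 1)) - l * coeff q i" for i
    by (cases i) (auto simp: q mult_pCons_left)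
  have pe: "(\<Sum>i\<le>degree p. coeff p i *s (T ^^ i) x) = T (D x) - l *s D x" for x
  proof -
    have "(\<Sum>i\<le>Suc n. coeff p i *s (T ^^ i) x)
        = (\<Sum>i\<le>Suc n. (if i = 0 then 0 else coeff q (i - 1)) *s (T ^^ i) x) - (\<Sum>i\<le>Suc n. (l * coeff q i) *s (T ^^ i) x)"
      by (simp add: cp sum_subtractf[symmetric] vector_sub_rdistrib del: sum.atMost_Suc)
    also have "(\<Sum>i\<le>Suc n. (l * coeff q i) *s (T ^^ i) x) = (\<Sum>i\<le>n. (l * coeff q i) *s (T ^^ i) x)"
      using dq coeff_eq_0[of q "Suc n"] by simp
    also have "\<dots> = l *s D x"
      by (simp add: D_def vec.scale_sum_right)
    also have "(\<Sum>i\<le>Suc n. (if i = 0 then 0 else coeff q (i - 1)) *s (T ^^ i) x) = (\<Sum>i\<le>n. coeff q i *s (T ^^ Suc i) x)"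
      by (subst sum.atMost_Suc_shift) simp
    also have "\<dots> = T (D x)"
      by (simp add: D_def lin_sum lin)
    finally show ?thesis using Suc(2) by simp
  qed
  show ?case
  proof (cases "D v = 0")
    case True
    then show ?thesis using Suc(1)[of q v] dq q0 by (simp add: D_def)
  next
    case False
    have eq: "T (D v) = l *s D v" using pe[of v] Suc(4) by simp
    then have l: "norm l < 1" using ev[OF False] by (simp add: T_def)
    have "D (T v - l *s v) = T (D v) - l *s D v"
    proof -
      have "(T ^^ i) (T v - l *s v) = T ((T ^^ i) v) - l *s (T ^^ i) v" for i
        using lin_k(1)[of i "T v - l *s v" "l *s v"] by (simp add: lin_k funpow_swap1)
      then show ?thesis
        by (simp add: D_def lin_sum lin vec.scale_sum_right sum_subtractf vec.scale_right_diff_distrib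
              mult.commute)
    qed
    with eq have "D (T v - l *s v) = 0" by simp
    then obtain C r where "0 < r" "r < 1" "\<forall>k. norm ((T ^^ k) (T v - l *s v)) \<le> C * r ^ k"
      using Suc(1)[of q "T v - l *s v"] dq q0 by (auto simp: D_def)
    then show ?thesis using decay_of_shifted_decay[OF lin l] by blast
  qed
qed

text \<open>More iterates than the dimension are linearly dependent. \<open>DIM\<close> is the real
  dimension, so the coefficients found are real.\<close>

lemma exists_annihilating_poly:
  fixes T :: "complex^'d \<Rightarrow> complex^'d"
  shows "\<exists>p. p \<noteq> 0 \<and> (\<Sum>i\<le>degree p. coeff p i *s (T ^^ i) v) = 0"
proof -
  let ?N = "DIM(complex^'d)"
  obtain c :: "nat \<Rightarrow> real" where c: "\<exists>i\<le>?N. c i \<noteq> 0" "(\<Sum>i\<le>?N. c i *\<^sub>R (T ^^ i) v) = 0"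
  proof (cases "inj_on (\<lambda>i. (T ^^ i) v) {..?N}")
    case True
    let ?S = "(\<lambda>i. (T ^^ i) v) ` {..?N}"
    have "card ?S = ?N + 1" using True by (simp add: card_image)
    then have "dependent ?S"
      using independent_bound[of ?S] by auto
    then obtain u where u: "\<exists>v\<in>?S. u v \<noteq> 0" "(\<Sum>v\<in>?S. u v *\<^sub>R v) = 0"
      using dependent_finite[of ?S] by auto
    show ?thesis
      using u True by (intro that[of "\<lambda>i. u ((T ^^ i) v)"]) (auto simp: sum.reindex)
  next
    \<comment> \<open>Dependence is a property of sets, so a repeated iterate has to be treated
      apart; it gives the polynomial \<open>X^i - X^j\<close>.\<close>
    case False
    then obtain i j where ij: "i \<le> ?N" "j \<le> ?N" "i \<noteq> j" "(T ^^ i) v = (T ^^ j) v"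
      by (auto simp: inj_on_def)
    let ?c = "\<lambda>k. (if k = i then 1 else 0) - (if k = j then 1 else (0::real))"
    have "(\<Sum>k\<le>?N. ?c k *\<^sub>R (T ^^ k) v) = (T ^^ i) v - (T ^^ j) v"
      using ij by (simp add: scaleR_diff_left sum_subtractf if_distrib[of "\<lambda>x. x *\<^sub>R _"] sum.delta cong: if_cong)
    then show ?thesis using ij by (intro that[of ?c]) auto
  qed
  define p where "p = (\<Sum>i\<le>?N. monom (complex_of_real (c i)) i)"
  have cf: "coeff p i = (if i \<le> ?N then complex_of_real (c i) else 0)" for i
    by (auto simp: p_def coeff_sum sum.delta if_distrib cong: if_cong)
  have "p \<noteq> 0" using c(1) cf by (metis coeff_0 of_real_eq_0_iff)
  have dp: "degree p \<le> ?N" by (rule degree_le) (simp add: cf)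
  have "(\<Sum>i\<le>degree p. coeff p i *s (T ^^ i) v) = (\<Sum>i\<le>?N. coeff p i *s (T ^^ i) v)"
    by (rule sum.mono_neutral_left) (use dp in \<open>auto simp: coeff_eq_0\<close>)
  also have "\<dots> = (\<Sum>i\<le>?N. c i *\<^sub>R (T ^^ i) v)"
    by (intro sum.cong) (auto simp: cf vec_eq_iff scaleR_conv_of_real[where 'a = complex])
  finally show ?thesis using c \<open>p \<noteq> 0\<close> by auto
qed

lemma matpow_apply: "matpow A k *v x = (((*v) A) ^^ k) x"
  by (induct k) (auto simp: matrix_vector_mul_assoc[symmetric])

text \<open>The eigenvalue condition lives over the complex numbers, so orbits are embedded there
  isometrically. Decay is obtained for each vector with its own rate and made uniform by the largest
  rate among the basis vectors.\<close>

lemma matpow_decay: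
  fixes A :: "real^'d^'d"
  assumes "\<And>c. complex_eigenvalue A c \<Longrightarrow> norm c < 1"
  shows "\<exists>C r. 0 \<le> C \<and> 0 < r \<and> r < 1 \<and> (\<forall>k x. norm (matpow A k *v x) \<le> C * r ^ k * norm x)"
proof -
  let ?M = "map_matrix complex_of_real A"
  let ?T = "(*v) ?M"
  let ?c = "\<lambda>x::real^'d. (\<chi> i. complex_of_real (x $ i)) :: complex^'d"
  have ev: "norm c < 1" if "w \<noteq> 0" "?M *v w = c *s w" for c w
    using assms[of c] that unfolding complex_eigenvalue_def by blast
  have com: "?c (A *v x) = ?T (?c x)" for x
    by (simp add: vec_eq_iff matrix_vector_mult_def map_matrix_def)
  have com_k: "?c (matpow A k *v x) = (?T ^^ k) (?c x)" for k x
    by (induct k) (auto simp: matrix_vector_mul_assoc[symmetric] com)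
  have nc: "norm (?c x) = norm x" for x
    by (simp add: norm_vec_def)
  have ex: "\<exists>C r. 0 < r \<and> r < 1 \<and> (\<forall>k. norm (matpow A k *v x) \<le> C * r ^ k)" for x
  proof -
    obtain p where "p \<noteq> 0" "(\<Sum>i\<le>degree p. coeff p i *s (?T ^^ i) (?c x)) = 0"
      using exists_annihilating_poly[of "?T" "?c x"] by blast
    then have "\<exists>C r. 0 < r \<and> r < 1 \<and> (\<forall>k. norm ((?T ^^ k) (?c x)) \<le> C * r ^ k)"
      by (intro decay_of_annihilating_poly[of ?M p] ev)
    then show ?thesis unfolding com_k[symmetric] nc .
  qed
  then obtain C r where Cr: "\<And>x. 0 < r x" "\<And>x. r x < 1" "\<And>x k. norm (matpow A k *v x) \<le> C x * r x ^ k"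
    by metis
  have C0: "C x \<ge> 0" for x using order_trans[OF norm_ge_zero Cr(3)[of 0 x]] by simp
  define s where "s = Max (range (\<lambda>i. r (axis i 1)))"
  have s: "r (axis i 1) \<le> s" for i unfolding s_def by (rule Max_ge) auto
  have s1: "s < 1" unfolding s_def using Cr(2) by (subst Max_less_iff) auto
  have s0: "s > 0" using Cr(1)[of "axis undefined 1"] s[of undefined] by simp
  define K where "K = (\<Sum>i\<in>UNIV. C (axis i 1))"
  have "norm (matpow A k *v x) \<le> K * s ^ k * norm x" for k x
  proof -
    have "matpow A k *v x = matpow A k *v (\<Sum>i\<in>UNIV. x $ i *s axis i 1)"
      by (simp add: basis_expansion)
    also have "\<dots> = (\<Sum>i\<in>UNIV. x $ i *s (matpow A k *v axis i 1))"
      by (simp add: linear_sum[OF matrix_vector_mul_linear] vector_scalar_commute)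
    finally have "norm (matpow A k *v x) \<le> (\<Sum>i\<in>UNIV. norm (x $ i *s (matpow A k *v axis i 1)))"
      by (simp add: norm_sum)
    also have "\<dots> \<le> (\<Sum>i\<in>UNIV. norm x * (C (axis i 1) * s ^ k))"
    proof (rule sum_mono)
      fix i
      have "norm (matpow A k *v axis i 1) \<le> C (axis i 1) * r (axis i 1) ^ k" by (rule Cr)
      also have "\<dots> \<le> C (axis i 1) * s ^ k"
        using C0 Cr(1) s by (intro mult_left_mono power_mono) (auto intro: less_imp_le)
      finally have *: "norm (matpow A k *v axis i 1) \<le> C (axis i 1) * s ^ k" .
      have "norm (x $ i *s (matpow A k *v axis i 1)) = \<bar>x $ i\<bar> * norm (matpow A k *v axis i 1)"
        by (simp add: scalar_mult_eq_scaleR)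
      also have "\<dots> \<le> norm x * (C (axis i 1) * s ^ k)"
        using * component_le_norm_cart[of x i] by (intro mult_mono) auto
      finally show "norm (x $ i *s (matpow A k *v axis i 1)) \<le> norm x * (C (axis i 1) * s ^ k)" .
    qed
    also have "\<dots> = K * s ^ k * norm x"
      by (simp add: K_def sum_distrib_left sum_distrib_right mult_ac)
    finally show ?thesis .
  qed
  moreover have "K \<ge> 0" unfolding K_def by (intro sum_nonneg C0)
  ultimately show ?thesis using s0 s1 by blast
qed

subsection \<open>Energy estimates for the state recursion\<close>

lemma norm_matrix_vector_mult_le: "norm (M *v x) \<le> norm M * norm (x :: real^'n)" for M :: "real^'n^'m"
proof -
  have "norm (M *v x) \<le> L2_set (\<lambda>i. norm (M $ i) * norm x) UNIV"
    unfolding norm_vec_def[of "M *v x"]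
    by (rule L2_set_mono) (auto simp: matrix_vector_mul_component Cauchy_Schwarz_ineq2)
  also have "\<dots> = norm M * norm x"
    by (simp add: norm_vec_def[of M] L2_set_left_distrib)
  finally show ?thesis .
qed

lemma norm_matrix_vector_mult_sq_le:
  fixes M :: "real^'n^'m"
  assumes "norm M \<le> c"
  shows "(norm (M *v x))\<^sup>2 \<le> c\<^sup>2 * (norm x)\<^sup>2"
proof -
  have "norm (M *v x) \<le> c * norm x"
    using norm_matrix_vector_mult_le[of M x] assms
    by (meson mult_right_mono norm_ge_zero order_trans)
  then have "(norm (M *v x))\<^sup>2 \<le> (c * norm x)\<^sup>2" by (rule power_mono) simp
  then show ?thesis by (simp add: power_mult_distrib)
qed

text \<open>Young's inequality; the free parameter keeps the factor of the first square close to 1,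
  so that a contraction survives the perturbation.\<close>

lemma norm_add_sq_le_weighted:
  fixes a b :: "'a::real_inner"
  assumes "0 < d"
  shows "(norm (a + b))\<^sup>2 \<le> (1 + d) * (norm a)\<^sup>2 + (1 + 1 / d) * (norm b)\<^sup>2"
proof -
  have "0 \<le> (norm (sqrt d *\<^sub>R a - (1 / sqrt d) *\<^sub>R b))\<^sup>2" by simp
  also have "\<dots> = d * (norm a)\<^sup>2 - 2 * (a \<bullet> b) + (norm b)\<^sup>2 / d"
    using assms by (simp add: power2_norm_eq_inner inner_diff_left inner_diff_right inner_commute
        real_sqrt_mult_self field_simps)
  finally have "2 * (a \<bullet> b) \<le> d * (norm a)\<^sup>2 + (norm b)\<^sup>2 / d" by simp
  moreover have "(norm (a + b))\<^sup>2 = (norm a)\<^sup>2 + 2 * (a \<bullet> b) + (norm b)\<^sup>2"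
    by (simp add: power2_norm_eq_inner inner_add_left inner_add_right inner_commute)
  ultimately show ?thesis by (simp add: algebra_simps)
qed

lemma norm_add_sq_le: "(norm (a + b))\<^sup>2 \<le> 2 * (norm a)\<^sup>2 + 2 * (norm b)\<^sup>2" for a b :: "'a::real_inner"
  using norm_add_sq_le_weighted[of 1 a b] by simp

lemma norm_diff_sq_le: "(norm (a - b))\<^sup>2 \<le> 2 * (norm a)\<^sup>2 + 2 * (norm b)\<^sup>2" for a b :: "'a::real_inner"
  using norm_add_sq_le[of a "- b"] by simp

locale linear_model =
  fixes A :: "real^'d^'d" and R :: "real^'q^'d" and B :: "real^'d^'p" and S :: "real^'p^'p"
  assumes stable: "\<And>c. complex_eigenvalue A c \<Longrightarrow> norm c < 1"
    and observ: "observable A B"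
    and control: "controllable A R"
    and full_rank_S: "full_rank S"
begin

text \<open>For \<open>m\<close> with \<open>\<bar>A\<^sup>m z\<bar> \<le> \<bar>z\<bar> / 2\<close>, the form \<open>V z = (\<Sum>j<m. \<bar>A\<^sup>j z\<bar>\<^sup>2)\<close> is a Lyapunov function.\<close>

lemma l2_gain:
  "\<exists>K\<ge>0. \<forall>n z f. (\<forall>k<n. z (Suc k) = A *v z k + f k) \<longrightarrow>
     (\<Sum>k\<le>n. (norm (z k))\<^sup>2) \<le> K * ((norm (z 0))\<^sup>2 + (\<Sum>k<n. (norm (f k))\<^sup>2))"
proof -
  obtain C r where Cr: "0 \<le> C" "0 < r" "r < 1" "\<And>k x. norm (matpow A k *v x) \<le> C * r ^ k * norm x"
    using matpow_decay[of A] stable by blast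
  have "(\<lambda>m. C * r ^ m) \<longlonglongrightarrow> C * 0"
    using Cr by (intro tendsto_intros LIMSEQ_power_zero) auto
  then have "eventually (\<lambda>m. C * r ^ m < 1/2) sequentially"
    by (rule order_tendstoD) simp
  then obtain m0 where m0: "\<And>m. m \<ge> m0 \<Longrightarrow> C * r ^ m < 1/2"
    by (auto simp: eventually_sequentially)
  define m where "m = Suc m0"
  define V where "V z = (\<Sum>j<m. (norm (matpow A j *v z))\<^sup>2)" for z
  define L where "L = (\<Sum>j<m. (C * r ^ j)\<^sup>2)"
  \<comment> \<open>Since \<open>V z \<le> L * |z|^2\<close> and \<open>d * L \<le> 1/4\<close>, the
    loss \<open>d * V z\<close> uses up at most a third of the decrease
    \<open>3/4 * |z|^2\<close>.\<close>
  define d where "d = 1 / (4 * (L + 1))"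
  define G where "G = (1 + 1 / d) * L"
  have L0: "L \<ge> 0" unfolding L_def by (intro sum_nonneg) auto
  have d0: "d > 0" "d * L \<le> 1/4" using L0 by (auto simp: d_def field_simps)
  have G0: "G \<ge> 0" using L0 d0 by (simp add: G_def)
  have VL: "V z \<le> L * (norm z)\<^sup>2" for z
    unfolding V_def L_def sum_distrib_right
  proof (rule sum_mono)
    fix j
    have "(norm (matpow A j *v z))\<^sup>2 \<le> (C * r ^ j * norm z)\<^sup>2" by (intro power_mono Cr) simp
    then show "(norm (matpow A j *v z))\<^sup>2 \<le> (C * r ^ j)\<^sup>2 * (norm z)\<^sup>2" by (simp add: power_mult_distrib)
  qed
  have Vge: "(norm z)\<^sup>2 \<le> V z" for z
    unfolding V_def m_def by (subst sum.lessThan_Suc_shift) (simp add: sum_nonneg)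
  \<comment> \<open>Applying \<open>A\<close> shifts the sum: the term \<open>|z|^2\<close> leaves
    and \<open>|A^m z|^2 \<le> |z|^2 / 4\<close> enters.\<close>
  have VA: "V (A *v z) \<le> V z - 3/4 * (norm z)\<^sup>2" for z
  proof -
    have sw: "matpow A j *v (A *v z) = matpow A (Suc j) *v z" for j
      by (simp only: matpow_apply funpow_swap1 funpow.simps o_def)
    have "V (A *v z) + (norm z)\<^sup>2 = (\<Sum>j<Suc m. (norm (matpow A j *v z))\<^sup>2)"
      unfolding V_def sw by (subst sum.lessThan_Suc_shift) simp
    also have "\<dots> = V z + (norm (matpow A m *v z))\<^sup>2" by (simp add: V_def)
    also have "(norm (matpow A m *v z))\<^sup>2 \<le> (1/2 * norm z)\<^sup>2"
    proof (rule power_mono)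
      have "C * r ^ m * norm z \<le> 1/2 * norm z"
        using m0[of m] by (intro mult_right_mono) (auto simp: m_def)
      then show "norm (matpow A m *v z) \<le> 1/2 * norm z" using Cr(4)[of m z] by simp
    qed simp
    finally show ?thesis by (simp add: power2_eq_square)
  qed
  have Vadd: "V (a + b) \<le> (1 + d) * V a + (1 + 1 / d) * V b" for a b
    unfolding V_def sum_distrib_left sum.distrib[symmetric]
    by (rule sum_mono) (simp add: norm_add_sq_le_weighted d0 matrix_vector_right_distrib)
  have step: "V (A *v z + f) + 1/2 * (norm z)\<^sup>2 \<le> V z + G * (norm f)\<^sup>2" for z f
  proof -
    have "V (A *v z + f) \<le> (1 + d) * V (A *v z) + (1 + 1 / d) * V f" by (rule Vadd)
    also have "(1 + d) * V (A *v z) \<le> (1 + d) * (V z - 3/4 * (norm z)\<^sup>2)"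
      using VA d0 by (intro mult_left_mono) auto
    also have "(1 + 1 / d) * V f \<le> G * (norm f)\<^sup>2"
      unfolding G_def using VL[of f] d0 by (simp add: mult_left_mono mult.assoc)
    also have "(1 + d) * (V z - 3/4 * (norm z)\<^sup>2) \<le> V z - 1/2 * (norm z)\<^sup>2"
    proof -
      have "d * V z \<le> d * (L * (norm z)\<^sup>2)" using VL d0 by (intro mult_left_mono) auto
      also have "\<dots> \<le> 1/4 * (norm z)\<^sup>2"
        using d0 mult_right_mono[of "d * L" "1/4" "(norm z)\<^sup>2"] by (simp add: mult.assoc)
      finally show ?thesis
      proof -
        assume *: "d * V z \<le> 1/4 * (norm z)\<^sup>2"
        have "(1 + d) * (V z - 3/4 * (norm z)\<^sup>2) = V z + d * V z - 3/4 * (norm z)\<^sup>2 - 3/4 * (d * (norm z)\<^sup>2)"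
          by (simp add: algebra_simps)
        moreover have "0 \<le> d * (norm z)\<^sup>2" using d0 by simp
        ultimately show ?thesis using * by linarith
      qed
    qed
    finally show ?thesis by simp
  qed
  have main: "V (z n) + 1/2 * (\<Sum>k<n. (norm (z k))\<^sup>2) \<le> V (z 0) + G * (\<Sum>k<n. (norm (f k))\<^sup>2)"
    if "\<forall>k<n. z (Suc k) = A *v z k + f k" for n z f
    using that
  proof (induction n)
    case (Suc n)
    then show ?case using step[of "z n" "f n"] by (simp add: algebra_simps)
  qed simp
  have "(\<Sum>k\<le>n. (norm (z k))\<^sup>2) \<le> (2 * (L + G)) * ((norm (z 0))\<^sup>2 + (\<Sum>k<n. (norm (f k))\<^sup>2))"
    if "\<forall>k<n. z (Suc k) = A *v z k + f k" for n z f
  proof -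
    have "(\<Sum>k\<le>n. (norm (z k))\<^sup>2) = (\<Sum>k<n. (norm (z k))\<^sup>2) + (norm (z n))\<^sup>2"
      by (simp add: lessThan_Suc_atMost[symmetric])
    also have "\<dots> \<le> 2 * (V (z n) + 1/2 * (\<Sum>k<n. (norm (z k))\<^sup>2))"
      using Vge[of "z n"] order_trans[OF zero_le_power2 Vge[of "z n"]] by simp
    also have "\<dots> \<le> 2 * (V (z 0) + G * (\<Sum>k<n. (norm (f k))\<^sup>2))"
      using main[OF that] by simp
    also have "\<dots> \<le> 2 * ((L + G) * (norm (z 0))\<^sup>2 + (L + G) * (\<Sum>k<n. (norm (f k))\<^sup>2))"
      using VL[of "z 0"] G0 L0 by (intro mult_left_mono add_mono mult_right_mono order_trans[OF VL])
        (auto simp: sum_nonneg)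
    finally show ?thesis by (simp add: algebra_simps)
  qed
  then show ?thesis using L0 G0 by (intro exI[of _ "2 * (L + G)"]) auto
qed

text \<open>The matrix has at least as many rows as columns, so full rank means injective, and an
  injective linear map in finite dimension is bounded below.\<close>

lemma observability_bound:
  "\<exists>K\<ge>0. \<forall>x. (norm x)\<^sup>2 \<le> K * (\<Sum>k<CARD('d). (norm (B *v (matpow A k *v x)))\<^sup>2)"
proof -
  let ?O = "observability_matrix A B"
  have "rank ?O = min CARD('d \<times> 'p) CARD('d)"
    using observ by (simp add: observable_def full_rank_def)
  moreover have "CARD('d) * 1 \<le> CARD('d) * CARD('p)"
    by (intro mult_le_mono2) (simp add: Suc_le_eq)
  then have "min CARD('d \<times> 'p) CARD('d) = CARD('d)"
    by (simp only: card_prod mult_1_right min_absorb1 min_absorb2)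
  ultimately have "inj ((*v) ?O)" by (simp add: full_rank_injective)
  then obtain c where c: "c > 0" "\<And>x. norm (?O *v x) \<ge> c * norm x"
    using linear_inj_bounded_below_pos[OF matrix_vector_mul_linear] by blast
  have "(norm x)\<^sup>2 \<le> 1 / c\<^sup>2 * (\<Sum>k<CARD('d). (norm (B *v (matpow A k *v x)))\<^sup>2)" for x
  proof -
    have cmp: "(?O *v x) $ ij = (B *v (matpow A (to_nat_on (UNIV :: 'd set) (fst ij)) *v x)) $ snd ij" for ij
      unfolding matrix_vector_mul_assoc by (simp add: observability_matrix_def matrix_vector_mult_def)
    have "(norm (?O *v x))\<^sup>2 = (\<Sum>ij\<in>UNIV. ((?O *v x) $ ij)\<^sup>2)"
      by (simp add: norm_vec_def L2_set_def sum_nonneg)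
    also have "\<dots> = (\<Sum>i\<in>UNIV. \<Sum>j\<in>UNIV. ((?O *v x) $ (i, j))\<^sup>2)"
      by (simp add: sum.cartesian_product UNIV_Times_UNIV[symmetric] del: UNIV_Times_UNIV)
    also have "\<dots> = (\<Sum>i\<in>UNIV. (norm (B *v (matpow A (to_nat_on (UNIV :: 'd set) i) *v x)))\<^sup>2)"
      by (simp add: cmp norm_vec_def L2_set_def sum_nonneg)
    also have "\<dots> = (\<Sum>k<CARD('d). (norm (B *v (matpow A k *v x)))\<^sup>2)"
      by (rule sum.reindex_bij_betw) (rule to_nat_on_finite, simp)
    finally have "(\<Sum>k<CARD('d). (norm (B *v (matpow A k *v x)))\<^sup>2) = (norm (?O *v x))\<^sup>2" by simp
    moreover have "(c * norm x)\<^sup>2 \<le> (norm (?O *v x))\<^sup>2"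
      using c by (intro power_mono) auto
    ultimately show ?thesis using c by (simp add: power_mult_distrib field_simps)
  qed
  then show ?thesis by (intro exI[of _ "1 / c\<^sup>2"]) auto
qed

text \<open>Here full rank means surjective. The inputs \<open>h\<close>, applied in reverse order
  of time, steer the state from 0 to \<open>t\<close> in \<open>CARD('d)\<close> steps.\<close>

lemma controllability:
  "\<exists>h. (\<Sum>j<CARD('d). matpow A j *v (R *v h j)) = t"
proof -
  let ?C = "controllability_matrix A R"
  let ?i = "to_nat_on (UNIV :: 'd set)"
  have "rank ?C = min CARD('d) CARD('d \<times> 'q)"
    using control by (simp add: controllable_def full_rank_def)
  moreover have "CARD('d) * 1 \<le> CARD('d) * CARD('q)"
    by (intro mult_le_mono2) (simp add: Suc_le_eq)
  then have "min CARD('d) CARD('d \<times> 'q) = CARD('d)"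
    by (simp only: card_prod mult_1_right min_absorb1 min_absorb2)
  ultimately have "surj ((*v) ?C)" by (simp add: full_rank_surjective)
  then obtain g where g: "?C *v g = t" by (metis surjD)
  define h where "h j = (\<chi> l. g $ (from_nat_into (UNIV :: 'd set) j, l))" for j :: nat
  have h: "h (?i j) = (\<chi> l. g $ (j, l))" for j
    by (simp add: h_def)
  have "t $ k = (\<Sum>j\<in>UNIV. matpow A (?i j) *v (R *v h (?i j))) $ k" for k
  proof -
    have "t $ k = (\<Sum>jl\<in>UNIV. ?C $ k $ jl * g $ jl)"
      by (simp add: g[symmetric] matrix_vector_mult_def)
    also have "\<dots> = (\<Sum>j\<in>UNIV. \<Sum>l\<in>UNIV. ?C $ k $ (j, l) * g $ (j, l))"
      by (simp add: sum.cartesian_product UNIV_Times_UNIV[symmetric] del: UNIV_Times_UNIV)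
    also have "\<dots> = (\<Sum>j\<in>UNIV. ((matpow A (?i j) ** R) *v h (?i j)) $ k)"
      by (simp add: h controllability_matrix_def matrix_vector_mult_def)
    finally show ?thesis by (simp add: matrix_vector_mul_assoc)
  qed
  then have "t = (\<Sum>j\<in>UNIV. matpow A (?i j) *v (R *v h (?i j)))" by (simp add: vec_eq_iff)
  also have "\<dots> = (\<Sum>j<CARD('d). matpow A j *v (R *v h j))"
    by (rule sum.reindex_bij_betw) (rule to_nat_on_finite, simp)
  finally show ?thesis by (intro exI[of _ h]) simp
qed

abbreviation X :: "real^'d \<Rightarrow> (nat \<Rightarrow> (real^'q) \<times> (real^'p)) \<Rightarrow> nat \<Rightarrow> real^'d"
  where "X \<equiv> state A R"

lemma state_energy:
  "\<exists>K\<ge>0. \<forall>n x w. (\<Sum>k\<le>n. (norm (X x w k))\<^sup>2) \<le> K * ((norm x)\<^sup>2 + (\<Sum>k\<le>n. (norm (fst (w k)))\<^sup>2))"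
proof -
  obtain K where K: "K \<ge> 0" "\<And>n z f. (\<forall>k<n. z (Suc k) = A *v z k + f k) \<Longrightarrow>
     (\<Sum>k\<le>n. (norm (z k))\<^sup>2) \<le> K * ((norm (z 0))\<^sup>2 + (\<Sum>k<n. (norm (f k))\<^sup>2))"
    using l2_gain by blast
  define G where "G = max 1 ((norm R)\<^sup>2)"
  have G: "G \<ge> 1" "G \<ge> (norm R)\<^sup>2" by (auto simp: G_def)
  have "(\<Sum>k\<le>n. (norm (X x w k))\<^sup>2) \<le> K * G * ((norm x)\<^sup>2 + (\<Sum>k\<le>n. (norm (fst (w k)))\<^sup>2))" for n x w
  proof -
    have "(\<Sum>k\<le>n. (norm (X x w k))\<^sup>2) \<le> K * ((norm x)\<^sup>2 + (\<Sum>k<n. (norm (R *v fst (w k)))\<^sup>2))"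
      using K(2)[of n "X x w" "\<lambda>k. R *v fst (w k)"] by simp
    also have "\<dots> \<le> K * (G * (norm x)\<^sup>2 + (\<Sum>k\<le>n. G * (norm (fst (w k)))\<^sup>2))"
    proof (intro mult_left_mono add_mono K)
      show "(norm x)\<^sup>2 \<le> G * (norm x)\<^sup>2"
        using mult_right_mono[OF G(1), of "(norm x)\<^sup>2"] by simp
      have "(norm (R *v fst (w k)))\<^sup>2 \<le> G * (norm (fst (w k)))\<^sup>2" for k
        using norm_matrix_vector_mult_sq_le[of R "norm R" "fst (w k)"] G
        by (meson mult_right_mono order_refl order_trans zero_le_power2)
      then have "(\<Sum>k<n. (norm (R *v fst (w k)))\<^sup>2) \<le> (\<Sum>k<n. G * (norm (fst (w k)))\<^sup>2)"
        by (intro sum_mono)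
      also have "\<dots> \<le> (\<Sum>k\<le>n. G * (norm (fst (w k)))\<^sup>2)"
        using G by (intro sum_mono2) auto
      finally show "(\<Sum>k<n. (norm (R *v fst (w k)))\<^sup>2) \<le> (\<Sum>k\<le>n. G * (norm (fst (w k)))\<^sup>2)" .
    qed
    also have "\<dots> = K * G * ((norm x)\<^sup>2 + (\<Sum>k\<le>n. (norm (fst (w k)))\<^sup>2))"
      by (simp add: sum_distrib_left algebra_simps)
    finally show ?thesis .
  qed
  then show ?thesis using K G by (intro exI[of _ "K * G"]) auto
qed

text \<open>\<open>A^k x\<close> is the difference of the runs from \<open>x\<close> and from 0 with
  the same noise, so \<open>B A^k x\<close> is expressed by \<open>y k\<close>, the residual and a
  state driven by noise alone; observability then recovers \<open>x\<close>. The path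
  \<open>y\<close> is arbitrary because the bound is used inside likelihoods, where \<open>y\<close>
  need not be produced by \<open>w\<close>.\<close>

lemma initial_energy:
  "\<exists>K\<ge>0. \<forall>n x w y. CARD('d) \<le> n \<longrightarrow> (norm x)\<^sup>2 \<le>
     K * (\<Sum>k\<le>n. (norm (y k))\<^sup>2 + (norm (y k - B *v X x w k))\<^sup>2 + (norm (fst (w k)))\<^sup>2)"
proof -
  obtain K1 where K1: "K1 \<ge> 0" "\<And>x. (norm x)\<^sup>2 \<le> K1 * (\<Sum>k<CARD('d). (norm (B *v (matpow A k *v x)))\<^sup>2)"
    using observability_bound by blast
  obtain K2 where K2: "K2 \<ge> 0" "\<And>n x w. (\<Sum>k\<le>n. (norm (X x w k))\<^sup>2) \<le> K2 * ((norm x)\<^sup>2 + (\<Sum>k\<le>n. (norm (fst (w k)))\<^sup>2))"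
    using state_energy by blast
  have split: "X x w k = matpow A k *v x + X 0 w k" for x w k
    by (induct k) (auto simp: matrix_vector_mul_assoc[symmetric] algebra_simps)
  define K where "K = K1 * max 6 (3 * (norm B)\<^sup>2 * K2)"
  have K: "K1 * 3 \<le> K" "K1 * (3 * (norm B)\<^sup>2 * K2) \<le> K" "0 \<le> K"
    unfolding K_def using K1 by (auto intro!: mult_left_mono mult_nonneg_nonneg)
  have "(norm x)\<^sup>2 \<le> K * (\<Sum>k\<le>n. (norm (y k))\<^sup>2 + (norm (y k - B *v X x w k))\<^sup>2 + (norm (fst (w k)))\<^sup>2)"
    if n: "CARD('d) \<le> n" for n x w y
  proof -
    let ?b = "(norm B)\<^sup>2"
    have tri: "(norm (a - b - c))\<^sup>2 \<le> 3 * (norm a)\<^sup>2 + 3 * (norm b)\<^sup>2 + 3 * (norm c)\<^sup>2" for a b c :: "real^'p"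
      using norm_add_sq_le_weighted[of "1/2" "a - b" "-c"] norm_diff_sq_le[of a b] by simp
    have pt: "(norm (B *v (matpow A k *v x)))\<^sup>2 \<le>
       3 * ((norm (y k))\<^sup>2 + (norm (y k - B *v X x w k))\<^sup>2) + 3 * ?b * (norm (X 0 w k))\<^sup>2" for k
    proof -
      have "B *v (matpow A k *v x) = y k - (y k - B *v X x w k) - B *v X 0 w k"
        by (simp add: split[of x] algebra_simps)
      then have "(norm (B *v (matpow A k *v x)))\<^sup>2 \<le> 3 * (norm (y k))\<^sup>2 + 3 * (norm (y k - B *v X x w k))\<^sup>2 + 3 * (norm (B *v X 0 w k))\<^sup>2"
        using tri by metis
      with norm_matrix_vector_mult_sq_le[of B "norm B" "X 0 w k"] show ?thesis by simp
    qed
    let ?P = "\<Sum>k\<le>n. (norm (y k))\<^sup>2 + (norm (y k - B *v X x w k))\<^sup>2"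
    let ?U = "\<Sum>k\<le>n. (norm (fst (w k)))\<^sup>2"
    have "(norm x)\<^sup>2 \<le> K1 * (\<Sum>k<CARD('d). (norm (B *v (matpow A k *v x)))\<^sup>2)" by (rule K1)
    also have "(\<Sum>k<CARD('d). (norm (B *v (matpow A k *v x)))\<^sup>2) \<le> (\<Sum>k\<le>n. (norm (B *v (matpow A k *v x)))\<^sup>2)"
      using n by (intro sum_mono2) auto
    also have "\<dots> \<le> (\<Sum>k\<le>n. 3 * ((norm (y k))\<^sup>2 + (norm (y k - B *v X x w k))\<^sup>2) + 3 * ?b * (norm (X 0 w k))\<^sup>2)"
      by (intro sum_mono pt)
    also have "\<dots> = 3 * ?P + 3 * ?b * (\<Sum>k\<le>n. (norm (X 0 w k))\<^sup>2)"
      by (simp add: sum.distrib sum_distrib_left)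
    also have "\<dots> \<le> 3 * ?P + 3 * ?b * (K2 * ?U)"
      using K2(2)[of 0 w n] by (intro add_left_mono mult_left_mono) auto
    finally have "(norm x)\<^sup>2 \<le> K1 * (3 * ?P + 3 * ?b * (K2 * ?U))"
      using K1 by (simp add: mult_left_mono)
    also have "\<dots> = (K1 * 3) * ?P + (K1 * (3 * ?b * K2)) * ?U" by (simp add: algebra_simps)
    also have "\<dots> \<le> K * ?P + K * ?U"
      using K by (intro add_mono mult_right_mono) (auto intro!: sum_nonneg)
    also have "\<dots> = K * (\<Sum>k\<le>n. (norm (y k))\<^sup>2 + (norm (y k - B *v X x w k))\<^sup>2 + (norm (fst (w k)))\<^sup>2)"
      by (simp add: sum.distrib algebra_simps)
    finally show ?thesis .
  qed
  then show ?thesis using K by blast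
qed

lemma S_inverse: "S ** matrix_inv S = mat 1" "matrix_inv S ** S = mat 1" "det S \<noteq> 0"
proof -
  have "rank S = CARD('p)" using full_rank_S by (simp add: full_rank_def)
  then have "inj ((*v) S)" by (simp add: full_rank_injective)
  then have "invertible S"
    by (simp add: invertible_left_inverse matrix_left_invertible_injective)
  then show "S ** matrix_inv S = mat 1" "matrix_inv S ** S = mat 1" "det S \<noteq> 0"
    using invertible_det_nz[of S] someI_ex[of "\<lambda>M. S ** M = mat 1 \<and> M ** S = mat 1"]
    unfolding invertible_def matrix_inv_def by auto
qed

abbreviation F where "F \<equiv> matrix_inv S"
text \<open>The observation noise that the path \<open>y\<close> requires when the state noise is
  that of \<open>w\<close>.\<close>

abbreviation resid where "resid x w y k \<equiv> F *v (y k - B *v X x w k)"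

text \<open>\<open>F'\<close> and \<open>H'\<close> stand for the perturbed \<open>S^-1\<close> and
  \<open>S^-1 B\<close>. The difference of the two state runs follows the recursion of the
  unperturbed \<open>A\<close> with a small forcing, so \<open>l2_gain\<close> bounds it by the
  state energy. That energy, the initial state included, is bounded through
  \<open>initial_energy\<close> by quantities already on the right, which is why no term in
  \<open>x\<close> remains.\<close>

lemma residual_perturbation:
  assumes "0 < \<eta>"
  shows "\<exists>d>0. \<forall>A' R' F' H'. norm (A' - A) \<le> d \<longrightarrow> norm (R' - R) \<le> d \<longrightarrow> norm (F' - F) \<le> d \<longrightarrow>
    norm (H' - F ** B) \<le> d \<longrightarrow> (\<forall>n x w y. CARD('d) \<le> n \<longrightarrow>
      (\<Sum>k\<le>n. (norm (resid x w y k))\<^sup>2) \<le> (\<Sum>k\<le>n. (norm (F' *v y k - H' *v state A' R' x w k))\<^sup>2)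
        + \<eta> * (\<Sum>k\<le>n. (norm (resid x w y k))\<^sup>2 + (norm (fst (w k)))\<^sup>2 + (norm (y k))\<^sup>2))"
proof -
  obtain K0 where K0: "K0 \<ge> 0" "\<And>n z f. (\<forall>k<n. z (Suc k) = A *v z k + f k) \<Longrightarrow>
     (\<Sum>k\<le>n. (norm (z k))\<^sup>2) \<le> K0 * ((norm (z 0))\<^sup>2 + (\<Sum>k<n. (norm (f k))\<^sup>2))"
    using l2_gain by blast
  obtain K1 where K1: "K1 \<ge> 0" "\<And>n x w. (\<Sum>k\<le>n. (norm (X x w k))\<^sup>2) \<le> K1 * ((norm x)\<^sup>2 + (\<Sum>k\<le>n. (norm (fst (w k)))\<^sup>2))"
    using state_energy by blast
  obtain K2 where K2: "K2 \<ge> 0" "\<And>n x w y. CARD('d) \<le> n \<Longrightarrow> (norm x)\<^sup>2 \<le>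
     K2 * (\<Sum>k\<le>n. (norm (y k))\<^sup>2 + (norm (y k - B *v X x w k))\<^sup>2 + (norm (fst (w k)))\<^sup>2)"
    using initial_energy by blast
  define s where "s = max 1 ((norm S)\<^sup>2)"
  have s: "1 \<le> s" "(norm S)\<^sup>2 \<le> s" by (auto simp: s_def)
  define K3 where "K3 = K1 * (K2 * s + 1)"
  have K3: "K3 \<ge> 0" using K1 K2 s by (simp add: K3_def)
  define h where "h = norm (F ** B) + 1"
  have h: "h \<ge> 1" by (simp add: h_def)
  define K4 where "K4 = 3 * (1 + K3) + 3 * h\<^sup>2 * (8 * K0 * (K3 + 1))"
  have K4: "K4 > 0" unfolding K4_def using K3 K0 by (intro add_pos_nonneg) auto
  \<comment> \<open>The square of the radius: \<open>4 * K0 * d2 \<le> 1/2\<close> serves to absorb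
    the deviation energy, \<open>4 * K4 * d2 \<le> \<eta>^2\<close> to make the last Young term at
    most \<open>\<eta> / 2 * W\<close>.\<close>
  define d2 where "d2 = min 1 (min (1 / (8 * (K0 + 1))) (\<eta>\<^sup>2 / (4 * K4)))"
  have d2: "0 < d2" "d2 \<le> 1" "4 * K0 * d2 \<le> 1/2" "d2 * (4 * K4) \<le> \<eta>\<^sup>2"
  proof -
    show "0 < d2" "d2 \<le> 1" using assms K0 K4 by (auto simp: d2_def)
    have "d2 \<le> 1 / (8 * (K0 + 1))" "d2 \<le> \<eta>\<^sup>2 / (4 * K4)" by (auto simp: d2_def)
    then have "d2 * (8 * (K0 + 1)) \<le> 1" "d2 * (4 * K4) \<le> \<eta>\<^sup>2"
      using K0 K4 by (auto simp: pos_le_divide_eq)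
    then show "4 * K0 * d2 \<le> 1/2" "d2 * (4 * K4) \<le> \<eta>\<^sup>2" using \<open>0 < d2\<close> by (auto simp: algebra_simps)
  qed
  have "(\<Sum>k\<le>n. (norm (resid x w y k))\<^sup>2) \<le> (\<Sum>k\<le>n. (norm (F' *v y k - H' *v state A' R' x w k))\<^sup>2)
        + \<eta> * (\<Sum>k\<le>n. (norm (resid x w y k))\<^sup>2 + (norm (fst (w k)))\<^sup>2 + (norm (y k))\<^sup>2)"
    if near: "norm (A' - A) \<le> sqrt d2" "norm (R' - R) \<le> sqrt d2" "norm (F' - F) \<le> sqrt d2"
      "norm (H' - F ** B) \<le> sqrt d2" and n: "CARD('d) \<le> n" for A' R' F' H' n x w y
  proof -
    let ?X = "X x w" and ?X' = "state A' R' x w"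
    define D where "D k = ?X' k - ?X k" for k
    define e where "e = resid x w y"
    define e' where "e' k = F' *v y k - H' *v ?X' k" for k
    define z where "z k = e' k - e k" for k
    let ?s = "\<lambda>f :: nat \<Rightarrow> real. \<Sum>k\<le>n. f k"
    define sX where "sX = ?s (\<lambda>k. (norm (?X k))\<^sup>2)"
    define sD where "sD = ?s (\<lambda>k. (norm (D k))\<^sup>2)"
    define sU where "sU = ?s (\<lambda>k. (norm (fst (w k)))\<^sup>2)"
    define sY where "sY = ?s (\<lambda>k. (norm (y k))\<^sup>2)"
    define sE where "sE = ?s (\<lambda>k. (norm (e k))\<^sup>2)"
    define sE' where "sE' = ?s (\<lambda>k. (norm (e' k))\<^sup>2)"
    define sZ where "sZ = ?s (\<lambda>k. (norm (z k))\<^sup>2)"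
    note defs = sX_def sD_def sU_def sY_def sE_def sE'_def sZ_def
    have pos: "0 \<le> sX" "0 \<le> sD" "0 \<le> sU" "0 \<le> sY" "0 \<le> sE" "0 \<le> sE'" "0 \<le> sZ"
      by (auto simp: defs intro!: sum_nonneg)
    define W where "W = sY + sE + sU"
    have W: "0 \<le> W" "sU \<le> W" "sY \<le> W" "sE \<le> W" using pos by (auto simp: W_def)
    note small = norm_matrix_vector_mult_sq_le[OF near(1)] norm_matrix_vector_mult_sq_le[OF near(2)]
      norm_matrix_vector_mult_sq_le[OF near(3)] norm_matrix_vector_mult_sq_le[OF near(4)]
    note small = small[unfolded real_sqrt_pow2[OF less_imp_le[OF d2(1)]]]
    have x2: "(norm x)\<^sup>2 \<le> K2 * s * W"
    proof -
      have "y k - B *v ?X k = S *v e k" for k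
        by (simp add: e_def matrix_vector_mul_assoc S_inverse)
      then have "(norm (y k - B *v ?X k))\<^sup>2 \<le> s * (norm (e k))\<^sup>2" for k
        using norm_matrix_vector_mult_sq_le[of S "norm S" "e k"] s
        by (metis (no_types, opaque_lifting) mult_right_mono order_refl order_trans zero_le_power2)
      moreover have "(norm (y k))\<^sup>2 \<le> s * (norm (y k))\<^sup>2" "(norm (fst (w k)))\<^sup>2 \<le> s * (norm (fst (w k)))\<^sup>2" for k
        using mult_right_mono[OF s(1) zero_le_power2, of "norm (y k)"]
          mult_right_mono[OF s(1) zero_le_power2, of "norm (fst (w k))"] by auto
      ultimately have "?s (\<lambda>k. (norm (y k))\<^sup>2 + (norm (y k - B *v ?X k))\<^sup>2 + (norm (fst (w k)))\<^sup>2)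
        \<le> ?s (\<lambda>k. s * (norm (y k))\<^sup>2 + s * (norm (e k))\<^sup>2 + s * (norm (fst (w k)))\<^sup>2)"
        by (intro sum_mono add_mono)
      also have "\<dots> = s * W"
        by (simp add: W_def defs sum.distrib sum_distrib_left algebra_simps)
      finally show ?thesis
        using K2(2)[OF n, of x y w] K2(1)
        by (smt (verit, best) mult.assoc mult_left_mono)
    qed
    have sX: "sX \<le> K3 * W"
    proof -
      have "sX \<le> K1 * ((norm x)\<^sup>2 + sU)" unfolding defs by (rule K1)
      also have "\<dots> \<le> K1 * (K2 * s * W + W)"
        using x2 W K1 by (intro mult_left_mono add_mono) auto
      finally show ?thesis by (simp add: K3_def algebra_simps)
    qed
    \<comment> \<open>The forcing contains the perturbed state, that is \<open>X + D\<close>, so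
      \<open>sD\<close> comes back on the right with factor at most 1/2 and is moved to the
      left.\<close>
    have sD: "sD \<le> 8 * K0 * d2 * (sX + sU)"
    proof -
      define f where "f k = (A' - A) *v ?X' k + (R' - R) *v fst (w k)" for k
      have "sD \<le> K0 * ((norm (D 0))\<^sup>2 + (\<Sum>k<n. (norm (f k))\<^sup>2))"
        unfolding defs by (rule K0) (simp add: D_def f_def algebra_simps)
      also have "\<dots> \<le> K0 * ?s (\<lambda>k. (norm (f k))\<^sup>2)"
        using K0 by (intro mult_left_mono) (auto simp: D_def intro!: sum_mono2)
      also have "\<dots> \<le> K0 * ?s (\<lambda>k. 4 * d2 * ((norm (?X k))\<^sup>2 + (norm (D k))\<^sup>2 + (norm (fst (w k)))\<^sup>2))"
      proof (intro mult_left_mono sum_mono K0)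
        fix k
        have "(norm (f k))\<^sup>2 \<le> 2 * (norm ((A' - A) *v ?X' k))\<^sup>2 + 2 * (norm ((R' - R) *v fst (w k)))\<^sup>2"
          unfolding f_def by (rule norm_add_sq_le)
        also have "\<dots> \<le> 2 * (d2 * (norm (?X' k))\<^sup>2) + 2 * (d2 * (norm (fst (w k)))\<^sup>2)"
          using small near by (intro add_mono mult_left_mono) auto
        also have "(norm (?X' k))\<^sup>2 \<le> 2 * (norm (?X k))\<^sup>2 + 2 * (norm (D k))\<^sup>2"
          using norm_add_sq_le[of "?X k" "D k"] by (simp add: D_def)
        finally have "(norm (f k))\<^sup>2 \<le> 2 * (d2 * (2 * (norm (?X k))\<^sup>2 + 2 * (norm (D k))\<^sup>2)) + 2 * (d2 * (norm (fst (w k)))\<^sup>2)"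
          using d2 by simp
        also have "\<dots> \<le> 4 * d2 * ((norm (?X k))\<^sup>2 + (norm (D k))\<^sup>2 + (norm (fst (w k)))\<^sup>2)"
          using d2 by (simp add: algebra_simps)
        finally show "(norm (f k))\<^sup>2 \<le> 4 * d2 * ((norm (?X k))\<^sup>2 + (norm (D k))\<^sup>2 + (norm (fst (w k)))\<^sup>2)" .
      qed
      also have "\<dots> = 4 * K0 * d2 * (sX + sU) + 4 * K0 * d2 * sD"
        by (simp add: defs sum.distrib sum_distrib_left algebra_simps)
      also have "4 * K0 * d2 * sD \<le> 1/2 * sD"
        using d2 pos by (intro mult_right_mono) auto
      finally show ?thesis by simp
    qed
    have sZ: "sZ \<le> d2 * K4 * W"
    proof -
      have tri: "(norm (a - b - c))\<^sup>2 \<le> 3 * (norm a)\<^sup>2 + 3 * (norm b)\<^sup>2 + 3 * (norm c)\<^sup>2" for a b c :: "real^'p"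
        using norm_add_sq_le_weighted[of "1/2" "a - b" "-c"] norm_diff_sq_le[of a b] by simp
      have "sqrt d2 \<le> 1" using d2(2) by simp
      moreover have "norm H' \<le> norm (F ** B) + norm (H' - F ** B)"
        using norm_triangle_ineq[of "F ** B" "H' - F ** B"] by simp
      ultimately have H': "norm H' \<le> h"
        using near(4) unfolding h_def by linarith
      have "(norm (z k))\<^sup>2 \<le> 3 * (d2 * (norm (y k))\<^sup>2) + 3 * (d2 * (norm (?X k))\<^sup>2) + 3 * (h\<^sup>2 * (norm (D k))\<^sup>2)" for k
      proof -
        have "z k = (F' - F) *v y k - (H' - F ** B) *v ?X k - H' *v D k"
          by (simp add: z_def e'_def e_def D_def algebra_simps matrix_vector_mul_assoc)
        then have "(norm (z k))\<^sup>2 \<le> 3 * (norm ((F' - F) *v y k))\<^sup>2 + 3 * (norm ((H' - F ** B) *v ?X k))\<^sup>2 + 3 * (norm (H' *v D k))\<^sup>2"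
          using tri by metis
        also have "\<dots> \<le> 3 * (d2 * (norm (y k))\<^sup>2) + 3 * (d2 * (norm (?X k))\<^sup>2) + 3 * (h\<^sup>2 * (norm (D k))\<^sup>2)"
          using small near norm_matrix_vector_mult_sq_le[OF H'] by (intro add_mono mult_left_mono) auto
        finally show ?thesis .
      qed
      then have "sZ \<le> ?s (\<lambda>k. 3 * (d2 * (norm (y k))\<^sup>2) + 3 * (d2 * (norm (?X k))\<^sup>2) + 3 * (h\<^sup>2 * (norm (D k))\<^sup>2))"
        unfolding defs by (intro sum_mono)
      also have "\<dots> = 3 * d2 * sY + 3 * d2 * sX + 3 * h\<^sup>2 * sD"
        by (simp add: defs sum.distrib sum_distrib_left algebra_simps)
      also have "\<dots> \<le> 3 * d2 * W + 3 * d2 * (K3 * W) + 3 * h\<^sup>2 * (8 * K0 * d2 * (K3 * W + W))"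
        using W d2 sX K0
        by (intro add_mono mult_left_mono order_trans[OF sD]) auto
      also have "\<dots> = d2 * K4 * W" by (simp add: K4_def algebra_simps)
      finally show ?thesis .
    qed
    \<comment> \<open>Expand \<open>e' = e + z\<close> and bound the cross term by Young's
      inequality with weights \<open>\<eta> / 2\<close> and \<open>2 / \<eta>\<close>.\<close>
    have "(norm (e k))\<^sup>2 \<le> (norm (e' k))\<^sup>2 + \<eta> / 2 * (norm (e k))\<^sup>2 + 2 / \<eta> * (norm (z k))\<^sup>2" for k
    proof -
      have "0 \<le> (norm (sqrt (\<eta> / 2) *\<^sub>R e k + (1 / sqrt (\<eta> / 2)) *\<^sub>R z k))\<^sup>2" by simp
      also have "\<dots> = \<eta> / 2 * (norm (e k))\<^sup>2 + 2 * (e k \<bullet> z k) + 2 / \<eta> * (norm (z k))\<^sup>2"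
        unfolding power2_norm_eq_inner inner_add_left inner_add_right inner_scaleR_left inner_scaleR_right
        using assms by (simp add: inner_commute real_sqrt_mult_self field_simps)
      finally have "0 \<le> \<eta> / 2 * (norm (e k))\<^sup>2 + 2 * (e k \<bullet> z k) + 2 / \<eta> * (norm (z k))\<^sup>2" .
      moreover have "(norm (e' k))\<^sup>2 = (norm (e k))\<^sup>2 + 2 * (e k \<bullet> z k) + (norm (z k))\<^sup>2"
        by (simp add: z_def power2_norm_eq_inner inner_diff_left inner_diff_right inner_commute)
      moreover have "0 \<le> (norm (z k))\<^sup>2" by simp
      ultimately show ?thesis by linarith
    qed
    then have "sE \<le> ?s (\<lambda>k. (norm (e' k))\<^sup>2 + \<eta> / 2 * (norm (e k))\<^sup>2 + 2 / \<eta> * (norm (z k))\<^sup>2)"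
      unfolding defs by (intro sum_mono)
    also have "\<dots> = sE' + \<eta> / 2 * sE + 2 / \<eta> * sZ"
      by (simp add: defs sum.distrib sum_distrib_left)
    also have "2 / \<eta> * sZ \<le> 2 / \<eta> * (\<eta>\<^sup>2 / 4 * W)"
    proof (intro mult_left_mono order_trans[OF sZ])
      show "d2 * K4 * W \<le> \<eta>\<^sup>2 / 4 * W" using d2 W by (intro mult_right_mono) auto
    qed (use assms in auto)
    also have "\<dots> = \<eta> / 2 * W" using assms by (simp add: power2_eq_square)
    also have "\<eta> / 2 * sE \<le> \<eta> / 2 * W" using W assms by (intro mult_left_mono) auto
    finally have "sE \<le> sE' + \<eta> * W" by (simp add: algebra_simps)
    moreover have "W = ?s (\<lambda>k. (norm (e k))\<^sup>2 + (norm (fst (w k)))\<^sup>2 + (norm (y k))\<^sup>2)"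
      by (simp add: W_def defs sum.distrib)
    ultimately show ?thesis
      by (simp only: defs e_def e'_def)
  qed
  then show ?thesis using d2 by (intro exI[of _ "sqrt d2"]) auto
qed

end

subsection \<open>Gaussian densities and likelihood ratios\<close>

lemma borel_measurable_matrix_vector_mult [measurable]:
  fixes M :: "real^'n^'m"
  assumes "f \<in> borel_measurable N"
  shows "(\<lambda>x. M *v f x) \<in> borel_measurable N"
  by (rule measurable_compose[OF assms]) (intro borel_measurable_continuous_onI continuous_intros)

lemma norm_sq_Basis: "(norm x)\<^sup>2 = (\<Sum>b\<in>Basis. (x \<bullet> b)\<^sup>2)"
  unfolding power2_norm_eq_inner by (subst euclidean_inner) (simp only: power2_eq_square)

section \<open>Linear changes of variables for Lebesgue measure\<close>

lemma nn_integral_lborel_shear: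
  fixes h :: "real^'n \<Rightarrow> ennreal"
  assumes [measurable]: "h \<in> borel_measurable borel" and "m \<noteq> n"
  shows "(\<integral>\<^sup>+x. h (x + (c * x $ n) *\<^sub>R axis m 1) \<partial>lborel) = (\<integral>\<^sup>+x. h x \<partial>lborel)"
proof -
  interpret product_sigma_finite "\<lambda>_ :: real^'n. lborel :: real measure" by standard
  let ?m = "axis m 1 :: real^'n" and ?n = "axis n 1 :: real^'n"
  let ?I = "Basis - {?m}"
  have B: "Basis = insert ?m ?I" "finite ?I" "?m \<notin> ?I" by (auto simp: axis_in_Basis_iff)
  have "?m \<noteq> ?n" using \<open>m \<noteq> n\<close> by (simp add: axis_eq_axis)
  let ?i = "\<lambda>f. \<Sum>b\<in>Basis. f b *\<^sub>R b :: real^'n"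
  have eq: "(\<integral>\<^sup>+x. g x \<partial>lborel) = (\<integral>\<^sup>+f. \<integral>\<^sup>+t. g (?i (f(?m := t))) \<partial>lborel \<partial>(Pi\<^sub>M ?I (\<lambda>_. lborel)))"
    if [measurable]: "g \<in> borel_measurable borel" for g :: "real^'n \<Rightarrow> ennreal"
  proof -
    have "(\<integral>\<^sup>+x. g x \<partial>lborel) = (\<integral>\<^sup>+f. g (?i f) \<partial>(Pi\<^sub>M Basis (\<lambda>_. lborel)))"
      by (subst lborel_eq) (simp add: nn_integral_distr)
    also have "\<dots> = (\<integral>\<^sup>+f. \<integral>\<^sup>+t. g (?i (f(?m := t))) \<partial>lborel \<partial>(Pi\<^sub>M ?I (\<lambda>_. lborel)))"
      by (subst (1) B(1), rule product_nn_integral_insert) (use B(1) in auto)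
    finally show ?thesis .
  qed
  \<comment> \<open>With the other coordinates frozen the shear is a translation of the
    \<open>m\<close>-th one, by an amount independent of it since
    \<open>m \<noteq> n\<close>.\<close>
  have "(\<integral>\<^sup>+t. h (?i (f(?m := t)) + (c * ?i (f(?m := t)) $ n) *\<^sub>R ?m) \<partial>lborel) = (\<integral>\<^sup>+t. h (?i (f(?m := t))) \<partial>lborel)" for f
  proof -
    have i: "?i (f(?m := t)) = t *\<^sub>R ?m + (\<Sum>b\<in>?I. f b *\<^sub>R b)" for t
      by (subst (1) B(1), subst sum.insert) (use B in \<open>auto intro!: sum.cong\<close>)
    have "?i (f(?m := t)) $ n = f ?n" for t
    proof -
      have "?i (f(?m := t)) $ n = ?i (f(?m := t)) \<bullet> ?n" by (simp add: cart_eq_inner_axis)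
      also have "\<dots> = (f(?m := t)) ?n" by (rule inner_sum_left_Basis) (simp add: axis_in_Basis_iff)
      finally show ?thesis using \<open>?m \<noteq> ?n\<close> by simp
    qed
    then have "(\<integral>\<^sup>+t. h (?i (f(?m := t)) + (c * ?i (f(?m := t)) $ n) *\<^sub>R ?m) \<partial>lborel)
        = (\<integral>\<^sup>+t. h (?i (f(?m := c * f ?n + 1 * t))) \<partial>lborel)"
      by (intro nn_integral_cong arg_cong[of _ _ h]) (simp only: i, simp add: algebra_simps)
    also have "\<dots> = (\<integral>\<^sup>+t. h (?i (f(?m := t))) \<partial>lborel)"
      unfolding i
      by (subst nn_integral_real_affine[of "\<lambda>t. h (t *\<^sub>R ?m + (\<Sum>b\<in>?I. f b *\<^sub>R b))" 1 "c * f ?n"]) auto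
    finally show ?thesis .
  qed
  then show ?thesis
    by (subst (1 2) eq) auto
qed

text \<open>The formula is stable under products, so it suffices to check the elementary matrices:
  diagonal ones, column swaps and shears.\<close>

lemma nn_integral_lborel_matrix:
  fixes M :: "real^'n^'n" and h :: "real^'n \<Rightarrow> ennreal"
  assumes [measurable]: "h \<in> borel_measurable borel" and "det M \<noteq> 0"
  shows "ennreal \<bar>det M\<bar> * (\<integral>\<^sup>+x. h (M *v x) \<partial>lborel) = (\<integral>\<^sup>+x. h x \<partial>lborel)"
proof -
  \<comment> \<open>With \<open>det M \<noteq> 0\<close> as a premise inside \<open>P\<close>, a
    matrix with a zero row satisfies \<open>P\<close> vacuously, and a product of nonzero
    determinant has only nonsingular factors.\<close>
  define P where "P M \<longleftrightarrow> (det M \<noteq> 0 \<longrightarrow> (\<forall>h\<in>borel_measurable borel.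
      ennreal \<bar>det M\<bar> * (\<integral>\<^sup>+x. h (M *v x) \<partial>lborel) = (\<integral>\<^sup>+x. h x \<partial>lborel)))" for M :: "real^'n^'n"
  have "P M"
  proof (rule induct_matrix_elementary[of P M])
    fix M N :: "real^'n^'n" assume PM: "P M" and PN: "P N"
    show "P (M ** N)"
      unfolding P_def
    proof safe
      fix h :: "real^'n \<Rightarrow> ennreal" assume [measurable]: "h \<in> borel_measurable borel" and d: "det (M ** N) \<noteq> 0"
      have "ennreal \<bar>det (M ** N)\<bar> * (\<integral>\<^sup>+x. h ((M ** N) *v x) \<partial>lborel)
          = ennreal \<bar>det M\<bar> * (ennreal \<bar>det N\<bar> * (\<integral>\<^sup>+x. h (M *v (N *v x)) \<partial>lborel))"
        by (simp add: det_mul abs_mult ennreal_mult matrix_vector_mul_assoc mult.assoc)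
      also have "ennreal \<bar>det N\<bar> * (\<integral>\<^sup>+x. h (M *v (N *v x)) \<partial>lborel) = (\<integral>\<^sup>+x. h (M *v x) \<partial>lborel)"
        using PN d unfolding P_def det_mul by (intro bspec[where x = "\<lambda>x. h (M *v x)"]) auto
      also have "ennreal \<bar>det M\<bar> * \<dots> = (\<integral>\<^sup>+x. h x \<partial>lborel)"
        using PM d unfolding P_def by (simp add: det_mul)
      finally show "ennreal \<bar>det (M ** N)\<bar> * (\<integral>\<^sup>+x. h ((M ** N) *v x) \<partial>lborel) = (\<integral>\<^sup>+x. h x \<partial>lborel)" .
    qed
  next
    fix M :: "real^'n^'n" and i assume "row i M = 0"
    then show "P M" by (simp add: P_def det_zero_row)
  next
    fix M :: "real^'n^'n" assume dg: "\<And>i j. i \<noteq> j \<Longrightarrow> M $ i $ j = 0"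
    show "P M"
      unfolding P_def
    proof safe
      fix h :: "real^'n \<Rightarrow> ennreal" assume [measurable]: "h \<in> borel_measurable borel" and d: "det M \<noteq> 0"
      define c where "c b = b \<bullet> (M *v b)" for b
      have cb: "c (axis i 1) = M $ i $ i" for i
        by (simp add: c_def inner_axis matrix_vector_mul_component inner_axis' )
      have dt: "det M = (\<Prod>i\<in>UNIV. M $ i $ i)" by (rule det_diagonal) (rule dg)
      have Bas: "Basis = range (\<lambda>i. axis i 1 :: real^'n)" by (auto simp: Basis_vec_def)
      have inj: "inj (\<lambda>i. axis i 1 :: real^'n)" by (auto simp: inj_def axis_eq_axis)
      have T: "M *v x = 0 + (\<Sum>j\<in>Basis. (c j * (x \<bullet> j)) *\<^sub>R j)" for x
      proof -
        have "(M *v x) $ i = (\<Sum>j\<in>UNIV. (M $ j $ j * x $ j) *\<^sub>R axis j 1) $ i" for i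
        proof -
          have "(M *v x) $ i = (\<Sum>j\<in>UNIV. if j = i then M $ i $ i * x $ i else 0)"
            unfolding matrix_vector_mult_def vec_lambda_beta by (intro sum.cong) (auto simp: dg)
          also have "\<dots> = (\<Sum>j\<in>UNIV. (M $ j $ j * x $ j) *\<^sub>R axis j 1) $ i"
            by (simp add: axis_def if_distrib cong: if_cong)
          finally show ?thesis .
        qed
        then show ?thesis
          by (simp add: vec_eq_iff Bas sum.reindex[OF inj] cb inner_axis)
      qed
      have "ennreal \<bar>det M\<bar> = (\<Prod>j\<in>Basis. \<bar>c j\<bar>)"
        by (simp add: dt Bas prod.reindex[OF inj] cb abs_prod)
      moreover have "c j \<noteq> 0" if "j \<in> Basis" for j
        using that d dt by (auto simp: Bas cb)
      ultimately show "ennreal \<bar>det M\<bar> * (\<integral>\<^sup>+x. h (M *v x) \<partial>lborel) = (\<integral>\<^sup>+x. h x \<partial>lborel)"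
        by (subst (2) lborel_affine_euclidean[of c 0])
          (auto simp: nn_integral_density nn_integral_distr T nn_integral_cmult)
    qed
  next
    fix m n :: 'n assume "m \<noteq> n"
    let ?p = "Transposition.transpose m n"
    let ?M = "(\<chi> i j. mat 1 $ i $ ?p j) :: real^'n^'n"
    have Mx: "(?M *v x) $ i = x $ ?p i" for x i
    proof -
      have "(?M *v x) $ i = (\<Sum>j\<in>UNIV. if j = ?p i then x $ j else 0)"
        unfolding matrix_vector_mult_def vec_lambda_beta by (intro sum.cong) (auto simp: mat_def)
      then show ?thesis by simp
    qed
    have p: "?p permutes UNIV" by (simp add: permutes_swap_id)
    have Bas: "Basis = range (\<lambda>i. axis i 1 :: real^'n)" by (auto simp: Basis_vec_def)
    have inj: "inj (\<lambda>i. axis i 1 :: real^'n)" by (auto simp: inj_def axis_eq_axis)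
    \<comment> \<open>A permutation of coordinates maps boxes to boxes of the same volume, and
      volumes of boxes determine \<open>lborel\<close>.\<close>
    have leb: "lborel = distr lborel borel (\<lambda>x. ?M *v x)"
    proof (rule lborel_eqI)
      fix l u :: "real^'n" assume lu: "\<And>b. b \<in> Basis \<Longrightarrow> l \<bullet> b \<le> u \<bullet> b"
      have lu': "l $ i \<le> u $ i" for i using lu[of "axis i 1"] by (simp add: axis_in_Basis_iff inner_axis)
      have "(\<lambda>x. ?M *v x) -` box l u = box (?M *v l) (?M *v u)"
        unfolding mem_box_cart Mx vimage_def by (auto simp: mem_box_cart Mx) (metis transpose_involutory)+
      then have "emeasure (distr lborel borel (\<lambda>x. ?M *v x)) (box l u) = emeasure lborel (box (?M *v l) (?M *v u))"
        by (simp add: emeasure_distr)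
      also have "\<dots> = (\<Prod>b\<in>Basis. (?M *v u - ?M *v l) \<bullet> b)"
        by (rule emeasure_lborel_box) (auto simp: Bas inner_axis Mx lu')
      also have "(\<Prod>b\<in>Basis. (?M *v u - ?M *v l) \<bullet> b) = (\<Prod>i\<in>UNIV. u $ ?p i - l $ ?p i)"
        by (simp add: Bas prod.reindex[OF inj] inner_axis Mx)
      also have "\<dots> = (\<Prod>i\<in>UNIV. u $ i - l $ i)"
        by (rule prod.permute[OF p, symmetric, unfolded o_def])
      also have "\<dots> = (\<Prod>b\<in>Basis. (u - l) \<bullet> b)"
        by (simp add: Bas prod.reindex[OF inj] inner_axis)
      finally show "emeasure (distr lborel borel (\<lambda>x. ?M *v x)) (box l u) = (\<Prod>b\<in>Basis. (u - l) \<bullet> b)" .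
    qed simp
    have "det ?M = of_int (sign ?p) * det (mat 1 :: real^'n^'n)" by (rule det_permute_columns[OF p])
    then have "\<bar>det ?M\<bar> = 1" by (simp add: sign_def)
    then show "P ?M"
      unfolding P_def by (subst (2) leb) (auto simp: nn_integral_distr)
  next
    fix m n :: 'n and c :: real assume mn: "m \<noteq> n"
    let ?M = "(\<chi> i j. if i = m \<and> j = n then c else of_bool (i = j)) :: real^'n^'n"
    have "?M *v x = x + (c * x $ n) *\<^sub>R axis m 1" for x
    proof -
      have "(?M *v x) $ i = x $ i + (if i = m then c * x $ n else 0)" for i
      proof -
        have "(?M *v x) $ i = (\<Sum>j\<in>UNIV. (if j = i then x $ i else 0) + (if j = n then if i = m then c * x $ n else 0 else 0))"
          unfolding matrix_vector_mult_def vec_lambda_beta by (intro sum.cong) (use mn in auto)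
        then show ?thesis by (simp add: sum.distrib)
      qed
      then show ?thesis by (simp add: vec_eq_iff axis_def)
    qed
    moreover have "det ?M = 1"
    proof -
      have "?M = (\<chi> k. if k = m then row m (mat 1) + c *s row n (mat 1) else row k (mat 1))"
        using mn by (auto simp: vec_eq_iff row_def mat_def)
      then show ?thesis using det_row_operation[OF mn, of "mat 1" c] by simp
    qed
    ultimately show "P ?M"
      using mn by (auto simp: P_def nn_integral_lborel_shear)
  qed
  then show ?thesis using assms by (auto simp: P_def)
qed

section \<open>The standard Gaussian law and its exponential moment\<close>

definition gauss_pdf :: "'a::euclidean_space \<Rightarrow> real" where
  "gauss_pdf x = (2 * pi) powr (- real DIM('a) / 2) * exp (- (norm x)\<^sup>2 / 2)"

lemma std_gaussian_eq: "std_gaussian = density lborel (\<lambda>x. ennreal (gauss_pdf x))"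
  by (simp add: std_gaussian_def gauss_pdf_def)

lemma gauss_pdf_pos: "0 < gauss_pdf x"
  by (simp add: gauss_pdf_def)

lemma borel_measurable_gauss_pdf [measurable]: "gauss_pdf \<in> borel_measurable borel"
  unfolding gauss_pdf_def[abs_def] by measurable

lemma sets_std_gaussian [measurable_cong, simp]: "sets std_gaussian = sets borel"
  by (simp add: std_gaussian_def)

lemma space_std_gaussian [simp]: "space std_gaussian = UNIV"
  by (simp add: std_gaussian_def)

lemma gauss_pdf_prod: "gauss_pdf x = (\<Prod>b\<in>Basis. std_normal_density (x \<bullet> b))" for x :: "'a::euclidean_space"
proof -
  have "(1 / sqrt (2 * pi)) ^ DIM('a) = (2 * pi) powr (- real DIM('a) / 2)"
    by (simp add: powr_half_sqrt[symmetric] powr_minus_divide[symmetric] powr_realpow[symmetric] powr_powr)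
  moreover have "(\<Prod>b\<in>Basis. std_normal_density (x \<bullet> b)) = (1 / sqrt (2 * pi)) ^ DIM('a) * (\<Prod>b\<in>Basis. exp (- (x \<bullet> b)\<^sup>2 / 2))"
    unfolding std_normal_density_def prod.distrib prod_constant ..
  moreover have "(\<Prod>b\<in>Basis. exp (- (x \<bullet> b)\<^sup>2 / 2)) = exp (- (norm x)\<^sup>2 / 2)"
    by (simp add: norm_sq_Basis exp_sum[symmetric] sum_negf sum_divide_distrib[symmetric])
  ultimately show ?thesis
    by (simp add: gauss_pdf_def)
qed

lemma nn_integral_std_gaussian_prod:
  assumes [measurable]: "f \<in> borel_measurable borel"
  shows "(\<integral>\<^sup>+x. (\<Prod>b\<in>Basis. f (x \<bullet> b)) \<partial>(std_gaussian :: 'a::euclidean_space measure))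
    = (\<integral>\<^sup>+t. ennreal (std_normal_density t) * f t \<partial>lborel) ^ DIM('a)"
proof -
  have "(\<integral>\<^sup>+x. (\<Prod>b\<in>Basis. f (x \<bullet> b)) \<partial>(std_gaussian :: 'a measure))
    = (\<integral>\<^sup>+x. (\<Prod>b\<in>Basis. ennreal (std_normal_density (x \<bullet> b)) * f (x \<bullet> b)) \<partial>(lborel :: 'a measure))"
    unfolding std_gaussian_eq
    by (simp add: nn_integral_density gauss_pdf_prod prod.distrib prod_ennreal)
  also have "\<dots> = (\<Prod>b\<in>(Basis :: 'a set). (\<integral>\<^sup>+t. ennreal (std_normal_density t) * f t \<partial>lborel))"
    by (rule nn_integral_lborel_prod) auto
  finally show ?thesis by simp
qed

lemma prob_space_std_gaussian: "prob_space (std_gaussian :: 'a::euclidean_space measure)"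
proof
  have "(\<integral>\<^sup>+t. ennreal (std_normal_density t) \<partial>lborel) = 1"
    using prob_space.emeasure_space_1[OF prob_space_normal_density[of 1 0]]
    by (simp add: emeasure_density)
  then show "emeasure (std_gaussian :: 'a measure) (space std_gaussian) = 1"
    using nn_integral_std_gaussian_prod[of "\<lambda>_. 1", where 'a = 'a] by simp
qed

text \<open>In each coordinate the factor \<open>exp (t^2 / 4)\<close> turns the standard normal
  density into \<open>sqrt 2\<close> times the normal density of variance 2.\<close>

lemma std_gaussian_exp_moment:
  "(\<integral>\<^sup>+x. ennreal (exp ((norm x)\<^sup>2 / 4)) \<partial>(std_gaussian :: 'a::euclidean_space measure)) = ennreal (sqrt 2 ^ DIM('a))"
proof -
  have "(\<integral>\<^sup>+t. ennreal (std_normal_density t) * ennreal (exp (t\<^sup>2 / 4)) \<partial>lborel)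
      = (\<integral>\<^sup>+t. ennreal (sqrt 2) * ennreal (normal_density 0 (sqrt 2) t) \<partial>lborel)"
    by (intro nn_integral_cong, subst (1 2) ennreal_mult[symmetric])
      (auto simp: normal_density_def exp_add[symmetric] real_sqrt_mult field_simps
        simp flip: exp_add intro!: ennreal_cong)
  also have "\<dots> = ennreal (sqrt 2)"
    using prob_space.emeasure_space_1[OF prob_space_normal_density[of "sqrt 2" 0]]
    by (simp add: emeasure_density nn_integral_cmult)
  finally have *: "(\<integral>\<^sup>+t. ennreal (std_normal_density t) * ennreal (exp (t\<^sup>2 / 4)) \<partial>lborel) = ennreal (sqrt 2)" .
  have n: "(norm x)\<^sup>2 / 4 = (\<Sum>b\<in>Basis. (x \<bullet> b)\<^sup>2 / 4)" for x :: 'a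
    by (simp add: norm_sq_Basis sum_divide_distrib)
  show ?thesis
    using nn_integral_std_gaussian_prod[of "\<lambda>t. ennreal (exp (t\<^sup>2 / 4))", where 'a = 'a]
    by (simp add: n exp_sum prod_ennreal * ennreal_power)
qed

text \<open>Squared norms add up on pairs. This makes the state noise and the observation noise of
  one time step independent.\<close>

lemma std_gaussian_pair:
  "(std_gaussian :: ('a::euclidean_space \<times> 'b::euclidean_space) measure) = std_gaussian \<Otimes>\<^sub>M std_gaussian"
proof -
  interpret a: prob_space "std_gaussian :: 'a measure" by (rule prob_space_std_gaussian)
  interpret b: prob_space "std_gaussian :: 'b measure" by (rule prob_space_std_gaussian)
  have pdf: "gauss_pdf (x, y) = gauss_pdf x * gauss_pdf y" for x :: 'a and y :: 'b
  proof -
    have "- (norm (x, y))\<^sup>2 / 2 = - (norm x)\<^sup>2 / 2 + - (norm y)\<^sup>2 / 2"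
      by (simp add: norm_Pair field_simps)
    moreover have "- real DIM('a \<times> 'b) / 2 = - real DIM('a) / 2 + - real DIM('b) / 2"
      by (simp add: field_simps)
    ultimately show ?thesis
      unfolding gauss_pdf_def by (simp only: powr_add exp_add) simp
  qed
  have [measurable]: "(\<lambda>(x :: 'a, y :: 'b). ennreal (gauss_pdf x) * ennreal (gauss_pdf y)) \<in> borel_measurable borel"
    unfolding borel_prod[symmetric] by measurable
  have "(std_gaussian :: 'a measure) \<Otimes>\<^sub>M (std_gaussian :: 'b measure)
     = density (lborel \<Otimes>\<^sub>M lborel) (\<lambda>(x, y). ennreal (gauss_pdf x) * ennreal (gauss_pdf y))"
    unfolding std_gaussian_eq
    by (rule pair_measure_density)
      (auto simp: std_gaussian_eq[symmetric] intro: b.sigma_finite_measure sigma_finite_lborel)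
  also have "\<dots> = std_gaussian"
    unfolding std_gaussian_eq lborel_prod
    by (intro density_cong) (auto simp: pdf ennreal_mult gauss_pdf_pos less_imp_le)
  finally show ?thesis by simp
qed

section \<open>The likelihood ratio of a single observation\<close>

context linear_model
begin

text \<open>With \<open>F = S^-1\<close> the inverse covariance is \<open>F^T F\<close>, so the
  quadratic form is the squared norm of a residual.\<close>

lemma gaussian_density_eq:
  "gaussian_density m (S ** transpose S) y = gauss_pdf (F *v (y - m)) / \<bar>det S\<bar>"
proof -
  let ?G = "transpose F ** F"
  have tr: "transpose S ** transpose F = mat 1" "transpose F ** transpose S = mat 1"
    using S_inverse by (simp_all add: matrix_transpose_mul[symmetric])
  have "(S ** transpose S) ** ?G = S ** ((transpose S ** transpose F) ** F)"
    by (simp add: matrix_mul_assoc)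
  then have 1: "(S ** transpose S) ** ?G = mat 1" by (simp add: tr S_inverse)
  have "?G ** (S ** transpose S) = transpose F ** ((F ** S) ** transpose S)"
    by (simp add: matrix_mul_assoc)
  then have 2: "?G ** (S ** transpose S) = mat 1" by (simp add: tr S_inverse)
  have "(S ** transpose S) ** matrix_inv (S ** transpose S) = mat 1"
    unfolding matrix_inv_def using 1 2
    by (rule_tac someI2[of _ ?G]) auto
  then have "?G = (?G ** (S ** transpose S)) ** matrix_inv (S ** transpose S)"
    by (simp only: matrix_mul_assoc[symmetric] matrix_mul_rid)
  then have inv: "matrix_inv (S ** transpose S) = ?G" by (simp only: 2 matrix_mul_lid)
  have n: "z \<bullet> (?G *v z) = (norm (F *v z))\<^sup>2" for z
  proof -
    have "z \<bullet> (?G *v z) = ((F *v z) v* F) \<bullet> z"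
      by (simp only: matrix_vector_mul_assoc[symmetric] transpose_matrix_vector inner_commute)
    then show ?thesis by (simp add: dot_lmul_matrix power2_norm_eq_inner)
  qed
  have pos: "0 < 2 * pi" by simp
  have "sqrt ((2 * pi) ^ CARD('p) * det (S ** transpose S)) = sqrt ((2 * pi) ^ CARD('p)) * \<bar>det S\<bar>"
    by (simp add: det_mul det_transpose real_sqrt_mult)
  moreover have "sqrt ((2 * pi) ^ CARD('p)) = (2 * pi) powr (real CARD('p) / 2)"
    unfolding powr_realpow[symmetric, OF pos] powr_half_sqrt[symmetric, OF powr_ge_zero] powr_powr
    by simp
  ultimately show ?thesis
    by (simp add: gaussian_density_def gauss_pdf_def inv n powr_minus_divide)
qed

text \<open>The density is taken relative to the standard Gaussian law: the reference is a
  probability measure, and reference observations can be read off from a noise path.\<close>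

definition lr :: "real^'d \<Rightarrow> real^'p \<Rightarrow> real" where
  "lr x y = obs_density B S x y / gauss_pdf y"

lemma obs_density_eq: "obs_density B S x y = gauss_pdf (F *v (y - B *v x)) / \<bar>det S\<bar>"
  by (simp add: obs_density_def gaussian_density_eq)

lemma obs_density_pos: "0 < obs_density B S x y"
  by (simp add: obs_density_eq gauss_pdf_pos S_inverse)

lemma lr_pos: "0 < lr x y"
  by (simp add: lr_def obs_density_pos gauss_pdf_pos)

lemma measurable_obs_density [measurable]:
  assumes [measurable]: "f \<in> borel_measurable N" "g \<in> borel_measurable N"
  shows "(\<lambda>\<omega>. obs_density B S (f \<omega>) (g \<omega>)) \<in> borel_measurable N"
  unfolding obs_density_eq by measurable

lemma measurable_lr [measurable]:
  assumes [measurable]: "f \<in> borel_measurable N" "g \<in> borel_measurable N"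
  shows "(\<lambda>\<omega>. lr (f \<omega>) (g \<omega>)) \<in> borel_measurable N"
  unfolding lr_def by measurable

text \<open>Weighted by \<open>lr x\<close>, the reference law becomes the observation law at state
  \<open>x\<close>: shift by \<open>B x\<close>, then substitute \<open>S v\<close>, whose Jacobian
  cancels the determinant in the density.\<close>

lemma nn_integral_lr:
  assumes [measurable]: "h \<in> borel_measurable borel"
  shows "(\<integral>\<^sup>+v. ennreal (lr x v) * h v \<partial>std_gaussian) = (\<integral>\<^sup>+v. h (B *v x + S *v v) \<partial>std_gaussian)"
proof -
  have [simp]: "F *v (S *v v) = v" for v by (simp add: matrix_vector_mul_assoc S_inverse)
  have "(\<integral>\<^sup>+v. ennreal (lr x v) * h v \<partial>std_gaussian) = (\<integral>\<^sup>+y. ennreal (obs_density B S x y) * h y \<partial>lborel)"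
  proof -
    have "gauss_pdf v * lr x v = obs_density B S x v" for v
      using gauss_pdf_pos[of v] by (simp add: lr_def)
    then have "ennreal (gauss_pdf v) * (ennreal (lr x v) * h v) = ennreal (obs_density B S x v) * h v" for v
      by (metis ennreal_mult' gauss_pdf_pos less_imp_le mult.assoc)
    then show ?thesis
      unfolding std_gaussian_eq by (subst nn_integral_density) auto
  qed
  also have "\<dots> = (\<integral>\<^sup>+y. ennreal (obs_density B S x y) * h y \<partial>(distr lborel borel ((+) (B *v x))))"
    by (simp only: lborel_distr_plus)
  also have "\<dots> = (\<integral>\<^sup>+y. ennreal (obs_density B S x (B *v x + y)) * h (B *v x + y) \<partial>lborel)"
    by (rule nn_integral_distr) auto
  also have "\<dots> = ennreal \<bar>det S\<bar> * (\<integral>\<^sup>+y. ennreal (obs_density B S x (B *v x + S *v y)) * h (B *v x + S *v y) \<partial>lborel)"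
    by (rule nn_integral_lborel_matrix[symmetric]) (auto simp: S_inverse)
  also have "\<dots> = (\<integral>\<^sup>+y. ennreal \<bar>det S\<bar> * (ennreal (gauss_pdf y / \<bar>det S\<bar>) * h (B *v x + S *v y)) \<partial>lborel)"
    by (subst nn_integral_cmult[symmetric]) (auto simp: obs_density_eq)
  also have "\<dots> = (\<integral>\<^sup>+y. ennreal (gauss_pdf y) * h (B *v x + S *v y) \<partial>lborel)"
  proof -
    have "ennreal \<bar>det S\<bar> * (ennreal (gauss_pdf y / \<bar>det S\<bar>) * c) = ennreal (gauss_pdf y) * c" for y c
      by (subst mult.assoc[symmetric], subst ennreal_mult[symmetric]) (auto simp: S_inverse gauss_pdf_pos less_imp_le)
    then show ?thesis by (intro nn_integral_cong)
  qed
  also have "\<dots> = (\<integral>\<^sup>+v. h (B *v x + S *v v) \<partial>std_gaussian)"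
    unfolding std_gaussian_eq by (subst nn_integral_density) auto
  finally show ?thesis .
qed

end

subsection \<open>Change of measure for the observations\<close>

lemma measurable_fst_borel [measurable (raw)]:
  fixes f :: "'c \<Rightarrow> 'a::euclidean_space \<times> 'b::euclidean_space"
  assumes "f \<in> borel_measurable M"
  shows "(\<lambda>x. fst (f x)) \<in> borel_measurable M" "(\<lambda>x. snd (f x)) \<in> borel_measurable M"
  by (rule measurable_compose[OF assms], simp add: borel_prod[symmetric])+

definition noise :: "(nat \<Rightarrow> 'a::euclidean_space) measure" where
  "noise = (\<Pi>\<^sub>M k\<in>UNIV. std_gaussian)"

lemma sets_noise [measurable_cong]: "sets noise = sets (\<Pi>\<^sub>M k\<in>(UNIV::nat set). borel)"
  unfolding noise_def by (intro sets_PiM_cong) auto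

lemma space_noise [simp]: "space noise = UNIV"
  by (simp add: noise_def space_PiM)

lemma sequence_space_std_gaussian: "sequence_space (std_gaussian :: 'a::euclidean_space measure)"
  unfolding sequence_space_def by (rule product_prob_spaceI) (rule prob_space_std_gaussian)

lemma prob_space_noise: "prob_space (noise :: (nat \<Rightarrow> 'a::euclidean_space) measure)"
  unfolding noise_def by (rule prob_space_PiM) (rule prob_space_std_gaussian)

abbreviation seq_borel :: "(nat \<Rightarrow> 'a::topological_space) measure" where
  "seq_borel \<equiv> (\<Pi>\<^sub>M k\<in>UNIV. borel)"

lemma space_seq_borel [simp]: "space seq_borel = UNIV"
  by (simp add: space_PiM)

lemma measurable_into_noise: "measurable N noise = measurable N seq_borel"
  by (intro measurable_cong_sets refl sets_noise)

lemma measurable_seqI: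
  "(\<And>k. (\<lambda>\<omega>. f \<omega> k) \<in> borel_measurable N) \<Longrightarrow> f \<in> measurable N (seq_borel :: (nat \<Rightarrow> 'a::topological_space) measure)"
  by (rule measurable_PiM_single') (auto simp: space_PiM)

lemma sigma_finite_noise: "sigma_finite_measure (noise :: (nat \<Rightarrow> 'a::euclidean_space) measure)"
  by (intro prob_space_imp_sigma_finite prob_space_noise)

lemma sigma_finite_std_gaussian: "sigma_finite_measure (std_gaussian :: 'a::euclidean_space measure)"
  by (intro prob_space_imp_sigma_finite prob_space_std_gaussian)

lemma emeasure_noise_UNIV [simp]: "emeasure (noise :: (nat \<Rightarrow> 'a::euclidean_space) measure) UNIV = 1"
  using prob_space.emeasure_space_1[OF prob_space_noise] by simp

lemma emeasure_std_gaussian_UNIV [simp]: "emeasure (std_gaussian :: 'a::euclidean_space measure) UNIV = 1"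
  using prob_space.emeasure_space_1[OF prob_space_std_gaussian] by simp

lemma nn_integral_swap:
  assumes "sigma_finite_measure M" "sigma_finite_measure N"
    and "(\<lambda>(x, y). f x y) \<in> borel_measurable (M \<Otimes>\<^sub>M N)"
  shows "(\<integral>\<^sup>+x. \<integral>\<^sup>+y. f x y \<partial>N \<partial>M) = (\<integral>\<^sup>+y. \<integral>\<^sup>+x. f x y \<partial>M \<partial>N)"
  using pair_sigma_finite.Fubini'[of M N f] assms by (simp add: pair_sigma_finite_def)

lemma noise_Suc:
  "distr (std_gaussian \<Otimes>\<^sub>M noise) noise (\<lambda>(s, w). case_nat s w) = (noise :: (nat \<Rightarrow> 'a::euclidean_space) measure)"
  unfolding noise_def by (rule sequence_space.PiM_iter[OF sequence_space_std_gaussian])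

text \<open>The inductions on time rest on this: the first noise variable is integrated apart, and
  the remaining path has again law \<open>noise\<close>.\<close>

lemma nn_integral_noise_Suc:
  fixes h :: "(nat \<Rightarrow> 'a::euclidean_space) \<Rightarrow> ennreal"
  assumes [measurable]: "h \<in> borel_measurable noise"
  shows "(\<integral>\<^sup>+w. h w \<partial>noise) = (\<integral>\<^sup>+s. \<integral>\<^sup>+w. h (case_nat s w) \<partial>noise \<partial>std_gaussian)"
proof -
  interpret sigma_finite_measure "noise :: (nat \<Rightarrow> 'a) measure" by (rule sigma_finite_noise)
  have "(\<integral>\<^sup>+w. h w \<partial>noise) = (\<integral>\<^sup>+w. h w \<partial>(distr (std_gaussian \<Otimes>\<^sub>M noise) noise (\<lambda>(s, w). case_nat s w)))"
    by (simp only: noise_Suc)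
  also have "\<dots> = (\<integral>\<^sup>+z. h (case_nat (fst z) (snd z)) \<partial>(std_gaussian \<Otimes>\<^sub>M noise))"
    by (subst nn_integral_distr) (simp_all add: case_prod_beta measurable_into_noise)
  also have "\<dots> = (\<integral>\<^sup>+s. \<integral>\<^sup>+w. h (case_nat s w) \<partial>noise \<partial>std_gaussian)"
    by (subst nn_integral_fst[symmetric]) auto
  finally show ?thesis .
qed

lemma nn_integral_std_gaussian_pair:
  fixes h :: "'a::euclidean_space \<times> 'b::euclidean_space \<Rightarrow> ennreal"
  assumes "h \<in> borel_measurable borel"
  shows "(\<integral>\<^sup>+s. h s \<partial>std_gaussian) = (\<integral>\<^sup>+u. \<integral>\<^sup>+v. h (u, v) \<partial>std_gaussian \<partial>std_gaussian)"
proof -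
  interpret sigma_finite_measure "std_gaussian :: 'b measure" by (rule sigma_finite_std_gaussian)
  have [measurable]: "h \<in> borel_measurable (borel \<Otimes>\<^sub>M borel)" using assms by (simp add: borel_prod)
  show ?thesis
    unfolding std_gaussian_pair by (subst nn_integral_fst[symmetric]) auto
qed

lemma nn_integral_std_gaussian_fst:
  assumes [measurable]: "h \<in> borel_measurable borel"
  shows "(\<integral>\<^sup>+s. h (fst s) \<partial>(std_gaussian :: ('a::euclidean_space \<times> 'b::euclidean_space) measure)) = (\<integral>\<^sup>+u. h u \<partial>std_gaussian)"
  by (subst nn_integral_std_gaussian_pair) auto

lemma nn_integral_std_gaussian_snd:
  assumes [measurable]: "h \<in> borel_measurable borel"
  shows "(\<integral>\<^sup>+s. h (snd s) \<partial>(std_gaussian :: ('a::euclidean_space \<times> 'b::euclidean_space) measure)) = (\<integral>\<^sup>+u. h u \<partial>std_gaussian)"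
  by (subst nn_integral_std_gaussian_pair) auto

lemma state_case_nat: "state A R x (case_nat s w) (Suc k) = state A R (A *v x + R *v fst s) w k"
  by (induct k) auto

lemma obs_case_nat: "obs A R B S x (case_nat s w) (Suc k) = obs A R B S (A *v x + R *v fst s) w k"
  by (simp add: obs_def state_case_nat del: state.simps)

lemma measurable_state [measurable (raw)]:
  fixes A :: "real^'d^'d" and R :: "real^'q^'d" and g :: "'c \<Rightarrow> nat \<Rightarrow> (real^'q) \<times> (real^'p)"
  assumes [measurable]: "f \<in> borel_measurable N" "g \<in> measurable N seq_borel"
  shows "(\<lambda>\<omega>. state A R (f \<omega>) (g \<omega>) k) \<in> borel_measurable N"
  by (induct k) auto

lemma measurable_obs [measurable (raw)]:
  fixes A :: "real^'d^'d" and R :: "real^'q^'d" and B :: "real^'d^'p" and S :: "real^'p^'p"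
  assumes [measurable]: "f \<in> borel_measurable N" "g \<in> measurable N seq_borel"
  shows "(\<lambda>\<omega>. obs A R B S (f \<omega>) (g \<omega>) k) \<in> borel_measurable N"
  unfolding obs_def by measurable

lemma measurable_obs_seq [measurable (raw)]:
  fixes A :: "real^'d^'d" and R :: "real^'q^'d" and B :: "real^'d^'p" and S :: "real^'p^'p"
  assumes [measurable]: "f \<in> borel_measurable N" "g \<in> measurable N seq_borel"
  shows "(\<lambda>\<omega>. obs A R B S (f \<omega>) (g \<omega>)) \<in> measurable N seq_borel"
  by (rule measurable_seqI) measurable

definition fsts :: "(nat \<Rightarrow> 'a \<times> 'b) \<Rightarrow> nat \<Rightarrow> 'a" where "fsts w k = fst (w k)"
definition snds :: "(nat \<Rightarrow> 'a \<times> 'b) \<Rightarrow> nat \<Rightarrow> 'b" where "snds w k = snd (w k)"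

lemma fsts_case_nat: "fsts (case_nat s w) = case_nat (fst s) (fsts w)"
  by (auto simp: fsts_def fun_eq_iff split: nat.split)

lemma snds_case_nat: "snds (case_nat s w) = case_nat (snd s) (snds w)"
  by (auto simp: snds_def fun_eq_iff split: nat.split)

lemma measurable_fsts_snds [measurable (raw)]:
  fixes f :: "'c \<Rightarrow> nat \<Rightarrow> 'a::euclidean_space \<times> 'b::euclidean_space"
  assumes [measurable]: "f \<in> measurable N seq_borel"
  shows "(\<lambda>\<omega>. fsts (f \<omega>)) \<in> measurable N seq_borel" "(\<lambda>\<omega>. snds (f \<omega>)) \<in> measurable N seq_borel"
  unfolding fsts_def[abs_def] snds_def[abs_def] by (rule measurable_seqI, measurable)+

lemma measurable_fsts_snds_component [measurable (raw)]:
  fixes f :: "'c \<Rightarrow> nat \<Rightarrow> 'a::euclidean_space \<times> 'b::euclidean_space"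
  assumes [measurable]: "f \<in> measurable N seq_borel"
  shows "(\<lambda>\<omega>. fsts (f \<omega>) k) \<in> borel_measurable N" "(\<lambda>\<omega>. snds (f \<omega>) k) \<in> borel_measurable N"
  unfolding fsts_def[abs_def] snds_def[abs_def] by measurable

lemma nn_integral_trans_kernel:
  fixes A :: "real^'d^'d" and R :: "real^'q^'d"
  assumes [measurable]: "h \<in> borel_measurable borel"
  shows "(\<integral>\<^sup>+x'. h x' \<partial>(trans_kernel A R x))
    = (\<integral>\<^sup>+s. h (A *v x + R *v fst s) \<partial>(std_gaussian :: ((real^'q) \<times> (real^'p)) measure))"
proof -
  have "(\<integral>\<^sup>+x'. h x' \<partial>(trans_kernel A R x)) = (\<integral>\<^sup>+u. h (A *v x + R *v u) \<partial>std_gaussian)"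
    unfolding trans_kernel_def gaussian_def by (subst nn_integral_distr) auto
  also have "\<dots> = (\<integral>\<^sup>+s. h (A *v x + R *v fst s) \<partial>(std_gaussian :: ((real^'q) \<times> (real^'p)) measure))"
    by (rule nn_integral_std_gaussian_fst[symmetric]) auto
  finally show ?thesis .
qed

context linear_model
begin

abbreviation Y :: "real^'d \<Rightarrow> (nat \<Rightarrow> (real^'q) \<times> (real^'p)) \<Rightarrow> nat \<Rightarrow> real^'p"
  where "Y \<equiv> obs A R B S"

text \<open>The iterated kernel integrals become one integral over noise paths. These are shared by
  all models and initial states, which is what permits a pathwise comparison of likelihoods.\<close>

lemma lik_from_eq:
  "lik_from A R B S n y x = (\<integral>\<^sup>+w. (\<Prod>k\<le>n. ennreal (obs_density B S (X x w k) (y k))) \<partial>noise)"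
proof (induction n arbitrary: x y)
  case 0
  show ?case by simp
next
  case (Suc n)
  let ?h = "\<lambda>x'. \<integral>\<^sup>+w. (\<Prod>k\<le>n. ennreal (obs_density B S (X x' w k) (y (Suc k)))) \<partial>noise"
  interpret sigma_finite_measure "noise :: (nat \<Rightarrow> (real^'q) \<times> (real^'p)) measure" by (rule sigma_finite_noise)
  have "lik_from A R B S (Suc n) y x = ennreal (obs_density B S x (y 0)) *
     (\<integral>\<^sup>+s. ?h (A *v x + R *v fst s) \<partial>(std_gaussian :: ((real^'q) \<times> (real^'p)) measure))"
    unfolding lik_from.simps Suc.IH by (subst nn_integral_trans_kernel[where 'p = 'p]) auto
  also have "\<dots> = (\<integral>\<^sup>+s. \<integral>\<^sup>+w. ennreal (obs_density B S x (y 0)) *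
      (\<Prod>k\<le>n. ennreal (obs_density B S (X (A *v x + R *v fst s) w k) (y (Suc k)))) \<partial>noise \<partial>(std_gaussian :: ((real^'q) \<times> (real^'p)) measure))"
    by (simp add: nn_integral_cmult)
  also have "\<dots> = (\<integral>\<^sup>+s. \<integral>\<^sup>+w. (\<Prod>k\<le>Suc n. ennreal (obs_density B S (X x (case_nat s w) k) (y k))) \<partial>noise \<partial>std_gaussian)"
    by (subst prod.atMost_Suc_shift) (simp add: state_case_nat del: state.simps(2))
  also have "\<dots> = (\<integral>\<^sup>+w. (\<Prod>k\<le>Suc n. ennreal (obs_density B S (X x w k) (y k))) \<partial>noise)"
    by (rule nn_integral_noise_Suc[symmetric]) measurable
  finally show ?case .
qed

text \<open>The first components of \<open>w\<close> are the state noise, the second components of \<open>w'\<close> stand for the observations.\<close>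

lemma change_of_measure:
  fixes H :: "(nat \<Rightarrow> real^'q) \<Rightarrow> (nat \<Rightarrow> real^'p) \<Rightarrow> ennreal"
  assumes "(\<lambda>(u, y). H u y) \<in> borel_measurable (seq_borel \<Otimes>\<^sub>M seq_borel)"
    and "\<And>u u' y y'. (\<And>k. k < n \<Longrightarrow> u k = u' k \<and> y k = y' k) \<Longrightarrow> H u y = H u' y'"
  shows "(\<integral>\<^sup>+w'. \<integral>\<^sup>+w. (\<Prod>k<n. ennreal (lr (X x w k) (snds w' k))) * H (fsts w) (snds w')
      \<partial>noise \<partial>(noise :: (nat \<Rightarrow> (real^'q) \<times> (real^'p)) measure)) = (\<integral>\<^sup>+w. H (fsts w) (Y x w) \<partial>noise)"
  using assms
proof (induction n arbitrary: x H)
  case 0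
  \<comment> \<open>For \<open>n = 0\<close> the dependence hypothesis says that \<open>H\<close> is
    constant.\<close>
  obtain c where "H = (\<lambda>_ _. c)"
  proof
    show "H = (\<lambda>_ _. H (\<lambda>_. 0) (\<lambda>_. 0))" by (intro ext, rule 0) simp
  qed
  then show ?case by simp
next
  case (Suc n)
  let ?N = "noise :: (nat \<Rightarrow> (real^'q) \<times> (real^'p)) measure"
  let ?G = "std_gaussian :: ((real^'q) \<times> (real^'p)) measure"
  note Suc.prems(1)[measurable]
  define xs where "xs s = A *v x + R *v fst s" for s :: "(real^'q) \<times> (real^'p)"
  have [measurable]: "xs \<in> borel_measurable borel" unfolding xs_def by measurable
  interpret N: sigma_finite_measure ?N by (rule sigma_finite_noise)
  interpret Gp: sigma_finite_measure "std_gaussian :: (real^'p) measure" by (rule sigma_finite_std_gaussian)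
  interpret G: sigma_finite_measure ?G by (rule sigma_finite_std_gaussian)
  define K where "K u v = (\<integral>\<^sup>+w. H (case_nat u (fsts w)) (case_nat v (Y (A *v x + R *v u) w)) \<partial>?N)" for u v
  have [measurable]: "(\<lambda>(u, v). K u v) \<in> borel_measurable (borel \<Otimes>\<^sub>M borel)"
    unfolding K_def by measurable
  \<comment> \<open>The integrand after both paths have lost their first entry. The first state
    noise and the first observation are frozen inside \<open>H\<close>; this is why the induction
    runs over all \<open>H\<close>.\<close>
  define J where "J s w' w v = (\<Prod>k<n. ennreal (lr (X (xs s) w k) (snds w' k))) *
      H (fsts (case_nat s w)) (case_nat v (snds w'))"
    for s :: "(real^'q) \<times> (real^'p)" and w w' :: "nat \<Rightarrow> (real^'q) \<times> (real^'p)" and v :: "real^'p"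
  have J_meas: "(\<lambda>(w', s). \<integral>\<^sup>+w. c * J s w' w v \<partial>?N) \<in> borel_measurable (?N \<Otimes>\<^sub>M ?G)"
    and J_meas1: "(\<lambda>w. J s w' w v) \<in> borel_measurable ?N"
    and J_meas2: "(\<lambda>w'. \<integral>\<^sup>+w. J s w' w v \<partial>?N) \<in> borel_measurable ?N" for c v s w'
    subgoal unfolding J_def by measurable
    subgoal unfolding J_def by (measurable; simp add: space_PiM)
    subgoal unfolding J_def by (measurable; simp add: space_PiM)
    done
  have IH: "(\<integral>\<^sup>+w'. \<integral>\<^sup>+w. J s w' w v \<partial>noise \<partial>?N) = K (fst s) v" for s v
    unfolding J_def K_def xs_def fsts_case_nat
  proof (rule Suc.IH)
    fix u u' y y' assume "\<And>k. k < n \<Longrightarrow> u k = (u' k :: real^'q) \<and> y k = (y' k :: real^'p)"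
    then show "H (case_nat (fst s) u) (case_nat v y) = H (case_nat (fst s) u') (case_nat v y')"
      by (intro Suc.prems(2)) (auto split: nat.split)
  qed measurable
  have "(\<integral>\<^sup>+w'. \<integral>\<^sup>+w. (\<Prod>k<Suc n. ennreal (lr (X x w k) (snds w' k))) * H (fsts w) (snds w') \<partial>noise \<partial>?N)
    = (\<integral>\<^sup>+s'. \<integral>\<^sup>+w'. \<integral>\<^sup>+s. \<integral>\<^sup>+w. ennreal (lr x (snd s')) * J s w' w (snd s') \<partial>?N \<partial>?G \<partial>?N \<partial>?G)"
  proof -
    let ?T = "\<lambda>w' w. (\<Prod>k<Suc n. ennreal (lr (X x w k) (snds w' k))) * H (fsts w) (snds w')"
    have T: "?T (case_nat s' w') (case_nat s w) = ennreal (lr x (snd s')) * J s w' w (snd s')" for s s' w w'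
      unfolding prod.lessThan_Suc_shift snds_case_nat state_case_nat J_def xs_def by (simp add: mult.assoc)
    have "(\<integral>\<^sup>+w'. \<integral>\<^sup>+w. ?T w' w \<partial>?N \<partial>?N) = (\<integral>\<^sup>+s'. \<integral>\<^sup>+w'. \<integral>\<^sup>+w. ?T (case_nat s' w') w \<partial>?N \<partial>?N \<partial>?G)"
      by (rule nn_integral_noise_Suc) measurable
    also have "\<dots> = (\<integral>\<^sup>+s'. \<integral>\<^sup>+w'. \<integral>\<^sup>+s. \<integral>\<^sup>+w. ?T (case_nat s' w') (case_nat s w) \<partial>?N \<partial>?G \<partial>?N \<partial>?G)"
      by (intro nn_integral_cong nn_integral_noise_Suc) measurable
    finally show ?thesis unfolding T .
  qed
  \<comment> \<open>The first state noise \<open>s\<close> is brought outside, so that the two inner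
    integrals over the tails match the induction hypothesis at the state
    \<open>xs s\<close>.\<close>
  also have "\<dots> = (\<integral>\<^sup>+s'. \<integral>\<^sup>+s. \<integral>\<^sup>+w'. \<integral>\<^sup>+w. ennreal (lr x (snd s')) * J s w' w (snd s') \<partial>?N \<partial>?N \<partial>?G \<partial>?G)"
    by (rule nn_integral_cong, rule nn_integral_swap[OF sigma_finite_noise sigma_finite_std_gaussian J_meas])
  also have "\<dots> = (\<integral>\<^sup>+s'. \<integral>\<^sup>+s. ennreal (lr x (snd s')) * (\<integral>\<^sup>+w'. \<integral>\<^sup>+w. J s w' w (snd s') \<partial>?N \<partial>?N) \<partial>?G \<partial>?G)"
    by (subst nn_integral_cmult, rule J_meas1, subst nn_integral_cmult, rule J_meas2, rule refl)
  also have "\<dots> = (\<integral>\<^sup>+s'. \<integral>\<^sup>+s. ennreal (lr x (snd s')) * K (fst s) (snd s') \<partial>?G \<partial>?G)"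
    by (simp only: IH)
  also have "\<dots> = (\<integral>\<^sup>+s. \<integral>\<^sup>+s'. ennreal (lr x (snd s')) * K (fst s) (snd s') \<partial>?G \<partial>?G)"
    by (intro nn_integral_swap sigma_finite_std_gaussian) measurable
  also have "\<dots> = (\<integral>\<^sup>+s. \<integral>\<^sup>+v. ennreal (lr x v) * K (fst s) v \<partial>std_gaussian \<partial>?G)"
    by (intro nn_integral_cong nn_integral_std_gaussian_snd[where h = "\<lambda>v. ennreal (lr x v) * K (fst s) v" for s]) measurable
  also have "\<dots> = (\<integral>\<^sup>+s. \<integral>\<^sup>+v. K (fst s) (B *v x + S *v v) \<partial>std_gaussian \<partial>?G)"
    by (intro nn_integral_cong nn_integral_lr) measurable
  also have "\<dots> = (\<integral>\<^sup>+u. \<integral>\<^sup>+v. K u (B *v x + S *v v) \<partial>std_gaussian \<partial>std_gaussian)"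
    by (rule nn_integral_std_gaussian_fst) measurable
  also have "\<dots> = (\<integral>\<^sup>+s. K (fst s) (B *v x + S *v snd s) \<partial>?G)"
  proof -
    have "(\<lambda>(u, v). K u (B *v x + S *v v)) \<in> borel_measurable (borel \<Otimes>\<^sub>M borel)" by measurable
    then have "(\<lambda>s. K (fst s) (B *v x + S *v snd s)) \<in> borel_measurable borel"
      by (simp only: borel_prod case_prod_beta')
    from nn_integral_std_gaussian_pair[OF this] show ?thesis by simp
  qed
  also have "\<dots> = (\<integral>\<^sup>+s. \<integral>\<^sup>+w. H (fsts (case_nat s w)) (Y x (case_nat s w)) \<partial>?N \<partial>?G)"
  proof -
    have "Y x (case_nat s w) = case_nat (B *v x + S *v snd s) (Y (A *v x + R *v fst s) w)" for s w
    proof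
      show "Y x (case_nat s w) k = case_nat (B *v x + S *v snd s) (Y (A *v x + R *v fst s) w) k" for k
        by (cases k) (simp_all add: obs_case_nat, simp add: obs_def)
    qed
    then show ?thesis by (simp add: K_def fsts_case_nat)
  qed
  also have "\<dots> = (\<integral>\<^sup>+w. H (fsts w) (Y x w) \<partial>?N)"
    by (rule nn_integral_noise_Suc[symmetric]) measurable
  finally show ?case .
qed

end

subsection \<open>Concentration of window averages\<close>

lemma nn_integral_noise_prod:
  assumes [measurable]: "h \<in> borel_measurable borel"
  shows "(\<integral>\<^sup>+w. (\<Prod>k<n. h (w k)) \<partial>(noise :: (nat \<Rightarrow> 'a::euclidean_space) measure)) = (\<integral>\<^sup>+s. h s \<partial>std_gaussian) ^ n"
proof (induction n)
  case (Suc n)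
  interpret sigma_finite_measure "noise :: (nat \<Rightarrow> 'a) measure" by (rule sigma_finite_noise)
  have "(\<integral>\<^sup>+w. (\<Prod>k<Suc n. h (w k)) \<partial>noise) = (\<integral>\<^sup>+s. \<integral>\<^sup>+w. (\<Prod>k<Suc n. h (case_nat s w k)) \<partial>noise \<partial>std_gaussian)"
    by (rule nn_integral_noise_Suc) measurable
  also have "\<dots> = (\<integral>\<^sup>+s. \<integral>\<^sup>+w. h s * (\<Prod>k<n. h (w k)) \<partial>noise \<partial>std_gaussian)"
    unfolding prod.lessThan_Suc_shift by simp
  also have "\<dots> = (\<integral>\<^sup>+s. h s \<partial>std_gaussian) * (\<integral>\<^sup>+w. (\<Prod>k<n. h (w k)) \<partial>noise)"
    by (subst nn_integral_cmult, measurable, subst nn_integral_multc, measurable)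
  finally show ?case using Suc by simp
qed simp

lemma nn_integral_noise_component:
  assumes [measurable]: "h \<in> borel_measurable borel"
  shows "(\<integral>\<^sup>+w. h (w k) \<partial>(noise :: (nat \<Rightarrow> 'a::euclidean_space) measure)) = (\<integral>\<^sup>+s. h s \<partial>std_gaussian)"
proof (induction k)
  case 0
  then show ?case by (subst nn_integral_noise_Suc) auto
next
  case (Suc k)
  then show ?case by (subst nn_integral_noise_Suc) auto
qed

lemma noise_energy_moment:
  "(\<integral>\<^sup>+w. ennreal (exp ((\<Sum>k<n. (norm (w k))\<^sup>2) / 4)) \<partial>(noise :: (nat \<Rightarrow> 'a::euclidean_space) measure))
    = ennreal (sqrt 2 ^ DIM('a)) ^ n"
proof -
  have "ennreal (exp ((\<Sum>k<n. (norm (w k))\<^sup>2) / 4)) = (\<Prod>k<n. ennreal (exp ((norm (w k))\<^sup>2 / 4)))" for w :: "nat \<Rightarrow> 'a"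
    by (simp add: sum_divide_distrib exp_sum prod_ennreal)
  then show ?thesis
    using nn_integral_noise_prod[of "\<lambda>s :: 'a. ennreal (exp ((norm s)\<^sup>2 / 4))" n] by (simp add: std_gaussian_exp_moment)
qed

lemma nn_integral_noise_comb:
  fixes h :: "(nat \<Rightarrow> 'a::euclidean_space) \<Rightarrow> ennreal"
  assumes [measurable]: "h \<in> borel_measurable noise"
  shows "(\<integral>\<^sup>+w. h w \<partial>noise) = (\<integral>\<^sup>+w. \<integral>\<^sup>+w'. h (comb_seq i w w') \<partial>noise \<partial>noise)"
proof -
  interpret sigma_finite_measure "noise :: (nat \<Rightarrow> 'a) measure" by (rule sigma_finite_noise)
  have [measurable]: "(\<lambda>z. comb_seq i (fst z) (snd z)) \<in> measurable (noise \<Otimes>\<^sub>M noise) (noise :: (nat \<Rightarrow> 'a) measure)"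
    using measurable_comb_seq[of i "std_gaussian :: 'a measure"] by (simp add: noise_def case_prod_beta')
  have "(\<integral>\<^sup>+w. h w \<partial>noise) = (\<integral>\<^sup>+w. h w \<partial>(distr (noise \<Otimes>\<^sub>M noise) noise (\<lambda>(w, w'). comb_seq i w w')))"
    unfolding noise_def by (simp only: sequence_space.PiM_comb_seq[OF sequence_space_std_gaussian])
  also have "\<dots> = (\<integral>\<^sup>+z. h (comb_seq i (fst z) (snd z)) \<partial>(noise \<Otimes>\<^sub>M noise))"
    by (subst nn_integral_distr) (simp_all add: case_prod_beta')
  also have "\<dots> = (\<integral>\<^sup>+w. \<integral>\<^sup>+w'. h (comb_seq i w w') \<partial>noise \<partial>noise)"
    by (subst nn_integral_fst[symmetric]) auto
  finally show ?thesis .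
qed

lemma measurable_shift [measurable (raw)]:
  assumes [measurable]: "f \<in> measurable N seq_borel"
  shows "(\<lambda>\<omega> k. f \<omega> (j + k)) \<in> measurable N seq_borel"
  by (rule measurable_seqI) measurable

text \<open>The blocks use disjoint coordinates of a product measure, hence are independent copies;
  \<open>comb_seq\<close> splits off one block at a time.\<close>

lemma block_exp_moment:
  fixes g :: "(nat \<Rightarrow> 'a::euclidean_space) \<Rightarrow> ennreal"
  assumes [measurable]: "g \<in> borel_measurable noise"
    and dep: "\<And>w w'. (\<And>k. k < M \<Longrightarrow> w k = w' k) \<Longrightarrow> g w = g w'"
  shows "(\<integral>\<^sup>+w. (\<Prod>i<N. g (\<lambda>k. w (i * M + k))) \<partial>noise) = (\<integral>\<^sup>+w. g w \<partial>noise) ^ N"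
proof (induction N)
  case (Suc N)
  let ?p = "\<lambda>N w. \<Prod>i<N. g (\<lambda>k. w (i * M + k))"
  have "(\<integral>\<^sup>+w. ?p (Suc N) w \<partial>noise) = (\<integral>\<^sup>+w. \<integral>\<^sup>+w'. ?p (Suc N) (comb_seq M w w') \<partial>noise \<partial>noise)"
    by (rule nn_integral_noise_comb) measurable
  also have "\<dots> = (\<integral>\<^sup>+w. \<integral>\<^sup>+w'. g w * ?p N w' \<partial>noise \<partial>noise)"
  proof -
    have "g (comb_seq M w w') = g w" for w w' :: "nat \<Rightarrow> 'a"
      by (rule dep) (simp add: comb_seq_def)
    moreover have "(\<lambda>k. comb_seq M w w' (Suc i * M + k)) = (\<lambda>k. w' (i * M + k))" for w w' :: "nat \<Rightarrow> 'a" and i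
      by (auto simp: comb_seq_def)
    ultimately show ?thesis unfolding prod.lessThan_Suc_shift by simp
  qed
  also have "\<dots> = (\<integral>\<^sup>+w. g w \<partial>noise) * (\<integral>\<^sup>+w. ?p N w \<partial>noise)"
    by (subst nn_integral_cmult, measurable, subst nn_integral_multc, measurable)
  finally show ?case using Suc by simp
qed simp

text \<open>Chernoff's bound with Hoeffding's lemma. The range is an arbitrary unit interval so that
  the lower tail follows by applying the bound to \<open>- g\<close>.\<close>

lemma block_hoeffding_upper:
  fixes g :: "(nat \<Rightarrow> 'a::euclidean_space) \<Rightarrow> real"
  assumes [measurable]: "g \<in> borel_measurable noise"
    and dep: "\<And>w w'. (\<And>k. k < M \<Longrightarrow> w k = w' k) \<Longrightarrow> g w = g w'"
    and bd: "\<And>w. g w \<in> {a..a + 1}" and "\<epsilon> > 0"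
  shows "emeasure noise {w. real N * (LINT w|noise. g w) + real N * \<epsilon> \<le> (\<Sum>i<N. g (\<lambda>k. w (i * M + k)))}
    \<le> ennreal (exp (- 2 * real N * \<epsilon>\<^sup>2))"
proof -
  let ?N = "noise :: (nat \<Rightarrow> 'a) measure"
  interpret prob_space ?N by (rule prob_space_noise)
  interpret interval_bounded_random_variable ?N g a "a + 1"
    by unfold_locales (use bd in auto)
  let ?\<mu> = "expectation g"
  let ?T = "\<lambda>w. \<Sum>i<N. g (\<lambda>k. w (i * M + k))"
  \<comment> \<open>The minimiser of \<open>- l * \<epsilon> + l^2 / 8\<close>, with value
    \<open>- 2 * \<epsilon>^2\<close>.\<close>
  define l where "l = 4 * \<epsilon>"
  have l: "l > 0" using \<open>\<epsilon> > 0\<close> by (simp add: l_def)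
  have "emeasure ?N {w. real N * ?\<mu> + real N * \<epsilon> \<le> ?T w}
    = (\<integral>\<^sup>+w. indicator {w. real N * ?\<mu> + real N * \<epsilon> \<le> ?T w} w \<partial>?N)"
  proof -
    have "{w \<in> space ?N. real N * ?\<mu> + real N * \<epsilon> \<le> ?T w} \<in> sets ?N" by measurable
    then show ?thesis by simp
  qed
  also have "\<dots> \<le> (\<integral>\<^sup>+w. ennreal (exp (- l * real N * \<epsilon>)) * (\<Prod>i<N. ennreal (exp (l * (g (\<lambda>k. w (i * M + k)) - ?\<mu>)))) \<partial>?N)"
  proof (rule nn_integral_mono)
    fix w
    have "(\<Prod>i<N. exp (l * (g (\<lambda>k. w (i * M + k)) - ?\<mu>))) = exp (l * (?T w - real N * ?\<mu>))"
      by (simp add: exp_sum[symmetric] sum_distrib_left[symmetric] sum_subtractf)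
    then have *: "ennreal (exp (- l * real N * \<epsilon>)) * (\<Prod>i<N. ennreal (exp (l * (g (\<lambda>k. w (i * M + k)) - ?\<mu>))))
      = ennreal (exp (l * (?T w - real N * ?\<mu> - real N * \<epsilon>)))"
      by (simp add: prod_ennreal ennreal_mult[symmetric] exp_add[symmetric] algebra_simps)
    show "indicator {w. real N * ?\<mu> + real N * \<epsilon> \<le> ?T w} w
      \<le> ennreal (exp (- l * real N * \<epsilon>)) * (\<Prod>i<N. ennreal (exp (l * (g (\<lambda>k. w (i * M + k)) - ?\<mu>))))"
      unfolding * using l by (auto split: split_indicator)
  qed
  also have "\<dots> = ennreal (exp (- l * real N * \<epsilon>)) * (\<integral>\<^sup>+w. ennreal (exp (l * (g w - ?\<mu>))) \<partial>?N) ^ N"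
  proof -
    have "ennreal (exp (l * (g w - ?\<mu>))) = ennreal (exp (l * (g w' - ?\<mu>)))" if "\<And>k. k < M \<Longrightarrow> w k = w' k" for w w'
      using dep[OF that] by simp
    then have "(\<integral>\<^sup>+w. (\<Prod>i<N. ennreal (exp (l * (g (\<lambda>k. w (i * M + k)) - ?\<mu>)))) \<partial>?N) = (\<integral>\<^sup>+w. ennreal (exp (l * (g w - ?\<mu>))) \<partial>?N) ^ N"
      by (intro block_exp_moment[of "\<lambda>w. ennreal (exp (l * (g w - ?\<mu>)))" M N]) auto
    moreover have "(\<lambda>w. \<Prod>i<N. ennreal (exp (l * (g (\<lambda>k. w (i * M + k)) - ?\<mu>)))) \<in> borel_measurable ?N"
      by measurable
    ultimately show ?thesis by (simp only: nn_integral_cmult)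
  qed
  also have "\<dots> \<le> ennreal (exp (- l * real N * \<epsilon>)) * ennreal (exp (l\<^sup>2 / 8)) ^ N"
    using Hoeffdings_lemma_nn_integral[OF l] by (intro mult_left_mono power_mono) auto
  also have "\<dots> = ennreal (exp (- 2 * real N * \<epsilon>\<^sup>2))"
    by (simp add: ennreal_power exp_of_nat_mult[symmetric] ennreal_mult[symmetric] exp_add[symmetric] l_def
        power2_eq_square algebra_simps)
  finally show ?thesis .
qed

lemma block_hoeffding:
  fixes g :: "(nat \<Rightarrow> 'a::euclidean_space) \<Rightarrow> real"
  assumes [measurable]: "g \<in> borel_measurable noise"
    and dep: "\<And>w w'. (\<And>k. k < M \<Longrightarrow> w k = w' k) \<Longrightarrow> g w = g w'"
    and bd: "\<And>w. 0 \<le> g w" "\<And>w. g w \<le> 1" and "\<epsilon> > 0"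
  shows "emeasure noise {w. real N * \<epsilon> \<le> \<bar>(\<Sum>i<N. g (\<lambda>k. w (i * M + k))) - real N * (LINT w|noise. g w)\<bar>}
    \<le> ennreal (2 * exp (- 2 * real N * \<epsilon>\<^sup>2))"
proof -
  let ?N = "noise :: (nat \<Rightarrow> 'a) measure" and ?T = "\<lambda>w. \<Sum>i<N. g (\<lambda>k. w (i * M + k))"
  let ?\<mu> = "LINT w|?N. g w"
  interpret prob_space ?N by (rule prob_space_noise)
  have "(LINT w|?N. - g w) = - ?\<mu>" by simp
  note up = block_hoeffding_upper[of g M 0 \<epsilon> N] and lo = block_hoeffding_upper[of "\<lambda>w. - g w" M "-1" \<epsilon> N]
  let ?U = "{w. real N * ?\<mu> + real N * \<epsilon> \<le> ?T w}"
  let ?L = "{w. real N * (LINT w|?N. - g w) + real N * \<epsilon> \<le> (\<Sum>i<N. - g (\<lambda>k. w (i * M + k)))}"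
  have "{w \<in> space ?N. real N * ?\<mu> + real N * \<epsilon> \<le> ?T w} \<in> sets ?N"
    "{w \<in> space ?N. real N * (LINT w|?N. - g w) + real N * \<epsilon> \<le> (\<Sum>i<N. - g (\<lambda>k. w (i * M + k)))} \<in> sets ?N"
    by measurable
  then have UL: "?U \<in> sets ?N" "?L \<in> sets ?N" by simp_all
  have "emeasure ?N {w. real N * \<epsilon> \<le> \<bar>?T w - real N * ?\<mu>\<bar>} \<le> emeasure ?N (?U \<union> ?L)"
  proof (rule emeasure_mono)
    show "{w. real N * \<epsilon> \<le> \<bar>?T w - real N * ?\<mu>\<bar>} \<subseteq> ?U \<union> ?L"
      by (auto simp: sum_negf abs_if split: if_splits)
  qed (intro sets.Un UL)
  also have "\<dots> \<le> emeasure ?N ?U + emeasure ?N ?L"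
    by (intro emeasure_subadditive UL)
  also have "\<dots> \<le> ennreal (exp (- 2 * real N * \<epsilon>\<^sup>2)) + ennreal (exp (- 2 * real N * \<epsilon>\<^sup>2))"
  proof (intro add_mono up lo)
    fix w w' :: "nat \<Rightarrow> 'a" assume "\<And>k. k < M \<Longrightarrow> w k = w' k"
    then show "g w = g w'" "- g w = - g w'" using dep[of w w'] by auto
  qed (use bd \<open>\<epsilon> > 0\<close> in auto)
  also have "\<dots> = ennreal (2 * exp (- 2 * real N * \<epsilon>\<^sup>2))"
    by (simp add: ennreal_plus[symmetric] del: ennreal_plus)
  finally show ?thesis .
qed

text \<open>The Lipschitz bound involves \<open>y 0, ..., y L\<close> only, so it also forces
  \<open>f\<close> to depend on these \<open>L + 1\<close> entries alone. The unit range is the one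
  for which the Hoeffding bound is stated.\<close>

definition test_fun :: "nat \<Rightarrow> real \<Rightarrow> ((nat \<Rightarrow> 'a::real_normed_vector) \<Rightarrow> real) \<Rightarrow> bool" where
  "test_fun L K f \<longleftrightarrow> f \<in> borel_measurable seq_borel \<and> 0 \<le> K \<and> (\<forall>y. 0 \<le> f y \<and> f y \<le> 1) \<and>
     (\<forall>y y'. \<bar>f y - f y'\<bar> \<le> K * (\<Sum>j\<le>L. norm (y j - y' j)))"

lemma state_shift: "state A R x w (j + k) = state A R (state A R x w j) (\<lambda>i. w (j + i)) k"
  by (induct k) auto

lemma obs_shift: "obs A R B S x w (j + k) = obs A R B S (state A R x w j) (\<lambda>i. w (j + i)) k"
  by (simp add: obs_def state_shift)

lemma state_linear: "state A R x w k = matpow A k *v x + state A R 0 w k"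
  by (induct k) (auto simp: matrix_vector_mul_assoc[symmetric] algebra_simps)

lemma obs_diff: "obs A R B S x w k - obs A R B S x' w k = B *v (matpow A k *v (x - x'))"
  unfolding obs_def by (subst (1 2) state_linear) (simp add: algebra_simps)

text \<open>Runs with the same noise differ by \<open>B A^k (x - x')\<close>, so a window that
  starts after \<open>m\<close> steps forgets the initial state at rate
  \<open>r ^ m\<close>.\<close>

lemma test_fun_obs_Lipschitz:
  fixes B :: "real^'d^'p"
  assumes f: "test_fun L K f" and r: "0 \<le> C" "0 < r" "r < 1" "\<And>k x. norm (matpow A k *v x) \<le> C * r ^ k * norm x"
  shows "\<bar>f (\<lambda>l. obs A R B S x w (m + l)) - f (\<lambda>l. obs A R B S x' w (m + l))\<bar>
    \<le> K * (real (Suc L) * (norm B * C)) * r ^ m * norm (x - x')"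
proof -
  have "\<bar>f (\<lambda>l. obs A R B S x w (m + l)) - f (\<lambda>l. obs A R B S x' w (m + l))\<bar>
     \<le> K * (\<Sum>l\<le>L. norm (obs A R B S x w (m + l) - obs A R B S x' w (m + l)))"
    using f by (simp add: test_fun_def)
  also have "\<dots> \<le> K * (\<Sum>l\<le>L. norm B * C * r ^ m * norm (x - x'))"
  proof (intro mult_left_mono sum_mono)
    fix l
    have "norm (obs A R B S x w (m + l) - obs A R B S x' w (m + l)) \<le> norm B * norm (matpow A (m + l) *v (x - x'))"
      unfolding obs_diff by (rule norm_matrix_vector_mult_le)
    also have "\<dots> \<le> norm B * (C * r ^ (m + l) * norm (x - x'))"
      by (intro mult_left_mono r) simp
    also have "\<dots> \<le> norm B * (C * r ^ m * norm (x - x'))"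
      using r by (intro mult_left_mono mult_right_mono power_decreasing) auto
    finally show "norm (obs A R B S x w (m + l) - obs A R B S x' w (m + l)) \<le> norm B * C * r ^ m * norm (x - x')"
      by (simp add: mult.assoc)
  qed (use f in \<open>simp add: test_fun_def\<close>)
  also have "\<dots> = K * (real (Suc L) * (norm B * C)) * r ^ m * norm (x - x')" by (simp add: mult_ac)
  finally show ?thesis .
qed

text \<open>Windows of length \<open>L + 1\<close>, each preceded by \<open>m\<close> unused observations.\<close>

definition window_sum :: "nat \<Rightarrow> nat \<Rightarrow> ((nat \<Rightarrow> 'a) \<Rightarrow> real) \<Rightarrow> nat \<Rightarrow> (nat \<Rightarrow> 'a) \<Rightarrow> real" where
  "window_sum m L f n y = (\<Sum>i < n div (m + L + 1). f (\<lambda>l. y (i * (m + L + 1) + m + l)))"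

context linear_model
begin

text \<open>Every block is restarted from state 0, which makes the windows functions of disjoint
  noise blocks. The error per window is at most \<open>G * r ^ m\<close> times the norm of the state
  at the start of the block. The energy bounds the average of these norms by a multiple of the block
  length, which grows linearly in \<open>m\<close>, and \<open>m * r ^ m\<close> tends to 0.\<close>

lemma window_approximation:
  fixes f :: "(nat \<Rightarrow> real^'p) \<Rightarrow> real"
  assumes f: "test_fun L K f" and "0 \<le> Q" "0 < \<delta>"
  shows "eventually (\<lambda>m. \<forall>n\<ge>m + L + 1. \<forall>x w. (norm x)\<^sup>2 + (\<Sum>k\<le>n. (norm (w k))\<^sup>2) \<le> Q * real n \<longrightarrow>
    \<bar>window_sum m L f n (Y x w) - (\<Sum>i < n div (m + L + 1). f (\<lambda>l. Y 0 (\<lambda>k. w (i * (m + L + 1) + k)) (m + l)))\<bar>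
      \<le> real (n div (m + L + 1)) * \<delta>) sequentially"
proof -
  obtain C r where r: "0 \<le> C" "0 < r" "r < 1" "\<And>k x. norm (matpow A k *v x) \<le> C * r ^ k * norm x"
    using matpow_decay[of A] stable by blast
  obtain E where E: "E \<ge> 0" "\<And>n x w. (\<Sum>k\<le>n. (norm (X x w k))\<^sup>2) \<le> E * ((norm x)\<^sup>2 + (\<Sum>k\<le>n. (norm (fst (w k)))\<^sup>2))"
    using state_energy by blast
  define G where "G = K * (real (Suc L) * (norm B * C))"
  have K: "K \<ge> 0" using f by (simp add: test_fun_def)
  have G: "G \<ge> 0" using K r by (simp add: G_def)
  have "(\<lambda>m. G * r ^ m * (1 + 2 * real (L + 1) * (E * Q)) + G * (2 * (E * Q)) * (real m * r ^ m)) \<longlonglongrightarrow>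
      G * 0 * (1 + 2 * real (L + 1) * (E * Q)) + G * (2 * (E * Q)) * 0"
    using r by (intro tendsto_intros LIMSEQ_power_zero powser_times_n_limit_0) auto
  then have "eventually (\<lambda>m. G * r ^ m * (1 + 2 * real (L + 1) * (E * Q)) + G * (2 * (E * Q)) * (real m * r ^ m) < \<delta>) sequentially"
    by (rule order_tendstoD) (use \<open>0 < \<delta>\<close> in simp)
  then show ?thesis
  proof eventually_elim
    case (elim m)
    define M where "M = m + L + 1"
    have M0: "0 < M" by (simp add: M_def)
    have MM: "real M = real m + real (L + 1)" by (simp add: M_def)
    show ?case
      unfolding M_def[symmetric] window_sum_def
    proof (intro allI impI)
      fix n :: nat and x :: "real^'d" and w :: "nat \<Rightarrow> (real^'q) \<times> (real^'p)"
      assume n: "M \<le> n" and Q: "(norm x)\<^sup>2 + (\<Sum>k\<le>n. (norm (w k))\<^sup>2) \<le> Q * real n"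
      let ?N = "n div M"
      have N1: "?N \<ge> 1" using n M0 by (simp add: Suc_le_eq div_greater_zero_iff)
      \<comment> \<open>At least one full block fits, so ignoring the incomplete last block costs at
        most a factor 2.\<close>
      have "n < (?N + 1) * M" using dividend_less_div_times[OF M0, of n] by simp
      also have "\<dots> \<le> (2 * ?N) * M" using N1 by (intro mult_right_mono) auto
      finally have nN: "real n \<le> 2 * real ?N * real M"
        by (metis less_imp_le of_nat_le_iff of_nat_mult of_nat_numeral)
      have NM: "?N * M \<le> n" by (rule div_times_less_eq_dividend)
      have "(\<Sum>i<?N. (norm (X x w (i * M)))\<^sup>2) = (\<Sum>k\<in>(\<lambda>i. i * M) ` {..<?N}. (norm (X x w k))\<^sup>2)"
        using M0 by (subst sum.reindex) (auto simp: inj_on_def)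
      also have "\<dots> \<le> (\<Sum>k\<le>n. (norm (X x w k))\<^sup>2)"
      proof (rule sum_mono2)
        show "(\<lambda>i. i * M) ` {..<?N} \<subseteq> {..n}"
        proof safe
          fix i assume "i < ?N"
          then have "i * M \<le> ?N * M" by (intro mult_right_mono) auto
          from this NM show "i * M \<le> n" by (rule order_trans)
        qed
      qed auto
      also have "\<dots> \<le> E * ((norm x)\<^sup>2 + (\<Sum>k\<le>n. (norm (fst (w k)))\<^sup>2))" by (rule E)
      also have "\<dots> \<le> E * (Q * real n)"
      proof (rule mult_left_mono)
        have "(norm (fst (w k)))\<^sup>2 \<le> (norm (w k))\<^sup>2" for k
          by (intro power_mono) (metis norm_fst_le prod.collapse, simp)
        then have "(\<Sum>k\<le>n. (norm (fst (w k)))\<^sup>2) \<le> (\<Sum>k\<le>n. (norm (w k))\<^sup>2)" by (intro sum_mono)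
        with Q show "(norm x)\<^sup>2 + (\<Sum>k\<le>n. (norm (fst (w k)))\<^sup>2) \<le> Q * real n" by simp
      qed (rule E)
      also have "\<dots> \<le> E * (Q * (2 * real ?N * real M))"
        using nN E \<open>0 \<le> Q\<close> by (intro mult_left_mono) auto
      finally have en: "(\<Sum>i<?N. (norm (X x w (i * M)))\<^sup>2) \<le> E * (Q * (2 * real ?N * real M))" .
      have "\<bar>(\<Sum>i<n div M. f (\<lambda>l. Y x w (i * M + m + l))) - (\<Sum>i<?N. f (\<lambda>l. Y 0 (\<lambda>k. w (i * M + k)) (m + l)))\<bar>
         \<le> (\<Sum>i<?N. \<bar>f (\<lambda>l. Y x w (i * M + m + l)) - f (\<lambda>l. Y 0 (\<lambda>k. w (i * M + k)) (m + l))\<bar>)"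
        unfolding sum_subtractf[symmetric] by (rule sum_abs)
      also have "\<dots> \<le> (\<Sum>i<?N. G * r ^ m * (1 + (norm (X x w (i * M)))\<^sup>2))"
      proof (rule sum_mono)
        fix i
        have "\<bar>f (\<lambda>l. Y x w (i * M + m + l)) - f (\<lambda>l. Y 0 (\<lambda>k. w (i * M + k)) (m + l))\<bar> \<le> G * r ^ m * norm (X x w (i * M) - 0)"
          unfolding add.assoc[of "i * M"] obs_shift[of A R B S x w "i * M"] G_def
          by (rule test_fun_obs_Lipschitz[OF f r])
        also have "\<dots> \<le> G * r ^ m * (1 + (norm (X x w (i * M)))\<^sup>2)"
        proof (rule mult_left_mono)
          have "0 \<le> (norm (X x w (i * M)) - 1)\<^sup>2" by simp
          then have "2 * norm (X x w (i * M)) \<le> 1 + (norm (X x w (i * M)))\<^sup>2"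
            by (simp only: power2_diff) simp
          then show "norm (X x w (i * M) - 0) \<le> 1 + (norm (X x w (i * M)))\<^sup>2"
            using norm_ge_zero[of "X x w (i * M)"] unfolding diff_zero by linarith
        qed (use G r in auto)
        finally show "\<bar>f (\<lambda>l. Y x w (i * M + m + l)) - f (\<lambda>l. Y 0 (\<lambda>k. w (i * M + k)) (m + l))\<bar> \<le> G * r ^ m * (1 + (norm (X x w (i * M)))\<^sup>2)" .
      qed
      also have "\<dots> = G * r ^ m * (real ?N + (\<Sum>i<?N. (norm (X x w (i * M)))\<^sup>2))"
        unfolding sum_distrib_left[symmetric] sum.distrib by simp
      also have "\<dots> \<le> G * r ^ m * (real ?N + E * (Q * (2 * real ?N * real M)))"
        using en G r by (intro mult_left_mono add_left_mono) auto
      also have "\<dots> = real ?N * (G * r ^ m * (1 + 2 * real (L + 1) * (E * Q)) + G * (2 * (E * Q)) * (real m * r ^ m))"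
        unfolding MM by (simp add: algebra_simps)
      also have "\<dots> \<le> real ?N * \<delta>" using elim by (intro mult_left_mono) auto
      finally show "\<bar>(\<Sum>i<n div M. f (\<lambda>l. Y x w (i * M + m + l))) - (\<Sum>i<?N. f (\<lambda>l. Y 0 (\<lambda>k. w (i * M + k)) (m + l)))\<bar> \<le> real ?N * \<delta>" .
    qed
  qed
qed

end

subsection \<open>Laws determined by Lipschitz test functions\<close>

text \<open>Lipschitz functions decreasing in \<open>n\<close> to the indicator of \<open>C\<close>,
  for \<open>C\<close> closed and nonempty.\<close>

definition bump :: "nat \<Rightarrow> 'a::metric_space set \<Rightarrow> 'a \<Rightarrow> real" where
  "bump n C x = max 0 (1 - real n * infdist x C)"

lemma bump_bounds: "0 \<le> bump n C x" "bump n C x \<le> 1"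
  by (auto simp: bump_def infdist_nonneg)

lemma bump_Lipschitz: "\<bar>bump n C x - bump n C y\<bar> \<le> real n * dist x y"
proof -
  have "\<bar>real n * infdist x C - real n * infdist y C\<bar> \<le> real n * dist x y"
    by (simp add: right_diff_distrib[symmetric] abs_mult infdist_triangle_abs mult_left_mono)
  then show ?thesis unfolding bump_def by linarith
qed

lemma borel_measurable_bump [measurable]: "bump n C \<in> borel_measurable borel"
  unfolding bump_def[abs_def] by (intro borel_measurable_continuous_onI continuous_intros)

lemma bump_tendsto_indicator:
  assumes "closed C" "C \<noteq> {}"
  shows "(\<lambda>n. bump n C x) \<longlonglongrightarrow> indicator C x"
proof (cases "x \<in> C")
  case True
  then show ?thesis by (simp add: bump_def)
next
  case False
  then have d: "infdist x C > 0"
    using assms in_closed_iff_infdist_zero infdist_nonneg[of x C] by (metis less_eq_real_def)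
  then obtain N :: nat where N: "1 < real N * infdist x C" using reals_Archimedean3 by blast
  have "bump n C x = 0" if "N \<le> n" for n
  proof -
    have "real N * infdist x C \<le> real n * infdist x C" using that d by (intro mult_right_mono) auto
    with N show ?thesis by (auto simp: bump_def max_def)
  qed
  then have "eventually (\<lambda>n. bump n C x = 0) sequentially"
    by (auto simp: eventually_sequentially)
  with False show ?thesis by (simp add: tendsto_eventually)
qed

lemma test_fun_prod_bump:
  fixes C :: "nat \<Rightarrow> 'a::real_normed_vector set"
  shows "test_fun L (real n) (\<lambda>y. \<Prod>j\<le>L. bump n (C j) (y j))"
  unfolding test_fun_def
proof safe
  show "(\<lambda>y. \<Prod>j\<le>L. bump n (C j) (y j)) \<in> borel_measurable seq_borel" by measurable
  fix y y' :: "nat \<Rightarrow> 'a"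
  show "0 \<le> (\<Prod>j\<le>L. bump n (C j) (y j))" by (intro prod_nonneg) (auto simp: bump_bounds)
  show "(\<Prod>j\<le>L. bump n (C j) (y j)) \<le> 1" by (intro prod_le_1) (auto simp: bump_bounds)
  have "\<bar>(\<Prod>j\<le>L. bump n (C j) (y j)) - (\<Prod>j\<le>L. bump n (C j) (y' j))\<bar>
    \<le> (\<Sum>j\<le>L. \<bar>bump n (C j) (y j) - bump n (C j) (y' j)\<bar>)"
    using norm_prod_diff[of "{..L}" "\<lambda>j. bump n (C j) (y j)" "\<lambda>j. bump n (C j) (y' j)"]
    by (simp add: bump_bounds)
  also have "\<dots> \<le> (\<Sum>j\<le>L. real n * norm (y j - y' j))"
    by (intro sum_mono) (simp add: bump_Lipschitz dist_norm[symmetric])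
  finally show "\<bar>(\<Prod>j\<le>L. bump n (C j) (y j)) - (\<Prod>j\<le>L. bump n (C j) (y' j))\<bar> \<le> real n * (\<Sum>j\<le>L. norm (y j - y' j))"
    by (simp add: sum_distrib_left)
qed simp

text \<open>Cylinders over closed sets generate the product sigma-algebra and are stable under
  intersection, and their indicators are limits of products of bumps, which are test
  functions.\<close>

lemma seq_measure_eqI:
  fixes M N :: "(nat \<Rightarrow> 'a::real_normed_vector) measure"
  assumes "prob_space M" "prob_space N" and sets: "sets M = sets seq_borel" "sets N = sets seq_borel"
    and eq: "\<And>L K f. test_fun L K f \<Longrightarrow> (\<integral>\<^sup>+y. ennreal (f y) \<partial>M) = (\<integral>\<^sup>+y. ennreal (f y) \<partial>N)"
  shows "M = N"
proof -
  interpret M: prob_space M by fact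
  interpret N: prob_space N by fact
  note sets[measurable_cong]
  let ?c = "\<lambda>(L, C). {y :: nat \<Rightarrow> 'a. \<forall>j\<le>L. y j \<in> C j}"
  let ?E = "?c ` {(L, C). \<forall>j. closed (C j)}"
  have E: "?E \<subseteq> Pow UNIV" by simp
  have sp: "space M = UNIV" using sets_eq_imp_space_eq[OF sets(1)] by simp
  have E_sets: "?E \<subseteq> sets seq_borel"
  proof safe
    fix L :: nat and C :: "nat \<Rightarrow> 'a set" assume [rule_format]: "\<forall>j. closed (C j)"
    then have [measurable]: "C j \<in> sets borel" for j by simp
    have "{y \<in> space seq_borel. \<forall>j\<le>L. y j \<in> C j} \<in> sets (seq_borel :: (nat \<Rightarrow> 'a) measure)" by measurable
    then show "{y. \<forall>j\<le>L. y j \<in> C j} \<in> sets (seq_borel :: (nat \<Rightarrow> 'a) measure)" by simp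
  qed
  have gen: "sets (seq_borel :: (nat \<Rightarrow> 'a) measure) = sigma_sets UNIV ?E"
  proof
    show "sigma_sets UNIV ?E \<subseteq> sets (seq_borel :: (nat \<Rightarrow> 'a) measure)"
      using sets.sigma_sets_subset[OF E_sets] by simp
    let ?S = "sigma UNIV ?E"
    have comp: "(\<lambda>y. y k) \<in> borel_measurable ?S" for k
      unfolding borel_eq_closed
    proof (rule measurable_measure_of)
      fix F :: "'a set" assume "F \<in> Collect closed"
      then have "{y. \<forall>j\<le>k. y j \<in> (if j = k then F else UNIV)} \<in> ?E"
        by (intro image_eqI[of _ _ "(k, \<lambda>j. if j = k then F else UNIV)"]) auto
      moreover have "{y. \<forall>j\<le>k. y j \<in> (if j = k then F else UNIV)} = (\<lambda>y. y k) -` F \<inter> space ?S"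
        by auto
      ultimately show "(\<lambda>y. y k) -` F \<inter> space ?S \<in> sets ?S" by (metis (lifting) E in_measure_of)
    qed auto
    have "(\<lambda>y. y) \<in> measurable ?S (seq_borel :: (nat \<Rightarrow> 'a) measure)"
      using comp by (rule measurable_seqI)
    from measurable_sets[OF this] show "sets (seq_borel :: (nat \<Rightarrow> 'a) measure) \<subseteq> sigma_sets UNIV ?E"
      using E by auto
  qed
  show ?thesis
  proof (rule measure_eqI_generator_eq[where E = ?E and \<Omega> = UNIV and A = "\<lambda>_. UNIV"])
    show "Int_stable ?E"
      unfolding Int_stable_def
    proof safe
      fix L L' :: nat and C C' :: "nat \<Rightarrow> 'a set" assume cl: "\<forall>j. closed (C j)" "\<forall>j. closed (C' j)"
      show "{y. \<forall>j\<le>L. y j \<in> C j} \<inter> {y. \<forall>j\<le>L'. y j \<in> C' j} \<in> ?E"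
        \<comment> \<open>Two cylinders of different length are brought to the longer one by padding
          with \<open>UNIV\<close>.\<close>
        by (rule image_eqI[of _ _ "(max L L', \<lambda>j. (if j \<le> L then C j else UNIV) \<inter> (if j \<le> L' then C' j else UNIV))"])
          (use cl in \<open>auto simp: closed_Int\<close>)
    qed
    have "UNIV \<in> ?E" by (rule image_eqI[of _ _ "(0, \<lambda>_. UNIV)"]) auto
    then show "range (\<lambda>_::nat. UNIV) \<subseteq> ?E" by auto
    show "\<And>i::nat. emeasure M UNIV \<noteq> \<infinity>" using M.emeasure_finite by simp
  next
    fix Z assume "Z \<in> ?E"
    then obtain L C where Z: "Z = {y. \<forall>j\<le>L. y j \<in> C j}" and cl: "\<And>j. closed (C j)" by auto
    show "emeasure M Z = emeasure N Z"
    \<comment> \<open>\<open>infdist\<close> to the empty set is 0 by convention, so the bumps of an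
      empty side are constantly 1 and do not approximate its indicator.\<close>
    proof (cases "\<exists>j\<le>L. C j = {}")
      case True
      then have "Z = {}" by (auto simp: Z)
      then show ?thesis by simp
    next
      case False
      let ?f = "\<lambda>n y. \<Prod>j\<le>L. bump n (C j) (y j)"
      have lim: "(\<lambda>n. \<integral>\<^sup>+y. ennreal (?f n y) \<partial>P) \<longlonglongrightarrow> emeasure P Z"
        if P: "prob_space P" "sets P = sets seq_borel" for P :: "(nat \<Rightarrow> 'a) measure"
      proof -
        interpret P: prob_space P by fact
        note P(2)[measurable_cong]
        have ZP: "Z \<in> sets P" using E_sets \<open>Z \<in> ?E\<close> P(2) by auto
        have ind: "(\<Prod>j\<le>L. indicator (C j) (y j)) = (indicator Z y :: real)" for y
          by (auto simp: Z split: split_indicator intro!: prod_zero)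
        have "(\<lambda>n. \<integral>\<^sup>+y. ennreal (?f n y) \<partial>P) \<longlonglongrightarrow> (\<integral>\<^sup>+y. ennreal (indicator Z y) \<partial>P)"
        proof (rule nn_integral_dominated_convergence[where w = "\<lambda>_. 1"])
          show "AE y in P. ennreal (?f n y) \<le> 1" for n
            by (intro AE_I2 ennreal_le_1[THEN iffD2] prod_le_1) (auto simp: bump_bounds)
          show "AE y in P. (\<lambda>n. ennreal (?f n y)) \<longlonglongrightarrow> ennreal (indicator Z y)"
            unfolding ind[symmetric]
            by (intro AE_I2 tendsto_ennrealI tendsto_prod bump_tendsto_indicator cl) (use False in auto)
        qed (use ZP in \<open>simp_all add: P.emeasure_space_1\<close>)
        then show ?thesis using ZP by (simp add: ennreal_indicator)
      qed
      show ?thesis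
        using LIMSEQ_unique[OF lim[OF assms(1) sets(1)]] lim[OF assms(2) sets(2)]
        by (simp add: eq[OF test_fun_prod_bump])
    qed
  qed (use E gen sets in auto)
qed

section \<open>Invariance of a law along the noise path\<close>

definition next_state :: "real^'d^'d \<Rightarrow> real^'q^'d \<Rightarrow> real^'d \<Rightarrow> (real^'q) \<times> (real^'p) \<Rightarrow> real^'d" where
  "next_state A R x s = A *v x + R *v fst s"

lemma measurable_next_state [measurable (raw)]:
  fixes A :: "real^'d^'d" and R :: "real^'q^'d" and g :: "'c \<Rightarrow> (real^'q) \<times> (real^'p)"
  assumes [measurable]: "f \<in> borel_measurable N" "g \<in> borel_measurable N"
  shows "(\<lambda>\<omega>. next_state A R (f \<omega>) (g \<omega>)) \<in> borel_measurable N"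
  unfolding next_state_def by measurable

text \<open>\<open>invariant_prob\<close> speaks of sets; writing the law as its own image under one
  step of the chain extends it to nonnegative functions.\<close>

lemma nn_integral_invariant_step:
  fixes A :: "real^'d^'d" and R :: "real^'q^'d"
  assumes inv: "invariant_prob A R \<pi>" and [measurable]: "h \<in> borel_measurable borel"
  shows "(\<integral>\<^sup>+x. h x \<partial>\<pi>) = (\<integral>\<^sup>+x. \<integral>\<^sup>+s. h (next_state A R x s) \<partial>(std_gaussian :: ((real^'q) \<times> (real^'p)) measure) \<partial>\<pi>)"
proof -
  let ?G = "std_gaussian :: ((real^'q) \<times> (real^'p)) measure"
  have sets [measurable_cong]: "sets \<pi> = sets borel" using inv by (simp add: invariant_prob_def)
  interpret G: sigma_finite_measure ?G by (rule sigma_finite_std_gaussian)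
  let ?D = "distr (\<pi> \<Otimes>\<^sub>M ?G) borel (\<lambda>z. next_state A R (fst z) (snd z))"
  have D: "(\<integral>\<^sup>+x. g x \<partial>?D) = (\<integral>\<^sup>+x. \<integral>\<^sup>+s. g (next_state A R x s) \<partial>?G \<partial>\<pi>)" if [measurable]: "g \<in> borel_measurable borel" for g
  proof -
    have "(\<integral>\<^sup>+x. g x \<partial>?D) = (\<integral>\<^sup>+z. g (next_state A R (fst z) (snd z)) \<partial>(\<pi> \<Otimes>\<^sub>M ?G))"
      by (rule nn_integral_distr) measurable
    then show ?thesis by (subst (asm) G.nn_integral_fst[symmetric]) auto
  qed
  have "\<pi> = ?D"
  proof (rule measure_eqI)
    fix E assume "E \<in> sets \<pi>"
    then have E [measurable]: "E \<in> sets borel" by (simp add: sets)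
    then have "emeasure \<pi> E = (\<integral>\<^sup>+x. emeasure (trans_kernel A R x) E \<partial>\<pi>)"
      using inv by (simp add: invariant_prob_def)
    also have "\<dots> = (\<integral>\<^sup>+x. \<integral>\<^sup>+s. indicator E (next_state A R x s) \<partial>?G \<partial>\<pi>)"
    proof (intro nn_integral_cong)
      fix x
      have "emeasure (trans_kernel A R x) E = (\<integral>\<^sup>+x'. indicator E x' \<partial>(trans_kernel A R x))"
        using E by (simp add: trans_kernel_def gaussian_def)
      then show "emeasure (trans_kernel A R x) E = (\<integral>\<^sup>+s. indicator E (next_state A R x s) \<partial>?G)"
        by (simp add: nn_integral_trans_kernel[where 'p = 'p] next_state_def)
    qed
    also have "\<dots> = emeasure ?D E" using D[of "indicator E"] E by simp
    finally show "emeasure \<pi> E = emeasure ?D E" .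
  qed (simp add: sets)
  then show ?thesis using D[of h] by simp
qed

text \<open>One step at a time: invariance absorbs the first noise variable into the state, and the
  rest of the path keeps its law. The noise is an argument of \<open>h\<close> so that functions of
  all later observations are covered.\<close>

lemma nn_integral_invariant_shift:
  fixes A :: "real^'d^'d" and R :: "real^'q^'d" and h :: "real^'d \<Rightarrow> (nat \<Rightarrow> (real^'q) \<times> (real^'p)) \<Rightarrow> ennreal"
  assumes inv: "invariant_prob A R \<pi>" and "(\<lambda>(x, w). h x w) \<in> borel_measurable (borel \<Otimes>\<^sub>M seq_borel)"
  shows "(\<integral>\<^sup>+x. \<integral>\<^sup>+w. h x w \<partial>noise \<partial>\<pi>) = (\<integral>\<^sup>+x. \<integral>\<^sup>+w. h (state A R x w m) (\<lambda>k. w (m + k)) \<partial>noise \<partial>\<pi>)"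
  using assms(2)
proof (induction m arbitrary: h)
  case (Suc m)
  note [measurable] = Suc.prems
  let ?G = "std_gaussian :: ((real^'q) \<times> (real^'p)) measure"
  interpret N: sigma_finite_measure "noise :: (nat \<Rightarrow> (real^'q) \<times> (real^'p)) measure" by (rule sigma_finite_noise)
  have "(\<integral>\<^sup>+x. \<integral>\<^sup>+w. h x w \<partial>noise \<partial>\<pi>) = (\<integral>\<^sup>+x. \<integral>\<^sup>+w. h (state A R x w m) (\<lambda>k. w (m + k)) \<partial>noise \<partial>\<pi>)"
    by (rule Suc.IH) fact
  also have "\<dots> = (\<integral>\<^sup>+x. \<integral>\<^sup>+s. \<integral>\<^sup>+w. h (state A R (next_state A R x s) w m) (\<lambda>k. w (m + k)) \<partial>noise \<partial>?G \<partial>\<pi>)"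
    by (rule nn_integral_invariant_step[OF inv]) measurable
  also have "\<dots> = (\<integral>\<^sup>+x. \<integral>\<^sup>+s. \<integral>\<^sup>+w. h (state A R x (case_nat s w) (Suc m)) (\<lambda>k. case_nat s w (Suc m + k)) \<partial>noise \<partial>?G \<partial>\<pi>)"
    unfolding state_case_nat next_state_def by simp
  also have "\<dots> = (\<integral>\<^sup>+x. \<integral>\<^sup>+w. h (state A R x w (Suc m)) (\<lambda>k. w (Suc m + k)) \<partial>noise \<partial>\<pi>)"
    by (intro nn_integral_cong nn_integral_noise_Suc[symmetric]) measurable
  finally show ?case .
qed simp

subsection \<open>The stationary law\<close>

lemma integral_eq_enn2real_unit:
  fixes f :: "'c \<Rightarrow> real"
  assumes "f \<in> borel_measurable M" "\<And>x. 0 \<le> f x"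
  shows "(LINT x|M. f x) = enn2real (\<integral>\<^sup>+x. ennreal (f x) \<partial>M)"
  using assms by (intro integral_eq_nn_integral) auto

context linear_model
begin

text \<open>Coupling: the run from 0 and the run from a stationary state share the noise and differ
  by \<open>A^m x\<close>, so their means merge, while the stationary mean does not change with
  \<open>m\<close>. The left side does not mention \<open>\<pi>\<close>, whence uniqueness.\<close>

lemma invariant_limit:
  fixes h :: "real^'d \<Rightarrow> (nat \<Rightarrow> (real^'q) \<times> (real^'p)) \<Rightarrow> real"
  assumes inv: "invariant_prob A R \<pi>" and [measurable]: "(\<lambda>(x, w). h x w) \<in> borel_measurable (borel \<Otimes>\<^sub>M seq_borel)"
    and bd: "\<And>x w. 0 \<le> h x w" "\<And>x w. h x w \<le> 1" and lip: "\<And>x x' w. \<bar>h x w - h x' w\<bar> \<le> K * norm (x - x')"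
  shows "(\<lambda>m. LINT w|noise. h (X 0 w m) (\<lambda>k. w (m + k))) \<longlonglongrightarrow> enn2real (\<integral>\<^sup>+x. \<integral>\<^sup>+w. ennreal (h x w) \<partial>noise \<partial>\<pi>)"
proof -
  obtain C r where r: "0 \<le> C" "0 < r" "r < 1" "\<And>k x. norm (matpow A k *v x) \<le> C * r ^ k * norm x"
    using matpow_decay[of A] stable by blast
  let ?N = "noise :: (nat \<Rightarrow> (real^'q) \<times> (real^'p)) measure"
  let ?P = "\<pi> \<Otimes>\<^sub>M ?N"
  have sets [measurable_cong]: "sets \<pi> = sets borel" and pp: "prob_space \<pi>"
    using inv by (auto simp: invariant_prob_def)
  interpret pi: prob_space \<pi> by (rule pp)
  interpret N: prob_space ?N by (rule prob_space_noise)
  interpret P: pair_prob_space \<pi> ?N by standard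
  let ?a = "\<lambda>m w. h (X 0 w m) (\<lambda>k. w (m + k))"
  let ?b = "\<lambda>m z. h (X (fst z) (snd z) m) (\<lambda>k. snd z (m + k))"
  have [measurable]: "?a m \<in> borel_measurable ?N" for m by measurable
  have mb [measurable]: "?b m \<in> borel_measurable ?P" for m by measurable
  have ma [measurable]: "(\<lambda>z. ?a m (snd z)) \<in> borel_measurable ?P" for m by measurable
  have a: "(LINT w|?N. ?a m w) = (LINT z|?P. ?a m (snd z))" for m
  proof -
    have "(\<integral>\<^sup>+z. ennreal (?a m (snd z)) \<partial>?P) = (\<integral>\<^sup>+x. \<integral>\<^sup>+w. ennreal (?a m w) \<partial>?N \<partial>\<pi>)"
      by (subst N.nn_integral_fst[symmetric]) auto
    also have "\<dots> = (\<integral>\<^sup>+w. ennreal (?a m w) \<partial>?N)" by (simp add: pi.emeasure_space_1)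
    finally show ?thesis by (simp add: integral_eq_enn2real_unit bd)
  qed
  have b: "enn2real (\<integral>\<^sup>+x. \<integral>\<^sup>+w. ennreal (h x w) \<partial>?N \<partial>\<pi>) = (LINT z|?P. ?b m z)" for m
  proof -
    have "(\<integral>\<^sup>+z. ennreal (?b m z) \<partial>?P) = (\<integral>\<^sup>+x. \<integral>\<^sup>+w. ennreal (h (X x w m) (\<lambda>k. w (m + k))) \<partial>?N \<partial>\<pi>)"
      by (subst N.nn_integral_fst[symmetric]) auto
    also have "\<dots> = (\<integral>\<^sup>+x. \<integral>\<^sup>+w. ennreal (h x w) \<partial>?N \<partial>\<pi>)"
      by (rule nn_integral_invariant_shift[OF inv, symmetric]) measurable
    finally show ?thesis by (simp add: integral_eq_enn2real_unit bd)
  qed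
  have ia: "integrable ?P (\<lambda>z. ?a m (snd z))" and ib: "integrable ?P (?b m)" for m
    by (rule P.P.integrable_const_bound[of _ 1]; use bd in simp)+
  have "(\<lambda>m. LINT z|?P. ?a m (snd z) - ?b m z) \<longlonglongrightarrow> (LINT z|?P. 0)"
  proof (rule integral_dominated_convergence[where w = "\<lambda>_. 1"])
    have "(\<lambda>m. ?a m (snd z) - ?b m z) \<longlonglongrightarrow> 0" for z
    proof (rule Lim_null_comparison)
      show "\<forall>\<^sub>F m in sequentially. norm (?a m (snd z) - ?b m z) \<le> \<bar>K\<bar> * (C * r ^ m * norm (fst z))"
      proof (intro always_eventually allI)
        fix m
        have "norm (?a m (snd z) - ?b m z) \<le> K * norm (X 0 (snd z) m - X (fst z) (snd z) m)"
          using lip by simp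
        also have "\<dots> \<le> \<bar>K\<bar> * norm (X 0 (snd z) m - X (fst z) (snd z) m)"
          by (intro mult_right_mono) auto
        also have "norm (X 0 (snd z) m - X (fst z) (snd z) m) = norm (matpow A m *v fst z)"
          by (subst (2) state_linear) (simp add: norm_minus_commute)
        also have "\<bar>K\<bar> * \<dots> \<le> \<bar>K\<bar> * (C * r ^ m * norm (fst z))"
          by (intro mult_left_mono r) simp
        finally show "norm (?a m (snd z) - ?b m z) \<le> \<bar>K\<bar> * (C * r ^ m * norm (fst z))" .
      qed
      have "(\<lambda>m. \<bar>K\<bar> * (C * r ^ m * norm (fst z))) \<longlonglongrightarrow> \<bar>K\<bar> * (C * 0 * norm (fst z))"
        using r by (intro tendsto_intros LIMSEQ_power_zero) auto
      then show "(\<lambda>m. \<bar>K\<bar> * (C * r ^ m * norm (fst z))) \<longlonglongrightarrow> 0" by simp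
    qed
    then show "AE z in ?P. (\<lambda>m. ?a m (snd z) - ?b m z) \<longlonglongrightarrow> 0" by simp
    have "\<bar>?a m (snd z) - ?b m z\<bar> \<le> 1" for m z
      using bd[of "X 0 (snd z) m" "\<lambda>k. snd z (m + k)"] bd[of "X (fst z) (snd z) m" "\<lambda>k. snd z (m + k)"] by linarith
    then show "AE z in ?P. norm (?a m (snd z) - ?b m z) \<le> 1" for m by simp
  qed simp_all
  then have "(\<lambda>m. (LINT w|?N. ?a m w) - enn2real (\<integral>\<^sup>+x. \<integral>\<^sup>+w. ennreal (h x w) \<partial>?N \<partial>\<pi>)) \<longlonglongrightarrow> 0"
    by (simp add: Bochner_Integration.integral_diff[OF ia ib] a b[symmetric])
  then show ?thesis by (simp add: LIM_zero_cancel)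
qed

lemma invariant_unique:
  assumes "invariant_prob A R \<pi>" "invariant_prob A R \<pi>'"
  shows "\<pi> = \<pi>'"
proof -
  \<comment> \<open>The law is carried over to constant sequences, so that
    \<open>seq_measure_eqI\<close> applies to it.\<close>
  let ?D = "\<lambda>\<pi>. distr \<pi> seq_borel (\<lambda>x (_::nat). x :: real^'d)"
  have m: "(\<lambda>x (_::nat). x :: real^'d) \<in> measurable borel seq_borel" by (rule measurable_seqI) simp
  have props: "prob_space \<pi>" "sets \<pi> = sets borel" if "invariant_prob A R \<pi>" for \<pi>
    using that by (auto simp: invariant_prob_def)
  have fm: "(\<lambda>x. f (\<lambda>_. x)) \<in> borel_measurable borel" if "test_fun L K f" for f :: "(nat \<Rightarrow> real^'d) \<Rightarrow> real" and L K
    by (rule measurable_compose[OF m, of f borel]) (use that in \<open>unfold test_fun_def, blast\<close>)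
  have m': "(\<lambda>x (_::nat). x :: real^'d) \<in> measurable \<pi> seq_borel" if "invariant_prob A R \<pi>" for \<pi>
    unfolding measurable_cong_sets[OF props(2)[OF that] refl] by (rule m)
  have int: "enn2real (\<integral>\<^sup>+x. \<integral>\<^sup>+w. ennreal (f (\<lambda>_. x)) \<partial>(noise :: (nat \<Rightarrow> (real^'q) \<times> (real^'p)) measure) \<partial>\<pi>) = enn2real (\<integral>\<^sup>+y. ennreal (f y) \<partial>?D \<pi>)"
    and fin: "(\<integral>\<^sup>+y. ennreal (f y) \<partial>?D \<pi>) < \<top>"
    if \<pi>: "invariant_prob A R \<pi>" and f: "test_fun L K f" for \<pi> f L K
  proof -
    interpret prob_space \<pi> by (rule props(1)[OF \<pi>])
    have [measurable]: "f \<in> borel_measurable seq_borel" using f by (simp add: test_fun_def)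
    have "(\<lambda>y. ennreal (f y)) \<in> borel_measurable (?D \<pi>)" by measurable
    from nn_integral_distr[OF m'[OF \<pi>] this]
    have e: "(\<integral>\<^sup>+y. ennreal (f y) \<partial>?D \<pi>) = (\<integral>\<^sup>+x. ennreal (f (\<lambda>_. x)) \<partial>\<pi>)" .
    then show "enn2real (\<integral>\<^sup>+x. \<integral>\<^sup>+w. ennreal (f (\<lambda>_. x)) \<partial>(noise :: (nat \<Rightarrow> (real^'q) \<times> (real^'p)) measure) \<partial>\<pi>) = enn2real (\<integral>\<^sup>+y. ennreal (f y) \<partial>?D \<pi>)"
      by simp
    have "(\<integral>\<^sup>+x. ennreal (f (\<lambda>_. x)) \<partial>\<pi>) \<le> (\<integral>\<^sup>+x. 1 \<partial>\<pi>)"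
      using f by (intro nn_integral_mono) (auto simp: test_fun_def)
    then show "(\<integral>\<^sup>+y. ennreal (f y) \<partial>?D \<pi>) < \<top>"
      unfolding e by (auto simp: emeasure_space_1 intro: order_le_less_trans)
  qed
  have "?D \<pi> = ?D \<pi>'"
  proof (rule seq_measure_eqI)
    fix L K and f :: "(nat \<Rightarrow> real^'d) \<Rightarrow> real" assume f: "test_fun L K f"
    have lim: "(\<lambda>m. LINT w|noise. f (\<lambda>_. X 0 w m)) \<longlonglongrightarrow> enn2real (\<integral>\<^sup>+y. ennreal (f y) \<partial>?D \<pi>)"
      if "invariant_prob A R \<pi>" for \<pi>
      unfolding int[OF that f, symmetric]
    proof (rule invariant_limit[OF that, where h = "\<lambda>x w. f (\<lambda>_. x)" and K = "K * real (Suc L)"])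
      show "(\<lambda>(x, w). f (\<lambda>_. x)) \<in> borel_measurable (borel \<Otimes>\<^sub>M seq_borel)"
        unfolding case_prod_beta' by (rule measurable_compose[OF measurable_fst fm[OF f]])
      fix x x' :: "real^'d"
      have "\<bar>f (\<lambda>_. x) - f (\<lambda>_. x')\<bar> \<le> K * (\<Sum>j\<le>L. norm (x - x'))"
        using f unfolding test_fun_def by blast
      then show "\<bar>f (\<lambda>_. x) - f (\<lambda>_. x')\<bar> \<le> K * real (Suc L) * norm (x - x')"
        by (simp only: sum_constant card_atMost mult.assoc)
    qed (use f in \<open>auto simp: test_fun_def\<close>)
    have "enn2real (\<integral>\<^sup>+y. ennreal (f y) \<partial>?D \<pi>) = enn2real (\<integral>\<^sup>+y. ennreal (f y) \<partial>?D \<pi>')"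
      by (rule LIMSEQ_unique[OF lim[OF assms(1)] lim[OF assms(2)]])
    then show "(\<integral>\<^sup>+y. ennreal (f y) \<partial>?D \<pi>) = (\<integral>\<^sup>+y. ennreal (f y) \<partial>?D \<pi>')"
      using fin[OF assms(1) f] fin[OF assms(2) f] by (metis ennreal_enn2real)
  next
    show "prob_space (?D \<pi>)" "prob_space (?D \<pi>')"
      by (rule prob_space.prob_space_distr[OF props(1) m'], rule assms, rule assms)+
  qed (rule sets_distr)+
  moreover have "\<pi> = distr (?D \<pi>) borel (\<lambda>y. y 0)" if "invariant_prob A R \<pi>" for \<pi>
  proof -
    note props(2)[OF that, measurable_cong]
    have "(\<lambda>y. y 0) \<in> borel_measurable (seq_borel :: (nat \<Rightarrow> real^'d) measure)" by measurable
    from distr_distr[OF this m'[OF that]]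
    have "distr (?D \<pi>) borel (\<lambda>y. y 0) = distr \<pi> borel (\<lambda>x. x)" by (simp only: o_def)
    then show ?thesis using distr_id2[of borel \<pi>] props(2)[OF that] by simp
  qed
  ultimately show ?thesis using assms by metis
qed

text \<open>The state at present for a chain that has run forever: \<open>w j\<close> acts
  \<open>j\<close> steps back in time. With this reversed order, prepending an entry to
  \<open>w\<close> is one step of the chain. Off the set of convergence the value is
  arbitrary.\<close>

definition stat_state :: "(nat \<Rightarrow> (real^'q) \<times> (real^'p)) \<Rightarrow> real^'d" where
  "stat_state w = (\<Sum>j. matpow A j *v (R *v fst (w j)))"

lemma measurable_stat_state [measurable (raw)]:
  assumes [measurable]: "g \<in> measurable N seq_borel"
  shows "(\<lambda>\<omega>. stat_state (g \<omega>)) \<in> borel_measurable N"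
  unfolding stat_state_def by measurable

text \<open>Tonelli: the expected sum of the norms is at most a geometric series, hence the sum is
  almost surely finite.\<close>

lemma AE_summable_noise:
  "AE w in (noise :: (nat \<Rightarrow> (real^'q) \<times> (real^'p)) measure). summable (\<lambda>j. matpow A j *v (R *v fst (w j)))"
proof -
  obtain C r where r: "0 \<le> C" "0 < r" "r < 1" "\<And>k x. norm (matpow A k *v x) \<le> C * r ^ k * norm x"
    using matpow_decay[of A] stable by blast
  let ?N = "noise :: (nat \<Rightarrow> (real^'q) \<times> (real^'p)) measure"
  let ?c = "sqrt 2 ^ DIM((real^'q) \<times> (real^'p))"
  let ?f = "\<lambda>w :: nat \<Rightarrow> (real^'q) \<times> (real^'p). \<lambda>j. norm (matpow A j *v (R *v fst (w j)))"
  have b: "(\<integral>\<^sup>+w. ennreal (?f w j) \<partial>?N) \<le> ennreal (C * r ^ j * norm R * ?c)" for j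
  proof -
    have "(\<integral>\<^sup>+w. ennreal (?f w j) \<partial>?N) \<le> (\<integral>\<^sup>+w. ennreal (C * r ^ j * norm R) * ennreal (exp ((norm (w j))\<^sup>2 / 4)) \<partial>?N)"
    proof (rule nn_integral_mono)
      fix w :: "nat \<Rightarrow> (real^'q) \<times> (real^'p)"
      have "?f w j \<le> C * r ^ j * (norm R * norm (fst (w j)))"
        using r by (intro order_trans[OF r(4)] mult_left_mono norm_matrix_vector_mult_le) auto
      also have "norm (fst (w j)) \<le> norm (w j)" by (metis norm_fst_le prod.collapse)
      \<comment> \<open>Reduces the first moment to the exponential one:
        \<open>t \<le> 1 + t^2 / 4 \<le> exp (t^2 / 4)\<close>.\<close>
      also have "norm (w j) \<le> exp ((norm (w j))\<^sup>2 / 4)"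
      proof -
        have "0 \<le> (norm (w j) / 2 - 1)\<^sup>2" by simp
        then have "norm (w j) \<le> 1 + (norm (w j))\<^sup>2 / 4"
          unfolding power2_diff by (simp add: power_divide)
        also have "\<dots> \<le> exp ((norm (w j))\<^sup>2 / 4)" by (rule exp_ge_add_one_self)
        finally show ?thesis .
      qed
      finally have "?f w j \<le> C * r ^ j * norm R * exp ((norm (w j))\<^sup>2 / 4)"
        using r by (simp add: mult_left_mono mult.assoc)
      then show "ennreal (?f w j) \<le> ennreal (C * r ^ j * norm R) * ennreal (exp ((norm (w j))\<^sup>2 / 4))"
        using r by (simp add: ennreal_mult[symmetric] ennreal_leI)
    qed
    also have "\<dots> = ennreal (C * r ^ j * norm R) * ennreal ?c"
      by (subst nn_integral_cmult)
        (auto simp: nn_integral_noise_component[where h = "\<lambda>s. ennreal (exp ((norm s)\<^sup>2 / 4))"] std_gaussian_exp_moment)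
    finally show ?thesis using r by (simp add: ennreal_mult)
  qed
  have "(\<integral>\<^sup>+w. (\<Sum>j. ennreal (?f w j)) \<partial>?N) = (\<Sum>j. \<integral>\<^sup>+w. ennreal (?f w j) \<partial>?N)"
    by (rule nn_integral_suminf) measurable
  also have "\<dots> \<le> (\<Sum>j. ennreal (C * r ^ j * norm R * ?c))"
    by (intro suminf_le b) auto
  also have "\<dots> < \<top>"
  proof -
    have "summable (\<lambda>j. C * r ^ j * norm R * ?c)"
      using r by (intro summable_mult2 summable_mult summable_geometric) auto
    then have "(\<Sum>j. ennreal (C * r ^ j * norm R * ?c)) \<noteq> \<top>"
      using r by (intro ennreal_suminf_neq_top) auto
    then show ?thesis by (simp add: less_top)
  qed
  finally have lt: "(\<integral>\<^sup>+w. (\<Sum>j. ennreal (?f w j)) \<partial>?N) < \<top>" .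
  have "AE w in ?N. (\<Sum>j. ennreal (?f w j)) \<noteq> \<infinity>"
  proof (rule nn_integral_PInf_AE)
    show "(\<lambda>w. \<Sum>j. ennreal (?f w j)) \<in> borel_measurable ?N" by measurable
  qed (use lt in simp)
  then show ?thesis
  proof eventually_elim
    case (elim w)
    have "summable (?f w)"
      by (rule summable_suminf_not_top) (use elim in \<open>simp_all only: norm_ge_zero infinity_ennreal_def not_False_eq_True\<close>)
    then show ?case by (rule summable_norm_cancel)
  qed
qed

text \<open>Prepending an independent noise variable preserves the law \<open>noise\<close> and,
  wherever the series converges, turns \<open>stat_state\<close> into its image under one
  step.\<close>

lemma invariant_exists: "invariant_prob A R (distr (noise :: (nat \<Rightarrow> (real^'q) \<times> (real^'p)) measure) borel stat_state)"
proof -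
  let ?N = "noise :: (nat \<Rightarrow> (real^'q) \<times> (real^'p)) measure"
  let ?G = "std_gaussian :: ((real^'q) \<times> (real^'p)) measure"
  interpret N: prob_space ?N by (rule prob_space_noise)
  interpret G: prob_space ?G by (rule prob_space_std_gaussian)
  have m [measurable]: "stat_state \<in> borel_measurable ?N" by measurable
  show ?thesis
    unfolding invariant_prob_def
  proof (intro conjI ballI)
    fix E :: "(real^'d) set" assume [measurable]: "E \<in> sets borel"
    have "(\<integral>\<^sup>+x. emeasure (trans_kernel A R x) E \<partial>distr ?N borel stat_state)
      = (\<integral>\<^sup>+x. \<integral>\<^sup>+s. indicator E (next_state A R x s) \<partial>?G \<partial>distr ?N borel stat_state)"
    proof (intro nn_integral_cong)
      fix x
      have "emeasure (trans_kernel A R x) E = (\<integral>\<^sup>+x'. indicator E x' \<partial>(trans_kernel A R x))"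
        by (simp add: trans_kernel_def gaussian_def)
      then show "emeasure (trans_kernel A R x) E = (\<integral>\<^sup>+s. indicator E (next_state A R x s) \<partial>?G)"
        by (simp add: nn_integral_trans_kernel[where 'p = 'p] next_state_def)
    qed
    also have "\<dots> = (\<integral>\<^sup>+w. \<integral>\<^sup>+s. indicator E (next_state A R (stat_state w) s) \<partial>?G \<partial>?N)"
      by (rule nn_integral_distr) measurable
    also have "\<dots> = (\<integral>\<^sup>+s. \<integral>\<^sup>+w. indicator E (next_state A R (stat_state w) s) \<partial>?N \<partial>?G)"
      by (rule nn_integral_swap[OF sigma_finite_noise sigma_finite_std_gaussian]) measurable
    also have "\<dots> = (\<integral>\<^sup>+s. \<integral>\<^sup>+w. indicator E (stat_state (case_nat s w)) \<partial>?N \<partial>?G)"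
    proof (rule nn_integral_cong, rule nn_integral_cong_AE)
      fix s :: "(real^'q) \<times> (real^'p)"
      show "AE w in ?N. (indicator E (next_state A R (stat_state w) s) :: ennreal) = indicator E (stat_state (case_nat s w))"
        using AE_summable_noise
      proof eventually_elim
        case (elim w)
        let ?f = "\<lambda>j. matpow A j *v (R *v fst (w j))" and ?g = "\<lambda>j. matpow A j *v (R *v fst (case_nat s w j))"
        have bl: "bounded_linear ((*v) A)" by (rule matrix_vector_mul_bounded_linear)
        have g: "?g (Suc j) = A *v ?f j" for j by (simp add: matrix_vector_mul_assoc[symmetric])
        have "summable (\<lambda>j. ?g (Suc j))" unfolding g by (rule bounded_linear.summable[OF bl elim])
        then have "summable ?g" by (rule summable_Suc_iff[of ?g, THEN iffD1])
        from suminf_split_head[OF this] have "suminf ?g = (\<Sum>j. ?g (Suc j)) + ?g 0" by simp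
        also have "(\<Sum>j. ?g (Suc j)) = A *v suminf ?f"
          unfolding g by (rule bounded_linear.suminf[OF bl elim, symmetric])
        finally show ?case by (simp add: stat_state_def next_state_def)
      qed
    qed
    also have "\<dots> = (\<integral>\<^sup>+w. indicator E (stat_state w) \<partial>?N)"
      by (rule nn_integral_noise_Suc[symmetric]) measurable
    also have "\<dots> = (\<integral>\<^sup>+x. indicator E x \<partial>distr ?N borel stat_state)"
      by (rule nn_integral_distr[symmetric]) measurable
    finally show "emeasure (distr ?N borel stat_state) E = (\<integral>\<^sup>+x. emeasure (trans_kernel A R x) E \<partial>distr ?N borel stat_state)"
      by simp
  qed (auto intro!: N.prob_space_distr)
qed

lemma invariant_law: "invariant_prob A R (invariant_law A R)"
  unfolding invariant_law_def by (rule theI[of "invariant_prob A R"], rule invariant_exists) (erule invariant_unique[OF _ invariant_exists])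

lemma stationary_law_eq:
  "stationary_law A R B S = distr (invariant_law A R \<Otimes>\<^sub>M noise) (\<Pi>\<^sub>M k\<in>UNIV. borel \<Otimes>\<^sub>M borel)
     (\<lambda>(x, w) k. (X x w k, Y x w k))"
  by (simp add: stationary_law_def path_law_def noise_def)

lemma measurable_path:
  "(\<lambda>(x, w) k. (X x w k, Y x w k)) \<in> measurable (invariant_law A R \<Otimes>\<^sub>M noise) (\<Pi>\<^sub>M k\<in>UNIV. borel \<Otimes>\<^sub>M borel)"
proof -
  have [measurable_cong]: "sets (invariant_law A R) = sets borel"
    using invariant_law by (simp add: invariant_prob_def)
  show ?thesis
    unfolding case_prod_beta'
    by (rule measurable_PiM_single') (auto simp: space_PiM space_pair_measure)
qed

lemma stationary_obs_law_eq:
  "stationary_obs_law A R B S = distr (invariant_law A R \<Otimes>\<^sub>M noise) seq_borel (\<lambda>z. Y (fst z) (snd z))"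
proof -
  have m: "obs_path \<in> measurable (\<Pi>\<^sub>M k\<in>UNIV. borel \<Otimes>\<^sub>M borel) (seq_borel :: (nat \<Rightarrow> real^'p) measure)"
    unfolding obs_path_def[abs_def] by (rule measurable_seqI) measurable
  show ?thesis
    unfolding stationary_obs_law_def stationary_law_eq distr_distr[OF m measurable_path]
    by (simp add: o_def obs_path_def[abs_def] case_prod_beta')
qed

definition obs_mean :: "((nat \<Rightarrow> real^'p) \<Rightarrow> real) \<Rightarrow> real" where
  "obs_mean f = enn2real (\<integral>\<^sup>+y. ennreal (f y) \<partial>stationary_obs_law A R B S)"

lemma prob_space_stationary_obs_law: "prob_space (stationary_obs_law A R B S)"
  and sets_stationary_obs_law: "sets (stationary_obs_law A R B S) = sets seq_borel"
  and nn_integral_stationary_obs_law: "f \<in> borel_measurable seq_borel \<Longrightarrow>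
    (\<integral>\<^sup>+y. f y \<partial>stationary_obs_law A R B S) = (\<integral>\<^sup>+x. \<integral>\<^sup>+w. f (Y x w) \<partial>noise \<partial>invariant_law A R)"
proof -
  let ?N = "noise :: (nat \<Rightarrow> (real^'q) \<times> (real^'p)) measure"
  have [measurable_cong]: "sets (invariant_law A R) = sets borel" and pp: "prob_space (invariant_law A R)"
    using invariant_law by (auto simp: invariant_prob_def)
  interpret pi: prob_space "invariant_law A R" by (rule pp)
  interpret N: prob_space ?N by (rule prob_space_noise)
  interpret P: pair_prob_space "invariant_law A R" ?N by standard
  have m: "(\<lambda>z. Y (fst z) (snd z)) \<in> measurable (invariant_law A R \<Otimes>\<^sub>M ?N) seq_borel" by measurable
  show "prob_space (stationary_obs_law A R B S)"
    unfolding stationary_obs_law_eq by (rule P.prob_space_distr[OF m])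
  show "sets (stationary_obs_law A R B S) = sets seq_borel" by (simp add: stationary_obs_law_eq)
  show "(\<integral>\<^sup>+y. f y \<partial>stationary_obs_law A R B S) = (\<integral>\<^sup>+x. \<integral>\<^sup>+w. f (Y x w) \<partial>noise \<partial>invariant_law A R)"
    if [measurable]: "f \<in> borel_measurable seq_borel"
  proof -
    have "(\<integral>\<^sup>+y. f y \<partial>stationary_obs_law A R B S) = (\<integral>\<^sup>+z. f (Y (fst z) (snd z)) \<partial>(invariant_law A R \<Otimes>\<^sub>M ?N))"
      unfolding stationary_obs_law_eq by (rule nn_integral_distr[OF m]) (simp add: that)
    then show ?thesis by (subst (asm) N.nn_integral_fst[symmetric]) auto
  qed
qed

lemma obs_mean_limit:
  assumes f: "test_fun L K f"
  shows "(\<lambda>m. LINT w|noise. f (\<lambda>l. Y 0 w (m + l))) \<longlonglongrightarrow> obs_mean f"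
proof -
  obtain C r where r: "0 \<le> C" "0 < r" "r < 1" "\<And>k x. norm (matpow A k *v x) \<le> C * r ^ k * norm x"
    using matpow_decay[of A] stable by blast
  have [measurable]: "f \<in> borel_measurable seq_borel" using f by (simp add: test_fun_def)
  have "(\<lambda>m. LINT w|noise. f (Y (X 0 w m) (\<lambda>k. w (m + k)))) \<longlonglongrightarrow> obs_mean f"
    unfolding obs_mean_def
  proof (subst nn_integral_stationary_obs_law, measurable, rule invariant_limit[OF invariant_law])
    show "(\<lambda>(x, w). f (Y x w)) \<in> borel_measurable (borel \<Otimes>\<^sub>M seq_borel)" by measurable
    show "\<bar>f (Y x w) - f (Y x' w)\<bar> \<le> K * (real (Suc L) * (norm B * C)) * norm (x - x')" for x x' w
      using test_fun_obs_Lipschitz[OF f r, where B = B and R = R and S = S and x = x and w = w and m = 0 and x' = x'] by simp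
  qed (use f in \<open>auto simp: test_fun_def\<close>)
  moreover have "Y (X 0 w m) (\<lambda>k. w (m + k)) = (\<lambda>l. Y 0 w (m + l))" for w m
    by (rule ext) (rule obs_shift[symmetric])
  ultimately show ?thesis by simp
qed

end

lemma obs_mean_separates:
  fixes A :: "real^'d^'d" and R :: "real^'q^'d" and B :: "real^'d^'p" and S :: "real^'p^'p"
  assumes M: "linear_model A R B S" and M': "linear_model A' R' B' S'"
    and ne: "stationary_obs_law A R B S \<noteq> stationary_obs_law A' R' B' S'"
  shows "\<exists>L K f. test_fun L K f \<and> linear_model.obs_mean A R B S f \<noteq> linear_model.obs_mean A' R' B' S' f"
proof (rule ccontr)
  interpret M: linear_model A R B S by fact
  interpret M': linear_model A' R' B' S' by fact
  assume "\<not> ?thesis"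
  then have eq: "M.obs_mean f = M'.obs_mean f" if "test_fun L K f" for L K f using that by blast
  \<comment> \<open>\<open>obs_mean\<close> passes through \<open>enn2real\<close>, which is
    injective on finite values only.\<close>
  have fin: "(\<integral>\<^sup>+y. ennreal (f y) \<partial>P) < \<top>" if "test_fun L K f" "prob_space P" for L K f and P :: "(nat \<Rightarrow> real^'p) measure"
  proof -
    have "(\<integral>\<^sup>+y. ennreal (f y) \<partial>P) \<le> (\<integral>\<^sup>+y. 1 \<partial>P)"
      using that(1) by (intro nn_integral_mono) (auto simp: test_fun_def)
    also have "\<dots> = 1" using prob_space.emeasure_space_1[OF that(2)] by simp
    finally show ?thesis by (auto intro: order_le_less_trans)
  qed
  have "stationary_obs_law A R B S = stationary_obs_law A' R' B' S'"
  proof (rule seq_measure_eqI)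
    fix L K f assume f: "test_fun L K (f :: (nat \<Rightarrow> real^'p) \<Rightarrow> real)"
    show "(\<integral>\<^sup>+y. ennreal (f y) \<partial>stationary_obs_law A R B S) = (\<integral>\<^sup>+y. ennreal (f y) \<partial>stationary_obs_law A' R' B' S')"
      using eq[OF f] fin[OF f M.prob_space_stationary_obs_law] fin[OF f M'.prob_space_stationary_obs_law]
      unfolding M.obs_mean_def M'.obs_mean_def by (metis ennreal_enn2real)
  qed (rule M.prob_space_stationary_obs_law M'.prob_space_stationary_obs_law M.sets_stationary_obs_law M'.sets_stationary_obs_law)+
  with ne show False by simp
qed

subsection \<open>Mutual absolute continuity over initial states\<close>

text \<open>The Gaussian density is positive, so the null sets are those of Lebesgue measure, which
  are translation invariant.\<close>

lemma std_gaussian_null_shift: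
  fixes g :: "'a::euclidean_space \<Rightarrow> ennreal"
  assumes [measurable]: "g \<in> borel_measurable borel" and "(\<integral>\<^sup>+s. g s \<partial>std_gaussian) = 0"
  shows "(\<integral>\<^sup>+s. g (a + s) \<partial>std_gaussian) = 0"
proof -
  have iff: "(\<integral>\<^sup>+s. h s \<partial>std_gaussian) = 0 \<longleftrightarrow> (\<integral>\<^sup>+s. h s \<partial>lborel) = 0"
    if [measurable]: "h \<in> borel_measurable borel" for h :: "'a \<Rightarrow> ennreal"
  proof -
    have "(\<integral>\<^sup>+s. h s \<partial>std_gaussian) = 0 \<longleftrightarrow> (AE s in lborel. ennreal (gauss_pdf s) * h s = 0)"
      unfolding std_gaussian_eq by (subst nn_integral_density, measurable) (subst nn_integral_0_iff_AE, auto)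
    also have "\<dots> \<longleftrightarrow> (AE s in lborel. h s = 0)"
      using gauss_pdf_pos by (auto simp: mult_eq_0_iff ennreal_eq_0_iff not_le[symmetric] not_less)
    also have "\<dots> \<longleftrightarrow> (\<integral>\<^sup>+s. h s \<partial>lborel) = 0" by (subst nn_integral_0_iff_AE) auto
    finally show ?thesis .
  qed
  have "(\<integral>\<^sup>+s. g s \<partial>lborel) = (\<integral>\<^sup>+s. g s \<partial>(distr lborel borel ((+) a)))" by (simp only: lborel_distr_plus)
  also have "\<dots> = (\<integral>\<^sup>+s. g (a + s) \<partial>lborel)" by (rule nn_integral_distr) auto
  finally have "(\<integral>\<^sup>+s. g (a + s) \<partial>lborel) = 0" using assms iff[of g] by simp
  then show ?thesis using iff[of "\<lambda>s. g (a + s)"] by simp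
qed

text \<open>Finitely many coordinates are moved, so the case of one variable can be iterated. A
  general shift of infinitely many coordinates can be singular.\<close>

lemma noise_null_shift:
  fixes g :: "(nat \<Rightarrow> 'a::euclidean_space) \<Rightarrow> ennreal"
  assumes "g \<in> borel_measurable noise" "(\<integral>\<^sup>+w. g w \<partial>noise) = 0" "\<And>k. n \<le> k \<Longrightarrow> h k = 0"
  shows "(\<integral>\<^sup>+w. g (\<lambda>k. h k + w k) \<partial>noise) = 0"
  using assms
proof (induction n arbitrary: g h)
  case 0
  then show ?case by simp
next
  case (Suc n)
  note [measurable] = Suc.prems(1)
  let ?N = "noise :: (nat \<Rightarrow> 'a) measure" and ?G = "std_gaussian :: 'a measure"
  interpret N: sigma_finite_measure ?N by (rule sigma_finite_noise)
  let ?h = "\<lambda>k. h (Suc k)"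
  have [measurable]: "(\<lambda>w k. ?h k + w k) \<in> measurable ?N seq_borel" by (rule measurable_seqI) measurable
  have [measurable]: "(\<lambda>\<omega> k. ?h k + snd \<omega> k) \<in> measurable (?G \<Otimes>\<^sub>M ?N) seq_borel" by (rule measurable_seqI) measurable
  have hm: "(\<lambda>w k. h k + w k) \<in> measurable ?N seq_borel" by (rule measurable_seqI) measurable
  have cn: "(\<lambda>k. h k + case_nat s w k) = case_nat (h 0 + s) (\<lambda>k. ?h k + w k)" for s w
    by (auto simp: fun_eq_iff split: nat.split)
  define K where "K s = (\<integral>\<^sup>+w. g (case_nat s (\<lambda>k. ?h k + w k)) \<partial>?N)" for s
  have [measurable]: "K \<in> borel_measurable borel"
    unfolding K_def by measurable
  have "(\<integral>\<^sup>+s. \<integral>\<^sup>+w. g (case_nat s w) \<partial>?N \<partial>?G) = 0"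
    using Suc.prems(2) by (subst (asm) nn_integral_noise_Suc) measurable
  then have "AE s in ?G. (\<integral>\<^sup>+w. g (case_nat s w) \<partial>?N) = 0"
    by (subst (asm) nn_integral_0_iff_AE) auto
  then have "AE s in ?G. K s = 0"
  proof eventually_elim
    case (elim s)
    have "(\<lambda>w. g (case_nat s w)) \<in> borel_measurable ?N" by measurable
    from Suc.IH[OF this elim] show ?case
      unfolding K_def using Suc.prems(3) by simp
  qed
  then have "(\<integral>\<^sup>+s. K s \<partial>?G) = 0" by (subst nn_integral_0_iff_AE) auto
  then have "(\<integral>\<^sup>+s. K (h 0 + s) \<partial>?G) = 0" by (rule std_gaussian_null_shift[rotated]) measurable
  moreover have "(\<integral>\<^sup>+w. g (\<lambda>k. h k + w k) \<partial>?N) = (\<integral>\<^sup>+s. K (h 0 + s) \<partial>?G)"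
    unfolding K_def cn[symmetric]
    by (rule nn_integral_noise_Suc) (rule measurable_compose[OF hm], use Suc.prems(1) in \<open>simp add: measurable_cong_sets[OF sets_noise refl]\<close>)
  ultimately show ?case by simp
qed

lemma state_add: "state A R (x + x') (\<lambda>k. h k + w k) k = state A R x h k + state A R x' w k"
  by (induct k) (auto simp: algebra_simps)

lemma state_cong_fst: "(\<And>k. k < n \<Longrightarrow> fst (w k) = fst (w' k)) \<Longrightarrow> state A R x w n = state A R x w' n"
  by (induct n) auto

lemma state_zero_sum: "state A R 0 w n = (\<Sum>i<n. matpow A (n - Suc i) *v (R *v fst (w i)))"
proof (induction n)
  case (Suc n)
  have "(\<Sum>i<n. matpow A (n - i) *v (R *v fst (w i))) = A *v (\<Sum>i<n. matpow A (n - Suc i) *v (R *v fst (w i)))"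
    unfolding linear_sum[OF matrix_vector_mul_linear]
  proof (intro sum.cong refl)
    fix i assume "i \<in> {..<n}"
    then have "n - i = Suc (n - Suc i)" by auto
    then show "matpow A (n - i) *v (R *v fst (w i)) = A *v (matpow A (n - Suc i) *v (R *v fst (w i)))"
      by (simp only: matpow.simps matrix_vector_mul_assoc[symmetric])
  qed
  then show ?case using Suc by simp
qed simp

context linear_model
begin

text \<open>By controllability a deterministic change of finitely many noise variables makes the observations
  started at \<open>x\<close> coincide with those started at \<open>x'\<close>, and such a change preserves null sets.\<close>

lemma obs_noise_shift:
  "\<exists>h. (\<forall>k\<ge>CARD('d). h k = 0) \<and> (\<forall>w. Y x (\<lambda>k. h k + w k) = Y x' w)"
proof -
  let ?d = "CARD('d)"
  \<comment> \<open>Inputs that bring the difference of the two states from \<open>x - x'\<close> to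
    0 in \<open>CARD('d)\<close> steps. The sum counts from the last step backwards, hence the index
    \<open>?d - Suc k\<close> below.\<close>
  obtain c where c: "(\<Sum>j<?d. matpow A j *v (R *v c j)) = - (matpow A ?d *v (x - x'))"
    using controllability by blast
  define u :: "nat \<Rightarrow> (real^'q) \<times> (real^'p)" where "u k = (if k < ?d then c (?d - Suc k) else 0, 0)" for k
  define D where "D = X (x - x') u"
  \<comment> \<open>Until the states have merged, the second component cancels the contribution
    \<open>B *v D k\<close> to the observation; this uses that \<open>S\<close> is
    invertible.\<close>
  define h where "h k = (fst (u k), - (F *v (B *v D k)))" for k
  have "X 0 u ?d = (\<Sum>i<?d. matpow A (?d - Suc i) *v (R *v c (?d - Suc i)))"
    unfolding state_zero_sum by (intro sum.cong) (auto simp: u_def)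
  also have "\<dots> = (\<Sum>j<?d. matpow A j *v (R *v c j))"
    by (rule sum.nat_diff_reindex)
  finally have "D ?d = 0"
    unfolding D_def by (subst state_linear) (simp add: c)
  have D0: "D k = 0" if "?d \<le> k" for k
    using that
  proof (induction k rule: dec_induct)
    case base
    show ?case by (rule \<open>D ?d = 0\<close>)
  next
    case (step k)
    then have "D (Suc k) = A *v D k" by (simp add: D_def u_def)
    with step show ?case by simp
  qed
  have D: "X (x - x') h k = D k" for k
    unfolding D_def by (rule state_cong_fst) (simp add: h_def)
  have "Y x (\<lambda>k. h k + w k) k = Y x' w k" for w k
  proof -
    have "X x (\<lambda>k. h k + w k) k = D k + X x' w k"
      using state_add[of A R "x - x'" x' h w k] by (simp add: D)
    then show ?thesis
      by (simp add: obs_def h_def algebra_simps matrix_vector_mul_assoc matrix_mul_assoc S_inverse)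
  qed
  moreover have "h k = 0" if "?d \<le> k" for k
    using that D0[OF that] by (simp add: h_def u_def zero_prod_def)
  ultimately show ?thesis by (intro exI[of _ h]) auto
qed

lemma obs_null_sets_agree:
  fixes g :: "(nat \<Rightarrow> real^'p) \<Rightarrow> ennreal"
  assumes [measurable]: "g \<in> borel_measurable seq_borel" and "(\<integral>\<^sup>+w. g (Y x w) \<partial>noise) = 0"
  shows "(\<integral>\<^sup>+w. g (Y x' w) \<partial>noise) = 0"
proof -
  obtain h where h: "\<And>k. CARD('d) \<le> k \<Longrightarrow> h k = 0" "\<And>w. Y x (\<lambda>k. h k + w k) = Y x' w"
    using obs_noise_shift by blast
  have "(\<lambda>w. g (Y x w)) \<in> borel_measurable (noise :: (nat \<Rightarrow> (real^'q) \<times> (real^'p)) measure)" by measurable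
  from noise_null_shift[where n = "CARD('d)" and h = h, OF this assms(2) h(1)] show ?thesis by (simp add: h(2))
qed

text \<open>The likelihood divided by the product of the \<open>gauss_pdf (y k)\<close>, a factor
  common to all parameters.\<close>

definition LR :: "(real^'d) measure \<Rightarrow> nat \<Rightarrow> (nat \<Rightarrow> real^'p) \<Rightarrow> ennreal" where
  "LR \<nu> n y = (\<integral>\<^sup>+x. \<integral>\<^sup>+w. (\<Prod>k<Suc n. ennreal (lr (X x w k) (y k))) \<partial>noise \<partial>\<nu>)"

text \<open>\<open>LR\<close> with the weight \<open>exp (\<eta>/2 (\<bar>e\<bar>\<^sup>2 + \<bar>u\<bar>\<^sup>2))\<close>, \<open>e\<close> the observation noise that \<open>y\<close> requires.\<close>

definition weighted_LR :: "real \<Rightarrow> (real^'d) measure \<Rightarrow> nat \<Rightarrow> (nat \<Rightarrow> real^'p) \<Rightarrow> ennreal" where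
  "weighted_LR \<eta> \<nu> n y = (\<integral>\<^sup>+x. \<integral>\<^sup>+w. (\<Prod>k<Suc n. ennreal (lr (X x w k) (y k))) *
     ennreal (exp (\<eta> / 2 * (\<Sum>k\<le>n. (norm (resid x w y k))\<^sup>2 + (norm (fsts w k))\<^sup>2))) \<partial>noise \<partial>\<nu>)"

text \<open>The density property of \<open>LR\<close>: \<open>change_of_measure\<close> for an
  \<open>H\<close> that ignores the state noise, integrated over the initial law by Fubini.\<close>

lemma LR_integral:
  assumes \<nu>: "prob_space \<nu>" "sets \<nu> = sets borel" and [measurable]: "q \<in> borel_measurable seq_borel"
    and dep: "\<And>y y'. (\<And>k. k \<le> n \<Longrightarrow> y k = y' k) \<Longrightarrow> q y = q y'"
  shows "(\<integral>\<^sup>+x. \<integral>\<^sup>+w. q (Y x w) \<partial>noise \<partial>\<nu>)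
    = (\<integral>\<^sup>+w'. q (snds w') * LR \<nu> n (snds w') \<partial>(noise :: (nat \<Rightarrow> (real^'q) \<times> (real^'p)) measure))"
proof -
  let ?N = "noise :: (nat \<Rightarrow> (real^'q) \<times> (real^'p)) measure"
  interpret N: sigma_finite_measure ?N by (rule sigma_finite_noise)
  interpret V: prob_space \<nu> by (rule \<nu>(1))
  note \<nu>(2)[measurable_cong]
  let ?J = "\<lambda>x w' w. (\<Prod>k<Suc n. ennreal (lr (X x w k) (snds w' k)))"
  have "(\<integral>\<^sup>+x. \<integral>\<^sup>+w. q (Y x w) \<partial>noise \<partial>\<nu>) = (\<integral>\<^sup>+x. \<integral>\<^sup>+w'. \<integral>\<^sup>+w. ?J x w' w * q (snds w') \<partial>?N \<partial>?N \<partial>\<nu>)"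
    by (intro nn_integral_cong change_of_measure[symmetric, where H = "\<lambda>u y. q y"]) (measurable, auto intro: dep)
  also have "\<dots> = (\<integral>\<^sup>+w'. \<integral>\<^sup>+x. \<integral>\<^sup>+w. ?J x w' w * q (snds w') \<partial>?N \<partial>\<nu> \<partial>?N)"
    by (rule nn_integral_swap[OF V.sigma_finite_measure_axioms sigma_finite_noise]) measurable
  also have "\<dots> = (\<integral>\<^sup>+w'. q (snds w') * LR \<nu> n (snds w') \<partial>?N)"
  proof (intro nn_integral_cong)
    fix w' :: "nat \<Rightarrow> (real^'q) \<times> (real^'p)"
    have m1: "(\<lambda>w. ?J x w' w) \<in> borel_measurable ?N" for x by (measurable; simp)
    have m2: "(\<lambda>x. \<integral>\<^sup>+w. ?J x w' w \<partial>?N) \<in> borel_measurable \<nu>" by (measurable; simp)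
    show "(\<integral>\<^sup>+x. \<integral>\<^sup>+w. ?J x w' w * q (snds w') \<partial>?N \<partial>\<nu>) = q (snds w') * LR \<nu> n (snds w')"
      unfolding LR_def nn_integral_multc[OF m1] nn_integral_multc[OF m2] by (rule mult.commute)
  qed
  finally show ?thesis .
qed

text \<open>After the change of measure \<open>y\<close> is the observation path of the model, so
  the residual is the observation noise itself and the weight depends on the noise energy
  alone.\<close>

lemma weighted_LR_integral:
  assumes \<nu>: "prob_space \<nu>" "sets \<nu> = sets borel" and [measurable]: "q \<in> borel_measurable seq_borel"
    and dep: "\<And>y y'. (\<And>k. k \<le> n \<Longrightarrow> y k = y' k) \<Longrightarrow> q y = q y'"
  shows "(\<integral>\<^sup>+w'. q (snds w') * weighted_LR \<eta> \<nu> n (snds w') \<partial>(noise :: (nat \<Rightarrow> (real^'q) \<times> (real^'p)) measure))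
    = (\<integral>\<^sup>+x. \<integral>\<^sup>+w. q (Y x w) * ennreal (exp (\<eta> / 2 * (\<Sum>k\<le>n. (norm (w k))\<^sup>2))) \<partial>noise \<partial>\<nu>)"
proof -
  let ?N = "noise :: (nat \<Rightarrow> (real^'q) \<times> (real^'p)) measure"
  interpret N: sigma_finite_measure ?N by (rule sigma_finite_noise)
  interpret V: prob_space \<nu> by (rule \<nu>(1))
  note \<nu>(2)[measurable_cong]
  let ?J = "\<lambda>x w' w. (\<Prod>k<Suc n. ennreal (lr (X x w k) (snds w' k)))"
  \<comment> \<open>\<open>change_of_measure\<close> exposes the state noise only, while
    \<open>resid\<close> expects a full noise path. The state ignores the second components, so they
    are filled with 0.\<close>
  define mk where "mk u k = (u k, 0 :: real^'p)" for u :: "nat \<Rightarrow> real^'q" and k :: nat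
  have X_mk: "X x (mk (fsts w)) k = X x w k" for x w k
    by (rule state_cong_fst) (simp add: mk_def fsts_def)
  have [measurable]: "(\<lambda>\<omega>. mk (f \<omega>)) \<in> measurable M seq_borel" if [measurable]: "f \<in> measurable M seq_borel" for f :: "'z \<Rightarrow> nat \<Rightarrow> real^'q" and M
    unfolding mk_def[abs_def] by (rule measurable_seqI) measurable
  define E where "E x u y = ennreal (exp (\<eta> / 2 * (\<Sum>k\<le>n. (norm (resid x (mk u) y k))\<^sup>2 + (norm (u k))\<^sup>2)))" for x u y
  have E_dep: "E x u y = E x u' y'" if eq: "\<And>k. k < Suc n \<Longrightarrow> u k = u' k \<and> y k = y' k" for x u u' y y'
  proof -
    have "resid x (mk u) y k = resid x (mk u') y' k \<and> u k = u' k" if k: "k \<le> n" for k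
    proof -
      have "X x (mk u) k = X x (mk u') k"
        by (rule state_cong_fst) (use k eq in \<open>simp add: mk_def\<close>)
      then show ?thesis using eq[of k] k by simp
    qed
    then have "(\<Sum>k\<le>n. (norm (resid x (mk u) y k))\<^sup>2 + (norm (u k))\<^sup>2) = (\<Sum>k\<le>n. (norm (resid x (mk u') y' k))\<^sup>2 + (norm (u' k))\<^sup>2)"
      by (intro sum.cong) auto
    then show ?thesis unfolding E_def by simp
  qed
  have EY: "E x (fsts w) (Y x w) = ennreal (exp (\<eta> / 2 * (\<Sum>k\<le>n. (norm (w k))\<^sup>2)))" for x w
  proof -
    have "resid x (mk (fsts w)) (Y x w) k = snd (w k)" for k
      by (simp add: X_mk obs_def matrix_vector_mul_assoc S_inverse)
    moreover have "(norm (snd (w k)))\<^sup>2 + (norm (fsts w k))\<^sup>2 = (norm (w k))\<^sup>2" for k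
      by (cases "w k") (simp add: fsts_def norm_Pair)
    ultimately show ?thesis by (simp add: E_def)
  qed
  have [measurable]: "(\<lambda>\<omega>. E (f \<omega>) (g \<omega>) (h \<omega>)) \<in> borel_measurable M"
    if [measurable]: "f \<in> borel_measurable M" "g \<in> measurable M seq_borel" "h \<in> measurable M seq_borel"
    for f g h and M :: "'z measure"
    unfolding E_def by measurable
  have weighted: "weighted_LR \<eta> \<nu> n y = (\<integral>\<^sup>+x. \<integral>\<^sup>+w. (\<Prod>k<Suc n. ennreal (lr (X x w k) (y k))) * E x (fsts w) y \<partial>?N \<partial>\<nu>)" for y
    unfolding weighted_LR_def E_def X_mk ..
  have "(\<integral>\<^sup>+w'. q (snds w') * weighted_LR \<eta> \<nu> n (snds w') \<partial>?N)
    = (\<integral>\<^sup>+w'. \<integral>\<^sup>+x. \<integral>\<^sup>+w. ?J x w' w * (q (snds w') * E x (fsts w) (snds w')) \<partial>?N \<partial>\<nu> \<partial>?N)"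
  proof (rule nn_integral_cong)
    fix w' :: "nat \<Rightarrow> (real^'q) \<times> (real^'p)"
    have m1: "(\<lambda>w. ?J x w' w * E x (fsts w) (snds w')) \<in> borel_measurable ?N" for x by (measurable; simp)
    have m2: "(\<lambda>x. \<integral>\<^sup>+w. ?J x w' w * E x (fsts w) (snds w') \<partial>?N) \<in> borel_measurable \<nu>" by (measurable; simp)
    show "q (snds w') * weighted_LR \<eta> \<nu> n (snds w') = (\<integral>\<^sup>+x. \<integral>\<^sup>+w. ?J x w' w * (q (snds w') * E x (fsts w) (snds w')) \<partial>?N \<partial>\<nu>)"
      unfolding weighted mult.left_commute[of _ "q (snds w')"] nn_integral_cmult[OF m1] nn_integral_cmult[OF m2] ..
  qed
  also have "\<dots> = (\<integral>\<^sup>+x. \<integral>\<^sup>+w'. \<integral>\<^sup>+w. ?J x w' w * (q (snds w') * E x (fsts w) (snds w')) \<partial>?N \<partial>?N \<partial>\<nu>)"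
    by (rule nn_integral_swap[OF sigma_finite_noise V.sigma_finite_measure_axioms]) measurable
  also have "\<dots> = (\<integral>\<^sup>+x. \<integral>\<^sup>+w. q (Y x w) * E x (fsts w) (Y x w) \<partial>?N \<partial>\<nu>)"
  proof (rule nn_integral_cong, rule change_of_measure)
    fix x
    show "(\<lambda>(u, y). q y * E x u y) \<in> borel_measurable (seq_borel \<Otimes>\<^sub>M seq_borel)" by measurable
    show "q y * E x u y = q y' * E x u' y'" if "\<And>k. k < Suc n \<Longrightarrow> u k = u' k \<and> y k = y' k" for u u' y y'
      using that by (intro arg_cong2[of _ _ _ _ "(*)"] dep E_dep) auto
  qed
  finally show ?thesis by (simp only: EY)
qed

end

subsection \<open>Stability of the likelihood under perturbation of the parameter\<close>

text \<open>On the event, the sum \<open>s\<close> satisfies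
  \<open>\<eta> / 2 * s \<le> s / 8 \<le> s / 4 - (D + 1) * n\<close>, and the moment of
  \<open>exp (s / 4)\<close> is at most \<open>exp (D * (n + 1))\<close>. The threshold
  \<open>8 * (D + 1)\<close> is made for this.\<close>

lemma noise_tail:
  fixes D :: real
  assumes D: "D = DIM('a::euclidean_space)" and \<eta>: "0 \<le> \<eta>" "\<eta> \<le> 1 / 4"
  shows "(\<integral>\<^sup>+w. indicator {w. 8 * (D + 1) * real n < (\<Sum>k\<le>n. (norm (w k))\<^sup>2)} w *
      ennreal (exp (\<eta> / 2 * (\<Sum>k\<le>n. (norm (w k))\<^sup>2))) \<partial>(noise :: (nat \<Rightarrow> 'a) measure)) \<le> ennreal (exp (D - real n))"
proof -
  let ?s = "\<lambda>w :: nat \<Rightarrow> 'a. \<Sum>k\<le>n. (norm (w k))\<^sup>2"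
  have "indicator {w. 8 * (D + 1) * real n < ?s w} w * ennreal (exp (\<eta> / 2 * ?s w))
     \<le> ennreal (exp (- (D + 1) * real n)) * ennreal (exp ((\<Sum>k<Suc n. (norm (w k))\<^sup>2) / 4))" for w
  proof (cases "8 * (D + 1) * real n < ?s w")
    case True
    have "0 \<le> ?s w" by (intro sum_nonneg) auto
    then have "\<eta> / 2 * ?s w \<le> 1 / 8 * ?s w" using \<eta> by (intro mult_right_mono) auto
    with True have "\<eta> / 2 * ?s w \<le> - (D + 1) * real n + ?s w / 4"
      unfolding mult.assoc mult_minus_left by linarith
    then have "exp (\<eta> / 2 * ?s w) \<le> exp (- (D + 1) * real n) * exp ((\<Sum>k<Suc n. (norm (w k))\<^sup>2) / 4)"
      by (simp add: exp_add[symmetric] lessThan_Suc_atMost del: sum.lessThan_Suc)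
    then have "ennreal (exp (\<eta> / 2 * ?s w)) \<le> ennreal (exp (- (D + 1) * real n) * exp ((\<Sum>k<Suc n. (norm (w k))\<^sup>2) / 4))"
      by (rule ennreal_leI)
    then show ?thesis using True by (simp add: ennreal_mult)
  qed simp
  then have "(\<integral>\<^sup>+w. indicator {w. 8 * (D + 1) * real n < ?s w} w * ennreal (exp (\<eta> / 2 * ?s w)) \<partial>noise)
    \<le> (\<integral>\<^sup>+w. ennreal (exp (- (D + 1) * real n)) * ennreal (exp ((\<Sum>k<Suc n. (norm (w k))\<^sup>2) / 4)) \<partial>(noise :: (nat \<Rightarrow> 'a) measure))"
    by (rule nn_integral_mono)
  also have "\<dots> = ennreal (exp (- (D + 1) * real n)) * ennreal (sqrt 2 ^ DIM('a)) ^ Suc n"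
  proof -
    have "(\<lambda>w. ennreal (exp ((\<Sum>k<Suc n. (norm (w k))\<^sup>2) / 4))) \<in> borel_measurable (noise :: (nat \<Rightarrow> 'a) measure)"
      by measurable
    then show ?thesis by (simp only: nn_integral_cmult noise_energy_moment)
  qed
  also have "\<dots> \<le> ennreal (exp (- (D + 1) * real n)) * ennreal (exp D) ^ Suc n"
  proof (intro mult_left_mono power_mono ennreal_leI)
    have "sqrt 2 \<le> sqrt (2\<^sup>2)" by (subst real_sqrt_le_iff) simp
    then have "sqrt 2 \<le> exp (1::real)" using exp_ge_add_one_self[of 1] by simp
    then have "sqrt 2 ^ DIM('a) \<le> exp 1 ^ DIM('a)" by (intro power_mono) auto
    then show "sqrt 2 ^ DIM('a) \<le> exp D" by (simp add: D exp_of_nat_mult[symmetric])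
  qed auto
  also have "\<dots> = ennreal (exp (D - real n))"
    by (simp only: ennreal_power exp_ge_zero exp_of_nat_mult[symmetric] ennreal_mult[symmetric] exp_add[symmetric])
      (simp add: algebra_simps)
  finally show ?thesis .
qed

lemma test_fun_cong:
  assumes "test_fun L K f" "\<And>j. j \<le> L \<Longrightarrow> y j = y' j"
  shows "f y = f y'"
proof -
  have "\<bar>f y - f y'\<bar> \<le> K * (\<Sum>j\<le>L. norm (y j - y' j))" using assms(1) by (simp add: test_fun_def)
  also have "\<dots> = 0" using assms(2) by simp
  finally show ?thesis by simp
qed

lemma obs_cong: "(\<And>j. j \<le> k \<Longrightarrow> w j = w' j) \<Longrightarrow> obs A R B S x w k = obs A R B S x w' k"
  using state_cong_fst[of k w w' A R x] by (simp add: obs_def)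

lemma prod_ennreal_exp:
  "(\<Prod>k<n. ennreal (f k * exp (g k))) = (\<Prod>k<n. ennreal (f k)) * ennreal (exp (\<Sum>k<n. g k))" if "\<And>k. 0 \<le> f k" for n :: nat
proof -
  have "ennreal (exp (\<Sum>k<n. g k)) = (\<Prod>k<n. ennreal (exp (g k)))"
    unfolding exp_sum[OF finite_lessThan] by (rule prod_ennreal[symmetric]) simp
  with that show ?thesis by (simp only: ennreal_mult exp_ge_zero prod.distrib)
qed

context linear_model
begin

text \<open>Closeness of exactly what enters the state recursion, the residual and the normalising
  constant. The determinant condition is one-sided because the perturbed likelihood is only bounded
  from above.\<close>

definition near :: "real \<Rightarrow> real^'d^'d \<Rightarrow> real^'q^'d \<Rightarrow> real^'d^'p \<Rightarrow> real^'p^'p \<Rightarrow> bool" where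
  "near \<rho> A' R' B' S' \<longleftrightarrow> norm (A' - A) \<le> \<rho> \<and> norm (R' - R) \<le> \<rho> \<and> norm (matrix_inv S' - F) \<le> \<rho> \<and>
     norm (matrix_inv S' ** B' - F ** B) \<le> \<rho> \<and> \<bar>det S\<bar> \<le> exp \<rho> * \<bar>det S'\<bar>"

lemma near_mono: "near \<rho> A' R' B' S' \<Longrightarrow> \<rho> \<le> \<rho>' \<Longrightarrow> near \<rho>' A' R' B' S'"
proof -
  assume *: "near \<rho> A' R' B' S'" "\<rho> \<le> \<rho>'"
  have "exp \<rho> * \<bar>det S'\<bar> \<le> exp \<rho>' * \<bar>det S'\<bar>" using * by (intro mult_right_mono) auto
  with * show ?thesis by (auto simp: near_def)
qed

lemma lr_eq: "lr x y = gauss_pdf (F *v (y - B *v x)) / (\<bar>det S\<bar> * gauss_pdf y)"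
  by (simp add: lr_def obs_density_eq)

text \<open>The bound holds already for the integrands, path by path: the logarithm of their ratio
  is half the difference of the residual energies plus at most \<open>\<eta>\<close> per factor for
  the determinants, and \<open>residual_perturbation\<close> bounds that difference by the exponent
  of the weight and the energy of \<open>y\<close>. The radius depends on \<open>\<eta>\<close>
  alone among the quantified data.\<close>

lemma LR_near:
  assumes \<eta>: "0 < \<eta>"
  shows "\<exists>\<rho>>0. \<forall>A' R' B' S'. linear_model A' R' B' S' \<longrightarrow> near \<rho> A' R' B' S' \<longrightarrow>
    (\<forall>\<nu> n y M. prob_space \<nu> \<longrightarrow> sets \<nu> = sets borel \<longrightarrow> CARD('d) \<le> n \<longrightarrow> (\<Sum>k\<le>n. (norm (y k))\<^sup>2) \<le> M * real n \<longrightarrow>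
      linear_model.LR A' R' B' S' \<nu> n y \<le> ennreal (exp ((2 * \<eta> + \<eta> * M / 2) * real n)) * weighted_LR \<eta> \<nu> n y)"
proof -
  obtain \<rho>0 where \<rho>0: "\<rho>0 > 0" and pert: "\<And>A' R' F' H' n x w y. norm (A' - A) \<le> \<rho>0 \<Longrightarrow> norm (R' - R) \<le> \<rho>0 \<Longrightarrow> norm (F' - F) \<le> \<rho>0 \<Longrightarrow>
    norm (H' - F ** B) \<le> \<rho>0 \<Longrightarrow> CARD('d) \<le> n \<Longrightarrow>
      (\<Sum>k\<le>n. (norm (resid x w y k))\<^sup>2) \<le> (\<Sum>k\<le>n. (norm (F' *v y k - H' *v state A' R' x w k))\<^sup>2)
        + \<eta> * (\<Sum>k\<le>n. (norm (resid x w y k))\<^sup>2 + (norm (fst (w k)))\<^sup>2 + (norm (y k))\<^sup>2)"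
    using residual_perturbation[OF \<eta>] by blast
  define \<rho> where "\<rho> = min \<rho>0 \<eta>"
  have \<rho>: "\<rho> > 0" "\<rho> \<le> \<rho>0" "\<rho> \<le> \<eta>" using \<rho>0 \<eta> by (auto simp: \<rho>_def)
  have "linear_model.LR A' R' B' S' \<nu> n y \<le> ennreal (exp ((2 * \<eta> + \<eta> * M / 2) * real n)) * weighted_LR \<eta> \<nu> n y"
    if model: "linear_model A' R' B' S'" and near: "near \<rho> A' R' B' S'" and \<nu>: "prob_space \<nu>" "sets \<nu> = sets borel"
      and n: "CARD('d) \<le> n" and y: "(\<Sum>k\<le>n. (norm (y k))\<^sup>2) \<le> M * real n" for A' R' B' S' \<nu> n y M
  proof -
    interpret M': linear_model A' R' B' S' by fact
    let ?N = "noise :: (nat \<Rightarrow> (real^'q) \<times> (real^'p)) measure"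
    interpret N: sigma_finite_measure ?N by (rule sigma_finite_noise)
    note \<nu>(2)[measurable_cong]
    have "1 \<le> CARD('d)" by (simp add: Suc_le_eq)
    with n have "n \<ge> 1" by (rule order_trans[rotated])
    note nr = near_mono[OF near \<rho>(2), unfolded near_def] and nd = near_mono[OF near \<rho>(3), unfolded near_def]
    let ?a = "(2 * \<eta> + \<eta> * M / 2) * real n"
    let ?W = "\<lambda>x w. \<eta> / 2 * (\<Sum>k\<le>n. (norm (resid x w y k))\<^sup>2 + (norm (fsts w k))\<^sup>2)"
    have pt: "(\<Prod>k<Suc n. ennreal (M'.lr (M'.X x w k) (y k))) \<le>
      ennreal (exp ?a) * ((\<Prod>k<Suc n. ennreal (lr (X x w k) (y k))) * ennreal (exp (?W x w)))" for x w
    proof -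
      let ?e = "resid x w y" and ?e' = "M'.resid x w y"
      have e': "?e' k = M'.F *v y k - (M'.F ** B') *v M'.X x w k" for k
        by (simp add: algebra_simps matrix_vector_mul_assoc)
      let ?g = "\<lambda>k. \<eta> + ((norm (?e k))\<^sup>2 - (norm (?e' k))\<^sup>2) / 2"
      have "M'.lr (M'.X x w k) (y k) \<le> lr (X x w k) (y k) * exp (?g k)" for k
      proof -
        have g: "gauss_pdf (?e' k) = gauss_pdf (?e k) * exp (((norm (?e k))\<^sup>2 - (norm (?e' k))\<^sup>2) / 2)"
          by (simp add: gauss_pdf_def exp_add[symmetric] mult.assoc) (simp add: field_simps)
        have "1 / \<bar>det S'\<bar> \<le> exp \<eta> / \<bar>det S\<bar>"
          using nd S_inverse(3) M'.S_inverse(3) by (simp add: field_simps)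
        then have "(gauss_pdf (?e' k) / gauss_pdf (y k)) * (1 / \<bar>det S'\<bar>) \<le> (gauss_pdf (?e' k) / gauss_pdf (y k)) * (exp \<eta> / \<bar>det S\<bar>)"
          by (intro mult_left_mono) (auto intro!: divide_nonneg_nonneg less_imp_le[OF gauss_pdf_pos])
        moreover have "M'.lr (M'.X x w k) (y k) = (gauss_pdf (?e' k) / gauss_pdf (y k)) * (1 / \<bar>det S'\<bar>)"
          by (simp add: M'.lr_eq)
        moreover have "lr (X x w k) (y k) * exp (?g k) = (gauss_pdf (?e' k) / gauss_pdf (y k)) * (exp \<eta> / \<bar>det S\<bar>)"
          by (simp add: lr_eq g exp_add mult_ac)
        ultimately show ?thesis by simp
      qed
      then have "(\<Prod>k<Suc n. ennreal (M'.lr (M'.X x w k) (y k))) \<le> (\<Prod>k<Suc n. ennreal (lr (X x w k) (y k) * exp (?g k)))"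
        by (intro prod_mono_ennreal ennreal_leI)
      also have "\<dots> = (\<Prod>k<Suc n. ennreal (lr (X x w k) (y k))) * ennreal (exp (\<Sum>k<Suc n. ?g k))"
        by (rule prod_ennreal_exp) (rule less_imp_le[OF lr_pos])
      also have "\<dots> \<le> (\<Prod>k<Suc n. ennreal (lr (X x w k) (y k))) * ennreal (exp (?a + ?W x w))"
      proof (intro mult_left_mono ennreal_leI)
        have s: "(\<Sum>k\<le>n. (norm (?e k))\<^sup>2) \<le> (\<Sum>k\<le>n. (norm (?e' k))\<^sup>2)
          + \<eta> * (\<Sum>k\<le>n. (norm (?e k))\<^sup>2 + (norm (fsts w k))\<^sup>2 + (norm (y k))\<^sup>2)"
          using pert[where A' = A' and R' = R' and F' = M'.F and H' = "M'.F ** B'" and n = n and x = x and w = w and y = y]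
            nr n unfolding e' fsts_def by blast
        have lin: "g \<le> a + W" if "g = h + b + (sE - sE') / 2" "sE \<le> sE' + T" "T = 2 * W + sY" "sY \<le> m" "b \<le> h" "a = 2 * h + m / 2"
          for g a W h b sE sE' T sY m :: real using that by argo
        have "(\<Sum>k<Suc n. ?g k) \<le> ?a + ?W x w"
        proof (rule lin[OF _ s])
          show "(\<Sum>k<Suc n. ?g k) = \<eta> * real n + \<eta> + ((\<Sum>k\<le>n. (norm (?e k))\<^sup>2) - (\<Sum>k\<le>n. (norm (?e' k))\<^sup>2)) / 2"
            unfolding lessThan_Suc_atMost sum.distrib sum_divide_distrib[symmetric] sum_subtractf
            by (simp add: algebra_simps)
          show "\<eta> * (\<Sum>k\<le>n. (norm (?e k))\<^sup>2 + (norm (fsts w k))\<^sup>2 + (norm (y k))\<^sup>2)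
            = 2 * ?W x w + \<eta> * (\<Sum>k\<le>n. (norm (y k))\<^sup>2)"
            by (simp add: sum.distrib algebra_simps)
          show "\<eta> * (\<Sum>k\<le>n. (norm (y k))\<^sup>2) \<le> \<eta> * (M * real n)" using y \<eta> by (intro mult_left_mono) auto
          \<comment> \<open>There are \<open>n + 1\<close> determinant factors but the exponent is a
            multiple of \<open>n\<close>; this accounts for the term
            \<open>2 * \<eta>\<close>.\<close>
          show "\<eta> \<le> \<eta> * real n" using \<eta> \<open>n \<ge> 1\<close> by simp
          show "?a = 2 * (\<eta> * real n) + \<eta> * (M * real n) / 2" by (simp add: algebra_simps)
        qed
        then show "exp (\<Sum>k<Suc n. ?g k) \<le> exp (?a + ?W x w)" by (simp only: exp_le_cancel_iff)
      qed simp
      also have "\<dots> = ennreal (exp ?a) * ((\<Prod>k<Suc n. ennreal (lr (X x w k) (y k))) * ennreal (exp (?W x w)))"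
        by (simp add: exp_add ennreal_mult mult_ac del: prod.lessThan_Suc)
      finally show ?thesis .
    qed
    let ?J = "\<lambda>x w. (\<Prod>k<Suc n. ennreal (lr (X x w k) (y k))) * ennreal (exp (?W x w))"
    have m1: "(\<lambda>w. ?J x w) \<in> borel_measurable ?N" for x by (measurable; simp)
    have m2: "(\<lambda>x. \<integral>\<^sup>+w. ?J x w \<partial>?N) \<in> borel_measurable \<nu>" by (measurable; simp)
    have "M'.LR \<nu> n y \<le> (\<integral>\<^sup>+x. \<integral>\<^sup>+w. ennreal (exp ?a) * ?J x w \<partial>?N \<partial>\<nu>)"
      unfolding M'.LR_def by (intro nn_integral_mono pt)
    also have "\<dots> = ennreal (exp ?a) * weighted_LR \<eta> \<nu> n y"
      unfolding weighted_LR_def nn_integral_cmult[OF m1] nn_integral_cmult[OF m2] ..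
    finally show ?thesis .
  qed
  with \<rho>(1) show ?thesis by blast
qed

end

subsection \<open>Concentration along observations\<close>

lemma AE_eventually_notin:
  assumes "\<And>n. C n \<in> sets M" "\<And>n. emeasure M (C n) \<le> ennreal (c * exp (- \<kappa> * real n))" "0 \<le> c" "0 < \<kappa>"
  shows "AE x in M. eventually (\<lambda>n. x \<notin> C n) sequentially"
proof -
  have "summable (\<lambda>n. c * exp (- \<kappa>) ^ n)"
    using \<open>0 < \<kappa>\<close> by (intro summable_mult summable_geometric) auto
  moreover have "exp (- \<kappa>) ^ n = exp (- \<kappa> * real n)" for n
    by (simp add: exp_of_nat_mult[symmetric] mult.commute)
  ultimately have s: "summable (\<lambda>n. c * exp (- \<kappa> * real n))" by simp
  have fin: "emeasure M (C n) < \<infinity>" for n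
    using assms(2)[of n] by (simp add: order_le_less_trans ennreal_less_top)
  have "AE x in M. eventually (\<lambda>n. x \<in> space M - C n) sequentially"
  proof (rule borel_cantelli_AE1)
    show "summable (\<lambda>n. measure M (C n))"
    proof (rule summable_comparison_test'[OF s])
      fix n
      have "measure M (C n) \<le> c * exp (- \<kappa> * real n)"
        unfolding measure_def by (rule enn2real_leI) (use assms in auto)
      then show "norm (measure M (C n)) \<le> c * exp (- \<kappa> * real n)" by simp
    qed
  qed (use assms fin in auto)
  then show ?thesis
    by eventually_elim (auto elim: eventually_mono)
qed

context linear_model
begin

lemma obs_energy:
  "\<exists>C\<ge>0. \<forall>n x w. (\<Sum>k\<le>n. (norm (Y x w k))\<^sup>2) \<le> C * ((norm x)\<^sup>2 + (\<Sum>k\<le>n. (norm (w k))\<^sup>2))"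
proof -
  obtain E where E: "E \<ge> 0" "\<And>n x w. (\<Sum>k\<le>n. (norm (X x w k))\<^sup>2) \<le> E * ((norm x)\<^sup>2 + (\<Sum>k\<le>n. (norm (fst (w k)))\<^sup>2))"
    using state_energy by blast
  let ?b = "2 * (norm B)\<^sup>2" and ?s = "2 * (norm S)\<^sup>2"
  have "(\<Sum>k\<le>n. (norm (Y x w k))\<^sup>2) \<le> (?b * E + ?s) * ((norm x)\<^sup>2 + (\<Sum>k\<le>n. (norm (w k))\<^sup>2))" for n x w
  proof -
    let ?W = "\<Sum>k\<le>n. (norm (w k))\<^sup>2"
    have "(norm (Y x w k))\<^sup>2 \<le> ?b * (norm (X x w k))\<^sup>2 + ?s * (norm (w k))\<^sup>2" for k
    proof -
      have "(norm (Y x w k))\<^sup>2 \<le> 2 * (norm (B *v X x w k))\<^sup>2 + 2 * (norm (S *v snd (w k)))\<^sup>2"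
        unfolding obs_def by (rule norm_add_sq_le)
      also have "\<dots> \<le> 2 * ((norm B)\<^sup>2 * (norm (X x w k))\<^sup>2) + 2 * ((norm S)\<^sup>2 * (norm (snd (w k)))\<^sup>2)"
        by (intro add_mono mult_left_mono norm_matrix_vector_mult_sq_le) auto
      also have "(norm (snd (w k)))\<^sup>2 \<le> (norm (w k))\<^sup>2"
        by (intro power_mono) (metis norm_snd_le prod.collapse, simp)
      finally show ?thesis by (simp add: mult_left_mono mult.assoc)
    qed
    then have "(\<Sum>k\<le>n. (norm (Y x w k))\<^sup>2) \<le> (\<Sum>k\<le>n. ?b * (norm (X x w k))\<^sup>2 + ?s * (norm (w k))\<^sup>2)"
      by (intro sum_mono)
    also have "\<dots> = ?b * (\<Sum>k\<le>n. (norm (X x w k))\<^sup>2) + ?s * ?W"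
      by (simp add: sum.distrib sum_distrib_left)
    also have "\<dots> \<le> ?b * (E * ((norm x)\<^sup>2 + ?W)) + ?s * ((norm x)\<^sup>2 + ?W)"
    proof (intro add_mono mult_left_mono order_trans[OF E(2)] E(1))
      have "(norm (fst (w k)))\<^sup>2 \<le> (norm (w k))\<^sup>2" for k
        by (intro power_mono) (metis norm_fst_le prod.collapse, simp)
      then show "(\<Sum>k\<le>n. (norm (fst (w k)))\<^sup>2) \<le> ?W" by (intro sum_mono)
    qed auto
    finally show ?thesis by (simp add: algebra_simps)
  qed
  then show ?thesis using E by (intro exI[of _ "?b * E + ?s"]) auto
qed

text \<open>The case \<open>y = Y\<close> of \<open>initial_energy\<close>, where
  \<open>y - B X\<close> is \<open>S\<close> applied to the observation noise.\<close>

lemma initial_energy_obs: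
  "\<exists>C\<ge>0. \<forall>n x w. CARD('d) \<le> n \<longrightarrow> (norm x)\<^sup>2 \<le> C * ((\<Sum>k\<le>n. (norm (Y x w k))\<^sup>2) + (\<Sum>k\<le>n. (norm (w k))\<^sup>2))"
proof -
  obtain E where E: "E \<ge> 0" "\<And>n x w y. CARD('d) \<le> n \<Longrightarrow> (norm x)\<^sup>2 \<le>
     E * (\<Sum>k\<le>n. (norm (y k))\<^sup>2 + (norm (y k - B *v X x w k))\<^sup>2 + (norm (fst (w k)))\<^sup>2)"
    using initial_energy by blast
  define s where "s = max 1 ((norm S)\<^sup>2)"
  have s: "1 \<le> s" "(norm S)\<^sup>2 \<le> s" by (auto simp: s_def)
  have "(norm x)\<^sup>2 \<le> (E * s) * ((\<Sum>k\<le>n. (norm (Y x w k))\<^sup>2) + (\<Sum>k\<le>n. (norm (w k))\<^sup>2))" if n: "CARD('d) \<le> n" for n x w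
  proof -
    have "(norm x)\<^sup>2 \<le> E * (\<Sum>k\<le>n. (norm (Y x w k))\<^sup>2 + (norm (Y x w k - B *v X x w k))\<^sup>2 + (norm (fst (w k)))\<^sup>2)"
      by (rule E(2)[OF n])
    also have "\<dots> \<le> E * (\<Sum>k\<le>n. s * ((norm (Y x w k))\<^sup>2 + (norm (w k))\<^sup>2))"
    proof (intro mult_left_mono sum_mono E)
      fix k
      have "(norm (Y x w k - B *v X x w k))\<^sup>2 \<le> s * (norm (snd (w k)))\<^sup>2"
        using norm_matrix_vector_mult_sq_le[of S "norm S" "snd (w k)"] s
        by (simp add: obs_def) (meson mult_right_mono order_trans zero_le_power2)
      moreover have "(norm (fst (w k)))\<^sup>2 \<le> s * (norm (fst (w k)))\<^sup>2" "(norm (Y x w k))\<^sup>2 \<le> s * (norm (Y x w k))\<^sup>2"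
        using mult_right_mono[OF s(1) zero_le_power2] by (metis mult_1)+
      moreover have "(norm (w k))\<^sup>2 = (norm (fst (w k)))\<^sup>2 + (norm (snd (w k)))\<^sup>2"
        by (cases "w k") (simp add: norm_Pair)
      ultimately show "(norm (Y x w k))\<^sup>2 + (norm (Y x w k - B *v X x w k))\<^sup>2 + (norm (fst (w k)))\<^sup>2 \<le> s * ((norm (Y x w k))\<^sup>2 + (norm (w k))\<^sup>2)"
        by (simp add: algebra_simps)
    qed
    also have "\<dots> = (E * s) * ((\<Sum>k\<le>n. (norm (Y x w k))\<^sup>2) + (\<Sum>k\<le>n. (norm (w k))\<^sup>2))"
      by (simp add: sum_distrib_left[symmetric] sum.distrib mult.assoc)
    finally show ?thesis .
  qed
  then show ?thesis using E s by (intro exI[of _ "E * s"]) auto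
qed

text \<open>An event of the noise alone: all windows are restarted from 0, so they are i.i.d. and
  the probability does not involve the initial state.\<close>

definition bad_windows :: "nat \<Rightarrow> nat \<Rightarrow> ((nat \<Rightarrow> real^'p) \<Rightarrow> real) \<Rightarrow> real \<Rightarrow> nat \<Rightarrow> (nat \<Rightarrow> (real^'q) \<times> (real^'p)) set" where
  "bad_windows m L f \<delta> n = {w. real (n div (m + L + 1)) * \<delta> \<le>
     \<bar>(\<Sum>i < n div (m + L + 1). f (\<lambda>l. Y 0 (\<lambda>k. w (i * (m + L + 1) + k)) (m + l)))
       - real (n div (m + L + 1)) * (LINT w|noise. f (\<lambda>l. Y 0 w (m + l)))\<bar>}"

lemma bad_windows_sets:
  assumes "test_fun L K f"
  shows "bad_windows m L f \<delta> n \<in> sets noise"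
proof -
  have [measurable]: "f \<in> borel_measurable seq_borel" using assms by (simp add: test_fun_def)
  have "{w \<in> space noise. real (n div (m + L + 1)) * \<delta> \<le>
     \<bar>(\<Sum>i < n div (m + L + 1). f (\<lambda>l. Y 0 (\<lambda>k. w (i * (m + L + 1) + k)) (m + l)))
       - real (n div (m + L + 1)) * (LINT w|noise. f (\<lambda>l. Y 0 w (m + l)))\<bar>} \<in> sets (noise :: (nat \<Rightarrow> (real^'q) \<times> (real^'p)) measure)"
    by measurable
  then show ?thesis by (simp add: bad_windows_def)
qed

lemma bad_windows_prob:
  assumes f: "test_fun L K f" and "0 < \<delta>"
  shows "emeasure noise (bad_windows m L f \<delta> n)
    \<le> ennreal (2 * exp (2 * \<delta>\<^sup>2) * exp (- (2 * \<delta>\<^sup>2 / real (m + L + 1)) * real n))"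
proof -
  have [measurable]: "f \<in> borel_measurable seq_borel" using f by (simp add: test_fun_def)
  define M where "M = m + L + 1"
  have M: "0 < M" by (simp add: M_def)
  have "emeasure noise (bad_windows m L f \<delta> n) \<le> ennreal (2 * exp (- 2 * real (n div M) * \<delta>\<^sup>2))"
    unfolding bad_windows_def M_def[symmetric]
  proof (rule block_hoeffding[where g = "\<lambda>w. f (\<lambda>l. Y 0 w (m + l))"])
    fix w w' :: "nat \<Rightarrow> (real^'q) \<times> (real^'p)" assume eq: "\<And>k. k < M \<Longrightarrow> w k = w' k"
    show "f (\<lambda>l. Y 0 w (m + l)) = f (\<lambda>l. Y 0 w' (m + l))"
      by (rule test_fun_cong[OF f], rule obs_cong, rule eq) (simp add: M_def)
  qed (use f \<open>0 < \<delta>\<close> in \<open>auto simp: test_fun_def\<close>)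
  also have "\<dots> \<le> ennreal (2 * exp (2 * \<delta>\<^sup>2) * exp (- (2 * \<delta>\<^sup>2 / real M) * real n))"
  proof (rule ennreal_leI)
    \<comment> \<open>\<open>n div M \<ge> n / M - 1\<close>, and the lost unit becomes the factor
      \<open>exp (2 * \<delta>^2)\<close>.\<close>
    have "real n = real (n div M) * real M + real (n mod M)"
      by (metis div_mult_mod_eq of_nat_add of_nat_mult)
    also have "real (n mod M) \<le> real M" using M by (simp add: less_imp_le)
    finally have "real n / real M \<le> real (n div M) + 1" using M by (simp add: field_simps)
    then have "2 * \<delta>\<^sup>2 * (real n / real M) \<le> 2 * \<delta>\<^sup>2 * (real (n div M) + 1)" by (intro mult_left_mono) auto
    then have "- 2 * real (n div M) * \<delta>\<^sup>2 \<le> 2 * \<delta>\<^sup>2 + - (2 * \<delta>\<^sup>2 / real M) * real n"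
      by (simp add: algebra_simps)
    then have "exp (- 2 * real (n div M) * \<delta>\<^sup>2) \<le> exp (2 * \<delta>\<^sup>2) * exp (- (2 * \<delta>\<^sup>2 / real M) * real n)"
      by (simp only: exp_add[symmetric] exp_le_cancel_iff)
    then show "2 * exp (- 2 * real (n div M) * \<delta>\<^sup>2) \<le> 2 * exp (2 * \<delta>\<^sup>2) * exp (- (2 * \<delta>\<^sup>2 / real M) * real n)"
      by (simp only: mult.assoc)
  qed
  finally show ?thesis by (simp only: M_def)
qed

text \<open>Three errors per window add up to \<open>7 / 4 * \<delta>\<close>: restarting from 0
  (\<open>\<delta> / 2\<close>), random deviation (\<open>\<delta>\<close>), and bias of the
  restarted mean (\<open>\<delta> / 4\<close>).\<close>

lemma window_sum_concentration:
  assumes f: "test_fun L K f" and Q: "0 \<le> Q" and \<delta>: "0 < \<delta>"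
  shows "eventually (\<lambda>m. \<forall>n\<ge>m + L + 1. \<forall>x w. (norm x)\<^sup>2 + (\<Sum>k\<le>n. (norm (w k))\<^sup>2) \<le> Q * real n \<longrightarrow>
    w \<notin> bad_windows m L f \<delta> n \<longrightarrow>
    \<bar>window_sum m L f n (Y x w) - real (n div (m + L + 1)) * obs_mean f\<bar> \<le> real (n div (m + L + 1)) * (7 / 4 * \<delta>)) sequentially"
proof -
  have "eventually (\<lambda>m. dist (LINT w|noise. f (\<lambda>l. Y 0 w (m + l))) (obs_mean f) < \<delta> / 4) sequentially"
    using obs_mean_limit[OF f] \<delta> by (intro tendstoD) auto
  moreover have "0 < \<delta> / 2" using \<delta> by simp
  note window_approximation[OF f Q this]
  ultimately show ?thesis
  proof (eventually_elim, safe)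
    fix m n :: nat and x :: "real^'d" and w :: "nat \<Rightarrow> (real^'q) \<times> (real^'p)"
    assume app: "\<forall>n\<ge>m + L + 1. \<forall>x w. (norm x)\<^sup>2 + (\<Sum>k\<le>n. (norm (w k))\<^sup>2) \<le> Q * real n \<longrightarrow>
        \<bar>window_sum m L f n (Y x w) - (\<Sum>i < n div (m + L + 1). f (\<lambda>l. Y 0 (\<lambda>k. w (i * (m + L + 1) + k)) (m + l)))\<bar>
        \<le> real (n div (m + L + 1)) * (\<delta> / 2)"
      and mean: "dist (LINT w|noise. f (\<lambda>l. Y 0 w (m + l))) (obs_mean f) < \<delta> / 4"
      and n: "m + L + 1 \<le> n" and xw: "(norm x)\<^sup>2 + (\<Sum>k\<le>n. (norm (w k))\<^sup>2) \<le> Q * real n"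
      and bad: "w \<notin> bad_windows m L f \<delta> n"
    let ?N = "real (n div (m + L + 1))"
    let ?G = "\<Sum>i < n div (m + L + 1). f (\<lambda>l. Y 0 (\<lambda>k. w (i * (m + L + 1) + k)) (m + l))"
    let ?e = "LINT w|noise. f (\<lambda>l. Y 0 w (m + l))"
    have 1: "\<bar>window_sum m L f n (Y x w) - ?G\<bar> \<le> ?N * (\<delta> / 2)" using app n xw by blast
    have 2: "\<bar>?G - ?N * ?e\<bar> < ?N * \<delta>" using bad by (simp add: bad_windows_def)
    have "\<bar>?N * ?e - ?N * obs_mean f\<bar> = ?N * \<bar>?e - obs_mean f\<bar>"
      by (simp add: right_diff_distrib[symmetric] abs_mult)
    also have "\<dots> \<le> ?N * (\<delta> / 4)" using mean by (intro mult_left_mono) (auto simp: dist_real_def)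
    finally have 3: "\<bar>?N * ?e - ?N * obs_mean f\<bar> \<le> ?N * (\<delta> / 4)" .
    have "\<bar>window_sum m L f n (Y x w) - ?N * obs_mean f\<bar> \<le> ?N * (\<delta> / 2) + ?N * \<delta> + ?N * (\<delta> / 4)"
      using 1 2 3 by argo
    then show "\<bar>window_sum m L f n (Y x w) - ?N * obs_mean f\<bar> \<le> ?N * (7 / 4 * \<delta>)" by (simp add: algebra_simps)
  qed
qed

end

subsection \<open>Exponential separation of likelihoods\<close>

context linear_model
begin

lemma measurable_LR:
  assumes \<nu>: "prob_space \<nu>" "sets \<nu> = sets borel"
  shows "LR \<nu> n \<in> borel_measurable seq_borel"
proof -
  interpret N: sigma_finite_measure "noise :: (nat \<Rightarrow> (real^'q) \<times> (real^'p)) measure" by (rule sigma_finite_noise)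
  interpret V: prob_space \<nu> by (rule \<nu>(1))
  note \<nu>(2)[measurable_cong]
  show ?thesis unfolding LR_def by measurable
qed

lemma measurable_weighted_LR:
  assumes \<nu>: "prob_space \<nu>" "sets \<nu> = sets borel"
  shows "weighted_LR \<eta> \<nu> n \<in> borel_measurable seq_borel"
proof -
  interpret N: sigma_finite_measure "noise :: (nat \<Rightarrow> (real^'q) \<times> (real^'p)) measure" by (rule sigma_finite_noise)
  interpret V: prob_space \<nu> by (rule \<nu>(1))
  note \<nu>(2)[measurable_cong]
  show ?thesis unfolding weighted_LR_def by measurable
qed

lemma LR_cong: "(\<And>k. k \<le> n \<Longrightarrow> y k = y' k) \<Longrightarrow> LR \<nu> n y = LR \<nu> n y'"
  unfolding LR_def by (intro nn_integral_cong prod.cong) auto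

lemma weighted_LR_cong: "(\<And>k. k \<le> n \<Longrightarrow> y k = y' k) \<Longrightarrow> weighted_LR \<eta> \<nu> n y = weighted_LR \<eta> \<nu> n y'"
proof -
  assume eq: "\<And>k. k \<le> n \<Longrightarrow> y k = y' k"
  have "(\<Prod>k<Suc n. ennreal (lr (X x w k) (y k))) = (\<Prod>k<Suc n. ennreal (lr (X x w k) (y' k)))" for x w
    by (rule prod.cong) (auto simp: eq)
  moreover have "(\<Sum>k\<le>n. (norm (resid x w y k))\<^sup>2 + (norm (fsts w k))\<^sup>2) = (\<Sum>k\<le>n. (norm (resid x w y' k))\<^sup>2 + (norm (fsts w k))\<^sup>2)" for x w
    by (rule sum.cong) (auto simp: eq)
  ultimately show ?thesis unfolding weighted_LR_def by (simp only:)
qed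

text \<open>Borel--Cantelli under the initial law \<open>\<nu>\<close>, then transfer of the null set to every initial state.\<close>

lemma AE_eventually_notin_obs:
  assumes \<nu>: "prob_space \<nu>" "sets \<nu> = sets borel" and C: "\<And>n. C n \<in> sets seq_borel"
    and bound: "\<And>n. ns \<le> n \<Longrightarrow> (\<integral>\<^sup>+x. \<integral>\<^sup>+w. indicator (C n) (Y x w) \<partial>noise \<partial>\<nu>) \<le> ennreal (c * exp (- \<kappa> * real n))"
    and "0 \<le> c" "0 < \<kappa>"
  shows "AE w in noise. eventually (\<lambda>n. Y x w \<notin> C n) sequentially"
proof -
  let ?N = "noise :: (nat \<Rightarrow> (real^'q) \<times> (real^'p)) measure"
  interpret N: prob_space ?N by (rule prob_space_noise)
  interpret V: prob_space \<nu> by (rule \<nu>(1))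
  note \<nu>(2)[measurable_cong]
  note [measurable] = C
  \<comment> \<open>The number of visits to the sets \<open>C n\<close> with
    \<open>n \<ge> ns\<close>. Its mean under the initial law \<open>\<nu>\<close> is finite, so its
    mean is finite for at least one initial state \<open>x0\<close>.\<close>
  define g :: "(nat \<Rightarrow> real^'p) \<Rightarrow> ennreal" where "g y = (\<Sum>n. indicator (C (ns + n)) y)" for y
  have [measurable]: "g \<in> borel_measurable seq_borel" unfolding g_def by measurable
  have "(\<integral>\<^sup>+x. \<integral>\<^sup>+w. g (Y x w) \<partial>?N \<partial>\<nu>) = (\<Sum>n. \<integral>\<^sup>+x. \<integral>\<^sup>+w. indicator (C (ns + n)) (Y x w) \<partial>?N \<partial>\<nu>)"
  proof -
    have "(\<integral>\<^sup>+w. g (Y x w) \<partial>?N) = (\<Sum>n. \<integral>\<^sup>+w. indicator (C (ns + n)) (Y x w) \<partial>?N)" for x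
      unfolding g_def by (rule nn_integral_suminf) measurable
    moreover have "(\<integral>\<^sup>+x. (\<Sum>n. \<integral>\<^sup>+w. indicator (C (ns + n)) (Y x w) \<partial>?N) \<partial>\<nu>)
      = (\<Sum>n. \<integral>\<^sup>+x. \<integral>\<^sup>+w. indicator (C (ns + n)) (Y x w) \<partial>?N \<partial>\<nu>)"
      by (rule nn_integral_suminf) measurable
    ultimately show ?thesis by simp
  qed
  also have "\<dots> \<le> (\<Sum>n. ennreal (c * exp (- \<kappa> * real (ns + n))))"
    by (intro suminf_le bound) auto
  also have "\<dots> < \<top>"
  proof -
    have "summable (\<lambda>n. c * exp (- \<kappa>) ^ (ns + n))"
      unfolding power_add using \<open>0 < \<kappa>\<close> by (intro summable_mult summable_geometric) auto
    moreover have "exp (- \<kappa>) ^ n = exp (- \<kappa> * real n)" for n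
      by (simp add: exp_of_nat_mult[symmetric] mult.commute)
    ultimately have "summable (\<lambda>n. c * exp (- \<kappa> * real (ns + n)))" by simp
    then have "(\<Sum>n. ennreal (c * exp (- \<kappa> * real (ns + n)))) \<noteq> \<top>"
      using \<open>0 \<le> c\<close> by (intro ennreal_suminf_neq_top) auto
    then show ?thesis by (simp add: less_top)
  qed
  finally have fin: "(\<integral>\<^sup>+x. \<integral>\<^sup>+w. g (Y x w) \<partial>?N \<partial>\<nu>) < \<top>" .
  have "\<exists>x0. (\<integral>\<^sup>+w. g (Y x0 w) \<partial>?N) \<noteq> \<top>"
  proof (rule ccontr)
    assume "\<not> ?thesis"
    then have "(\<integral>\<^sup>+x. \<integral>\<^sup>+w. g (Y x w) \<partial>?N \<partial>\<nu>) = (\<integral>\<^sup>+x. \<top> \<partial>\<nu>)" by simp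
    also have "\<dots> = \<top>" by (simp add: V.emeasure_space_1)
    finally show False using fin by simp
  qed
  then obtain x0 where "(\<integral>\<^sup>+w. g (Y x0 w) \<partial>?N) \<noteq> \<infinity>" by auto
  then have "AE w in ?N. g (Y x0 w) \<noteq> \<infinity>"
    by (rule nn_integral_PInf_AE[rotated]) measurable
  then have "AE w in ?N. indicator {y. g y = \<top>} (Y x0 w) = (0 :: ennreal)"
    by eventually_elim simp
  moreover have gm: "indicator {y. g y = \<top>} \<in> borel_measurable (seq_borel :: (nat \<Rightarrow> real^'p) measure)"
  proof -
    have "{y \<in> space seq_borel. g y = \<top>} \<in> sets (seq_borel :: (nat \<Rightarrow> real^'p) measure)" by measurable
    then show ?thesis by (intro borel_measurable_indicator) simp
  qed
  note [measurable] = gm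
  ultimately have "(\<integral>\<^sup>+w. indicator {y. g y = \<top>} (Y x0 w) \<partial>?N) = 0"
    by (subst nn_integral_0_iff_AE) auto
  \<comment> \<open>Infinitely many visits is an event of the observation path, so being null from
    \<open>x0\<close> it is null from every \<open>x\<close>.\<close>
  then have "(\<integral>\<^sup>+w. indicator {y. g y = \<top>} (Y x w) \<partial>?N) = 0"
    by (rule obs_null_sets_agree[OF gm])
  then have "AE w in ?N. indicator {y. g y = \<top>} (Y x w) = (0 :: ennreal)"
    by (subst (asm) nn_integral_0_iff_AE) auto
  then show ?thesis
  proof eventually_elim
    case (elim w)
    let ?a = "\<lambda>n. indicator (C (ns + n)) (Y x w) :: real"
    have "(\<Sum>n. ennreal (?a n)) \<noteq> \<top>"
      using elim by (auto simp: g_def ennreal_indicator split: split_indicator_asm)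
    then have "summable ?a" by (intro summable_suminf_not_top) auto
    then have "?a \<longlonglongrightarrow> 0" by (rule summable_LIMSEQ_zero)
    then have "eventually (\<lambda>n. ?a n < 1) sequentially" by (rule order_tendstoD) simp
    then obtain n2 where n2: "\<And>n. n2 \<le> n \<Longrightarrow> ?a n < 1" by (auto simp: eventually_sequentially)
    have "Y x w \<notin> C n" if "ns + n2 \<le> n" for n
    proof -
      have "n2 \<le> n - ns" "ns + (n - ns) = n" using that by linarith+
      with n2[of "n - ns"] show ?thesis by (auto split: split_indicator_asm)
    qed
    then show ?case by (auto simp: eventually_sequentially)
  qed
qed

end

text \<open>The set \<open>G\<close> is fixed before the nearby models, and the quantifier over
  these stands inside \<open>eventually\<close>: the bound is uniform over uncountably many
  parameters although only countably many events are removed.\<close>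

lemma likelihood_separation:
  fixes A A0 :: "real^'d^'d" and R R0 :: "real^'q^'d" and B B0 :: "real^'d^'p" and S S0 :: "real^'p^'p"
  assumes star: "linear_model A R B S" and zero: "linear_model A0 R0 B0 S0"
    and ne: "stationary_obs_law A R B S \<noteq> stationary_obs_law A0 R0 B0 S0"
    and \<nu>: "prob_space \<nu>" "sets \<nu> = sets (borel :: (real^'d) measure)"
  shows "\<exists>\<rho>>0. \<exists>c>0. \<exists>G\<in>sets (seq_borel :: (nat \<Rightarrow> real^'p) measure).
    (\<forall>x. AE w in (noise :: (nat \<Rightarrow> (real^'q) \<times> (real^'p)) measure). obs A R B S x w \<in> G) \<and>
    (\<forall>y\<in>G. eventually (\<lambda>n. \<forall>A' R' B' S'. linear_model A' R' B' S' \<longrightarrow> linear_model.near A0 R0 B0 S0 \<rho> A' R' B' S' \<longrightarrow>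
      linear_model.LR A' R' B' S' \<nu> n y \<le> ennreal (exp (- c * real n)) * linear_model.LR A R B S \<nu> n y) sequentially)"
proof -
  interpret P: linear_model A R B S by fact
  interpret Z: linear_model A0 R0 B0 S0 by fact
  let ?N = "noise :: (nat \<Rightarrow> (real^'q) \<times> (real^'p)) measure"
  interpret N: prob_space ?N by (rule prob_space_noise)
  interpret V: prob_space \<nu> by (rule \<nu>(1))
  note \<nu>(2)[measurable_cong]

  \<comment> \<open>Test function, window length and constants\<close>
  obtain L Kf f where f: "test_fun L Kf f" and fne: "P.obs_mean f \<noteq> Z.obs_mean f"
    using obs_mean_separates[OF star zero ne] by blast
  have [measurable]: "f \<in> borel_measurable seq_borel" using f by (simp add: test_fun_def)
  define \<mu> where "\<mu> = P.obs_mean f"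
  define \<mu>0 where "\<mu>0 = Z.obs_mean f"
  \<comment> \<open>An average within \<open>7/4 * \<delta>\<close> of both means would give
    \<open>|\<mu> - \<mu>0| \<le> 7/2 * \<delta>\<close>, contradicting
    \<open>|\<mu> - \<mu>0| = 4 * \<delta>\<close>.\<close>
  define \<delta> where "\<delta> = \<bar>\<mu> - \<mu>0\<bar> / 4"
  have \<delta>: "0 < \<delta>" using fne by (simp add: \<delta>_def \<mu>_def \<mu>0_def)
  define D :: real where "D = DIM((real^'q) \<times> (real^'p))"
  have D: "D \<ge> 0" by (simp add: D_def)
  define K where "K = 8 * (D + 1)"
  have K: "K \<ge> 0" using D by (simp add: K_def)
  obtain C1 where C1: "C1 \<ge> 0" "\<And>n x w. (\<Sum>k\<le>n. (norm (P.Y x w k))\<^sup>2) \<le> C1 * ((norm x)\<^sup>2 + (\<Sum>k\<le>n. (norm (w k))\<^sup>2))"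
    using P.obs_energy by blast
  define M where "M = C1 * (K + 1)"
  have M: "M \<ge> 0" using C1 K by (simp add: M_def)
  obtain C2 where C2: "C2 \<ge> 0" "\<And>n x w. CARD('d) \<le> n \<Longrightarrow>
      (norm x)\<^sup>2 \<le> C2 * ((\<Sum>k\<le>n. (norm (Z.Y x w k))\<^sup>2) + (\<Sum>k\<le>n. (norm (w k))\<^sup>2))"
    using Z.initial_energy_obs by blast
  \<comment> \<open>Per step, this bounds initial state plus noise in the model \<open>Z\<close>,
    given observations of energy at most \<open>M * n\<close> and noise of energy at most
    \<open>K * n\<close>.\<close>
  define Q where "Q = C2 * (M + K) + K"
  have Q: "Q \<ge> 0" using C2 M K by (simp add: Q_def)
  \<comment> \<open>One window length has to serve both models. The bound \<open>K + 1\<close> for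
    the true model leaves room for the fixed initial state, as \<open>|x|^2 \<le> n\<close>
    eventually.\<close>
  have "\<exists>m. (\<forall>n\<ge>m + L + 1. \<forall>x w. (norm x)\<^sup>2 + (\<Sum>k\<le>n. (norm (w k))\<^sup>2) \<le> (K + 1) * real n \<longrightarrow>
        w \<notin> P.bad_windows m L f \<delta> n \<longrightarrow>
        \<bar>window_sum m L f n (P.Y x w) - real (n div (m + L + 1)) * \<mu>\<bar> \<le> real (n div (m + L + 1)) * (7 / 4 * \<delta>)) \<and>
      (\<forall>n\<ge>m + L + 1. \<forall>x w. (norm x)\<^sup>2 + (\<Sum>k\<le>n. (norm (w k))\<^sup>2) \<le> Q * real n \<longrightarrow>
        w \<notin> Z.bad_windows m L f \<delta> n \<longrightarrow>
        \<bar>window_sum m L f n (Z.Y x w) - real (n div (m + L + 1)) * \<mu>0\<bar> \<le> real (n div (m + L + 1)) * (7 / 4 * \<delta>))"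
    unfolding \<mu>_def \<mu>0_def
    by (rule eventually_happens'[OF sequentially_bot], rule eventually_conj)
      (rule P.window_sum_concentration[OF f _ \<delta>], use K in simp, rule Z.window_sum_concentration[OF f Q \<delta>])
  then obtain m where
    mP: "\<And>n x w. m + L + 1 \<le> n \<Longrightarrow> (norm x)\<^sup>2 + (\<Sum>k\<le>n. (norm (w k))\<^sup>2) \<le> (K + 1) * real n \<Longrightarrow>
        w \<notin> P.bad_windows m L f \<delta> n \<Longrightarrow>
        \<bar>window_sum m L f n (P.Y x w) - real (n div (m + L + 1)) * \<mu>\<bar> \<le> real (n div (m + L + 1)) * (7 / 4 * \<delta>)" and
    mZ: "\<And>n x w. m + L + 1 \<le> n \<Longrightarrow> (norm x)\<^sup>2 + (\<Sum>k\<le>n. (norm (w k))\<^sup>2) \<le> Q * real n \<Longrightarrow>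
        w \<notin> Z.bad_windows m L f \<delta> n \<Longrightarrow>
        \<bar>window_sum m L f n (Z.Y x w) - real (n div (m + L + 1)) * \<mu>0\<bar> \<le> real (n div (m + L + 1)) * (7 / 4 * \<delta>)"
    by blast
  define M0 where "M0 = m + L + 1"
  have M0: "0 < M0" by (simp add: M0_def)
  \<comment> \<open>The slower of two decay rates: that of the bad windows, and the rate 1 of the
    noise tail.\<close>
  define \<kappa> where "\<kappa> = min 1 (2 * \<delta>\<^sup>2 / real M0)"
  have \<kappa>: "0 < \<kappa>" "\<kappa> \<le> 1" "\<kappa> \<le> 2 * \<delta>\<^sup>2 / real M0" using \<delta> M0 by (auto simp: \<kappa>_def)
  \<comment> \<open>The bound 1/4 is that of \<open>noise_tail\<close>. The other one makes the
    perturbation loss \<open>a\<close>, the gain \<open>c\<close> to be proved and the weight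
    \<open>\<eta> / 2 * K\<close> together use at most half of \<open>\<kappa>\<close>.\<close>
  define \<eta> where "\<eta> = min (1 / 4) (\<kappa> / (4 * (2 + M / 2 + K / 2)))"
  have \<eta>: "0 < \<eta>" "\<eta> \<le> 1 / 4" using \<kappa> M K by (auto simp: \<eta>_def intro!: divide_pos_pos add_pos_nonneg)
  have \<eta>\<kappa>: "\<eta> * (2 + M / 2 + K / 2) \<le> \<kappa> / 4"
  proof -
    have p: "0 < 2 + M / 2 + K / 2" using M K by simp
    have "\<eta> \<le> \<kappa> / (4 * (2 + M / 2 + K / 2))" by (simp add: \<eta>_def)
    then show ?thesis using p by (simp add: field_simps)
  qed
  define a where "a = 2 * \<eta> + \<eta> * M / 2"
  define c where "c = \<kappa> / 4"
  have c: "0 < c" using \<kappa> by (simp add: c_def)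
  have ac: "a + c + \<eta> / 2 * K \<le> \<kappa> / 2"
    using \<eta>\<kappa> by (simp add: a_def c_def algebra_simps)
  obtain \<rho> where \<rho>: "\<rho> > 0" and near: "\<And>A' R' B' S' n y. linear_model A' R' B' S' \<Longrightarrow> Z.near \<rho> A' R' B' S' \<Longrightarrow>
      CARD('d) \<le> n \<Longrightarrow> (\<Sum>k\<le>n. (norm (y k))\<^sup>2) \<le> M * real n \<Longrightarrow>
      linear_model.LR A' R' B' S' \<nu> n y \<le> ennreal (exp (a * real n)) * Z.weighted_LR \<eta> \<nu> n y"
    using Z.LR_near[OF \<eta>(1)] \<nu> unfolding a_def by blast

  \<comment> \<open>Observation sets typical for the true model\<close>
  define En where "En n = {y :: nat \<Rightarrow> real^'p. (\<Sum>k\<le>n. (norm (y k))\<^sup>2) \<le> M * real n \<and>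
      \<bar>window_sum m L f n y - real (n div M0) * \<mu>\<bar> \<le> real (n div M0) * (7 / 4 * \<delta>)}" for n
  have En_sets [measurable]: "En n \<in> sets seq_borel" for n
  proof -
    have "{y \<in> space seq_borel. (\<Sum>k\<le>n. (norm (y k))\<^sup>2) \<le> M * real n \<and>
      \<bar>window_sum m L f n y - real (n div M0) * \<mu>\<bar> \<le> real (n div M0) * (7 / 4 * \<delta>)} \<in> sets (seq_borel :: (nat \<Rightarrow> real^'p) measure)"
      unfolding window_sum_def by measurable
    then show ?thesis by (simp add: En_def)
  qed
  have En_cong: "y \<in> En n \<longleftrightarrow> y' \<in> En n" if eq: "\<And>k. k \<le> n \<Longrightarrow> y k = y' k" for y y' n
  proof -
    have "window_sum m L f n y = window_sum m L f n y'"
      unfolding window_sum_def M0_def[symmetric]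
    proof (intro sum.cong refl test_fun_cong[OF f] eq)
      fix i j assume "i \<in> {..<n div M0}" "j \<le> L"
      then have "(i + 1) * M0 \<le> n div M0 * M0" by (intro mult_right_mono) auto
      also have "\<dots> \<le> n" by (rule div_times_less_eq_dividend)
      finally show "i * M0 + m + j \<le> n" using \<open>j \<le> L\<close> by (simp add: M0_def)
    qed
    moreover have "(\<Sum>k\<le>n. (norm (y k))\<^sup>2) = (\<Sum>k\<le>n. (norm (y' k))\<^sup>2)" using eq by (intro sum.cong) auto
    ultimately show ?thesis by (simp add: En_def)
  qed
  define T where "T n = {w :: nat \<Rightarrow> (real^'q) \<times> (real^'p). K * real n < (\<Sum>k\<le>n. (norm (w k))\<^sup>2)}" for n
  have [measurable]: "T n \<in> sets ?N" for n
  proof -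
    have "{w \<in> space ?N. K * real n < (\<Sum>k\<le>n. (norm (w k))\<^sup>2)} \<in> sets ?N" by measurable
    then show ?thesis by (simp add: T_def)
  qed
  have En_star: "AE w in ?N. eventually (\<lambda>n. P.Y x w \<in> En n) sequentially" for x
  proof -
    have "AE w in ?N. eventually (\<lambda>n. w \<notin> T n) sequentially"
    proof (rule AE_eventually_notin[where c = "exp D" and \<kappa> = 1])
      show "emeasure ?N (T n) \<le> ennreal (exp D * exp (- 1 * real n))" for n
      proof -
        have "emeasure ?N (T n) = (\<integral>\<^sup>+w. indicator (T n) w * ennreal (exp (0 / 2 * (\<Sum>k\<le>n. (norm (w k))\<^sup>2))) \<partial>?N)"
          by simp
        also have "\<dots> \<le> ennreal (exp (D - real n))"
          unfolding T_def K_def by (rule noise_tail[OF D_def]) auto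
        finally show ?thesis by (simp add: exp_diff exp_minus field_simps)
      qed
    qed auto
    moreover have "AE w in ?N. eventually (\<lambda>n. w \<notin> P.bad_windows m L f \<delta> n) sequentially"
      by (rule AE_eventually_notin[OF P.bad_windows_sets[OF f] P.bad_windows_prob[OF f \<delta>]]) (use \<delta> in auto)
    ultimately show ?thesis
    proof eventually_elim
      case (elim w)
      have "eventually (\<lambda>n. (norm x)\<^sup>2 \<le> real n) sequentially"
        by (rule filterlim_real_sequentially[unfolded filterlim_at_top, rule_format])
      with elim eventually_ge_at_top[of M0] show ?case
      proof eventually_elim
        case (elim n)
        have "(\<Sum>k\<le>n. (norm (w k))\<^sup>2) \<le> K * real n" using elim(1) by (simp add: T_def)
        with elim(4) have xw: "(norm x)\<^sup>2 + (\<Sum>k\<le>n. (norm (w k))\<^sup>2) \<le> (K + 1) * real n"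
          by (simp add: algebra_simps)
        have "(\<Sum>k\<le>n. (norm (P.Y x w k))\<^sup>2) \<le> C1 * ((K + 1) * real n)"
          by (rule order_trans[OF C1(2) mult_left_mono[OF xw C1(1)]])
        moreover have "\<bar>window_sum m L f n (P.Y x w) - real (n div M0) * \<mu>\<bar> \<le> real (n div M0) * (7 / 4 * \<delta>)"
          using mP[OF _ xw elim(2)] elim(3) by (simp add: M0_def)
        ultimately show ?case by (simp add: En_def M_def mult.assoc)
      qed
    qed
  qed

  \<comment> \<open>Weighted probability of these sets under the competing model\<close>
  have En_zero: "(\<integral>\<^sup>+x. \<integral>\<^sup>+w. indicator (En n) (Z.Y x w) * ennreal (exp (\<eta> / 2 * (\<Sum>k\<le>n. (norm (w k))\<^sup>2))) \<partial>?N \<partial>\<nu>)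
      \<le> ennreal ((2 * exp (2 * \<delta>\<^sup>2) + exp D) * exp ((\<eta> / 2 * K - \<kappa>) * real n))" if n: "CARD('d) \<le> n" "M0 \<le> n" for n
  proof -
    let ?s = "\<lambda>w :: nat \<Rightarrow> (real^'q) \<times> (real^'p). \<Sum>k\<le>n. (norm (w k))\<^sup>2"
    let ?W = "\<lambda>w. ennreal (exp (\<eta> / 2 * ?s w))"
    let ?Bad = "Z.bad_windows m L f \<delta> n"
    have [measurable]: "?Bad \<in> sets ?N" by (rule Z.bad_windows_sets[OF f])
    have N1: "1 \<le> n div M0" using n M0 by (simp add: Suc_le_eq div_greater_zero_iff)
    \<comment> \<open>On \<open>En\<close> with moderate noise, the initial state is controlled
      through the observations, whatever \<open>\<nu>\<close> is. Good windows would then average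
      near \<open>\<mu>0\<close>, but \<open>En\<close> keeps them near \<open>\<mu>\<close>, so the
      noise lies in the bad set.\<close>
    have "indicator (En n) (Z.Y x w) * ?W w \<le> ennreal (exp (\<eta> / 2 * K * real n)) * indicator ?Bad w + indicator (T n) w * ?W w" for x w
    proof (cases "Z.Y x w \<in> En n \<and> w \<notin> T n")
      case True
      then have s: "?s w \<le> K * real n" by (simp add: T_def)
      have "(norm x)\<^sup>2 \<le> C2 * ((\<Sum>k\<le>n. (norm (Z.Y x w k))\<^sup>2) + ?s w)" by (rule C2(2)[OF n(1)])
      also have "\<dots> \<le> C2 * (M * real n + K * real n)"
        using True s C2(1) by (intro mult_left_mono add_mono) (auto simp: En_def)
      finally have xw: "(norm x)\<^sup>2 + ?s w \<le> Q * real n" using s by (simp add: Q_def algebra_simps)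
      have "w \<in> ?Bad"
      proof (rule ccontr)
        assume "w \<notin> ?Bad"
        then have "\<bar>window_sum m L f n (Z.Y x w) - real (n div M0) * \<mu>0\<bar> \<le> real (n div M0) * (7 / 4 * \<delta>)"
          using mZ[OF _ xw] n(2) by (simp add: M0_def)
        moreover have "\<bar>window_sum m L f n (Z.Y x w) - real (n div M0) * \<mu>\<bar> \<le> real (n div M0) * (7 / 4 * \<delta>)"
          using True by (simp add: En_def)
        ultimately have "\<bar>real (n div M0) * \<mu> - real (n div M0) * \<mu>0\<bar> \<le> 2 * (real (n div M0) * (7 / 4 * \<delta>))"
          by argo
        moreover have "\<bar>real (n div M0) * \<mu> - real (n div M0) * \<mu>0\<bar> = real (n div M0) * (4 * \<delta>)"
          by (simp add: right_diff_distrib[symmetric] abs_mult \<delta>_def)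
        moreover have "0 < real (n div M0) * \<delta>" using N1 \<delta> by simp
        ultimately show False by (simp add: algebra_simps)
      qed
      moreover have "?W w \<le> ennreal (exp (\<eta> / 2 * K * real n))"
        using s \<eta> by (intro ennreal_leI) (simp add: mult.assoc)
      ultimately show ?thesis using True by simp
    next
      case False
      then show ?thesis by (auto split: split_indicator)
    qed
    then have "(\<integral>\<^sup>+x. \<integral>\<^sup>+w. indicator (En n) (Z.Y x w) * ?W w \<partial>?N \<partial>\<nu>)
      \<le> (\<integral>\<^sup>+x. \<integral>\<^sup>+w. ennreal (exp (\<eta> / 2 * K * real n)) * indicator ?Bad w + indicator (T n) w * ?W w \<partial>?N \<partial>\<nu>)"
      by (intro nn_integral_mono)
    also have "\<dots> = (\<integral>\<^sup>+w. ennreal (exp (\<eta> / 2 * K * real n)) * indicator ?Bad w + indicator (T n) w * ?W w \<partial>?N)"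
      by (simp add: V.emeasure_space_1)
    also have "\<dots> = ennreal (exp (\<eta> / 2 * K * real n)) * emeasure ?N ?Bad + (\<integral>\<^sup>+w. indicator (T n) w * ?W w \<partial>?N)"
      by (subst nn_integral_add) (auto simp: nn_integral_cmult_indicator)
    also have "\<dots> \<le> ennreal (exp (\<eta> / 2 * K * real n)) * ennreal (2 * exp (2 * \<delta>\<^sup>2) * exp (- \<kappa> * real n)) + ennreal (exp (D - real n))"
    proof (intro add_mono mult_left_mono)
      have "emeasure ?N ?Bad \<le> ennreal (2 * exp (2 * \<delta>\<^sup>2) * exp (- (2 * \<delta>\<^sup>2 / real M0) * real n))"
        unfolding M0_def by (rule Z.bad_windows_prob[OF f \<delta>])
      also have "\<dots> \<le> ennreal (2 * exp (2 * \<delta>\<^sup>2) * exp (- \<kappa> * real n))"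
      proof (intro ennreal_leI mult_left_mono)
        show "exp (- (2 * \<delta>\<^sup>2 / real M0) * real n) \<le> exp (- \<kappa> * real n)"
          unfolding exp_le_cancel_iff using \<kappa>(3) by (intro mult_right_mono) auto
      qed simp
      finally show "emeasure ?N ?Bad \<le> ennreal (2 * exp (2 * \<delta>\<^sup>2) * exp (- \<kappa> * real n))" .
      show "(\<integral>\<^sup>+w. indicator (T n) w * ?W w \<partial>?N) \<le> ennreal (exp (D - real n))"
        unfolding T_def K_def by (rule noise_tail[OF D_def]) (use \<eta> in auto)
    qed auto
    also have "\<dots> \<le> ennreal (2 * exp (2 * \<delta>\<^sup>2) * exp ((\<eta> / 2 * K - \<kappa>) * real n)) + ennreal (exp D * exp ((\<eta> / 2 * K - \<kappa>) * real n))"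
    proof (intro add_mono)
      show "ennreal (exp (\<eta> / 2 * K * real n)) * ennreal (2 * exp (2 * \<delta>\<^sup>2) * exp (- \<kappa> * real n)) \<le> ennreal (2 * exp (2 * \<delta>\<^sup>2) * exp ((\<eta> / 2 * K - \<kappa>) * real n))"
      proof -
        have "exp ((\<eta> / 2 * K - \<kappa>) * real n) = exp (\<eta> / 2 * K * real n) * exp (- \<kappa> * real n)"
          unfolding exp_add[symmetric] by (simp add: algebra_simps)
        then show ?thesis by (subst ennreal_mult[symmetric]) (auto simp: mult_ac)
      qed
      have "D - real n \<le> D + (\<eta> / 2 * K - \<kappa>) * real n"
      proof -
        have "\<kappa> * real n \<le> 1 * real n" using \<kappa> by (intro mult_right_mono) auto
        moreover have "0 \<le> \<eta> / 2 * K * real n" using \<eta> K by simp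
        ultimately show ?thesis by (simp add: left_diff_distrib)
      qed
      then show "ennreal (exp (D - real n)) \<le> ennreal (exp D * exp ((\<eta> / 2 * K - \<kappa>) * real n))"
        by (intro ennreal_leI) (simp only: exp_add[symmetric] exp_le_cancel_iff)
    qed
    also have "\<dots> = ennreal ((2 * exp (2 * \<delta>\<^sup>2) + exp D) * exp ((\<eta> / 2 * K - \<kappa>) * real n))"
      by (subst ennreal_plus[symmetric]) (auto simp: distrib_right)
    finally show ?thesis .
  qed

  \<comment> \<open>Paths on which the desired inequality fails\<close>
  define Bn where "Bn n = {y \<in> En n. P.LR \<nu> n y < ennreal (exp ((a + c) * real n)) * Z.weighted_LR \<eta> \<nu> n y}" for n
  have [measurable]: "P.LR \<nu> n \<in> borel_measurable seq_borel" "Z.weighted_LR \<eta> \<nu> n \<in> borel_measurable seq_borel" for n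
    by (rule P.measurable_LR[OF \<nu>], rule Z.measurable_weighted_LR[OF \<nu>])
  have Bn_sets [measurable]: "Bn n \<in> sets seq_borel" for n
  proof -
    have "{y \<in> space seq_borel. y \<in> En n \<and> P.LR \<nu> n y < ennreal (exp ((a + c) * real n)) * Z.weighted_LR \<eta> \<nu> n y} \<in> sets (seq_borel :: (nat \<Rightarrow> real^'p) measure)"
      by measurable
    then show ?thesis by (simp add: Bn_def)
  qed
  have Bn_notin: "AE w in ?N. eventually (\<lambda>n. P.Y x w \<notin> Bn n) sequentially" for x
  proof (rule P.AE_eventually_notin_obs[OF \<nu>, where ns = "max CARD('d) M0" and \<kappa> = "\<kappa> / 2" and c = "2 * exp (2 * \<delta>\<^sup>2) + exp D"])
    show "Bn n \<in> sets seq_borel" for n by (rule Bn_sets)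
    fix n assume "max CARD('d) M0 \<le> n"
    then have n: "CARD('d) \<le> n" "M0 \<le> n" by auto
    let ?t = "ennreal (exp ((a + c) * real n))"
    have Bn_cong: "y \<in> Bn n \<longleftrightarrow> y' \<in> Bn n" if "\<And>k. k \<le> n \<Longrightarrow> y k = y' k" for y y'
      unfolding Bn_def using P.LR_cong[of n y y', OF that] Z.weighted_LR_cong[of n y y', OF that] En_cong[of n y y', OF that] by simp
    have "(\<integral>\<^sup>+x. \<integral>\<^sup>+w. indicator (Bn n) (P.Y x w) \<partial>?N \<partial>\<nu>) = (\<integral>\<^sup>+w'. indicator (Bn n) (snds w') * P.LR \<nu> n (snds w') \<partial>?N)"
    proof (rule P.LR_integral[OF \<nu>])
      show "indicator (Bn n) \<in> borel_measurable seq_borel" by measurable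
      show "indicator (Bn n) y = (indicator (Bn n) y' :: ennreal)" if "\<And>k. k \<le> n \<Longrightarrow> y k = y' k" for y y'
        using Bn_cong[of y y', OF that] by (simp add: indicator_def)
    qed
    \<comment> \<open>Markov's inequality in disguise: on \<open>Bn\<close> the density of the true
      model is dominated by a multiple of the weighted ratio of the competing one.\<close>
    also have "\<dots> \<le> (\<integral>\<^sup>+w'. ?t * (indicator (En n) (snds w') * Z.weighted_LR \<eta> \<nu> n (snds w')) \<partial>?N)"
      by (intro nn_integral_mono) (auto simp: Bn_def split: split_indicator)
    also have "\<dots> = ?t * (\<integral>\<^sup>+w'. indicator (En n) (snds w') * Z.weighted_LR \<eta> \<nu> n (snds w') \<partial>?N)"
      by (rule nn_integral_cmult) measurable
    also have "(\<integral>\<^sup>+w'. indicator (En n) (snds w') * Z.weighted_LR \<eta> \<nu> n (snds w') \<partial>?N)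
       = (\<integral>\<^sup>+x. \<integral>\<^sup>+w. indicator (En n) (Z.Y x w) * ennreal (exp (\<eta> / 2 * (\<Sum>k\<le>n. (norm (w k))\<^sup>2))) \<partial>?N \<partial>\<nu>)"
    proof (rule Z.weighted_LR_integral[OF \<nu>])
      show "indicator (En n) \<in> borel_measurable seq_borel" by measurable
      show "indicator (En n) y = (indicator (En n) y' :: ennreal)" if "\<And>k. k \<le> n \<Longrightarrow> y k = y' k" for y y'
        using En_cong[of n y y', OF that] by (simp add: indicator_def)
    qed
    also have "?t * \<dots> \<le> ?t * ennreal ((2 * exp (2 * \<delta>\<^sup>2) + exp D) * exp ((\<eta> / 2 * K - \<kappa>) * real n))"
      by (intro mult_left_mono En_zero n) simp
    also have "\<dots> = ennreal ((2 * exp (2 * \<delta>\<^sup>2) + exp D) * exp ((a + c + \<eta> / 2 * K - \<kappa>) * real n))"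
    proof -
      have "exp ((a + c + \<eta> / 2 * K - \<kappa>) * real n) = exp ((a + c) * real n) * exp ((\<eta> / 2 * K - \<kappa>) * real n)"
        unfolding exp_add[symmetric] by (simp add: algebra_simps)
      then show ?thesis by (subst ennreal_mult[symmetric]) (auto simp: mult_ac add_nonneg_nonneg)
    qed
    also have "\<dots> \<le> ennreal ((2 * exp (2 * \<delta>\<^sup>2) + exp D) * exp (- (\<kappa> / 2) * real n))"
    proof (intro ennreal_leI mult_left_mono)
      show "exp ((a + c + \<eta> / 2 * K - \<kappa>) * real n) \<le> exp (- (\<kappa> / 2) * real n)"
        unfolding exp_le_cancel_iff using ac by (intro mult_right_mono) auto
    qed (simp add: add_nonneg_nonneg)
    finally show "(\<integral>\<^sup>+x. \<integral>\<^sup>+w. indicator (Bn n) (P.Y x w) \<partial>?N \<partial>\<nu>) \<le> ennreal ((2 * exp (2 * \<delta>\<^sup>2) + exp D) * exp (- (\<kappa> / 2) * real n))" .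
  qed (use \<kappa> in \<open>auto intro: add_nonneg_nonneg\<close>)

  \<comment> \<open>The set of good paths and the uniform bound\<close>
  define G where "G = {y. eventually (\<lambda>n. y \<in> En n - Bn n) sequentially}"
  have "G = (\<Union>N. \<Inter>n\<in>{N..}. En n - Bn n)"
    by (auto simp: G_def eventually_sequentially)
  also have "\<dots> \<in> sets (seq_borel :: (nat \<Rightarrow> real^'p) measure)"
    using sets.top[of "seq_borel :: (nat \<Rightarrow> real^'p) measure"]
    by (intro sets.countable_UN sets.countable_INT'' image_subsetI sets.Diff) auto
  finally have G_sets: "G \<in> sets (seq_borel :: (nat \<Rightarrow> real^'p) measure)" .
  have "AE w in ?N. P.Y x w \<in> G" for x
    using En_star[of x] Bn_notin[of x]
  proof eventually_elim
    case (elim w)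
    then show ?case unfolding G_def by (auto simp: eventually_conj_iff)
  qed
  moreover have "eventually (\<lambda>n. \<forall>A' R' B' S'. linear_model A' R' B' S' \<longrightarrow> Z.near \<rho> A' R' B' S' \<longrightarrow>
      linear_model.LR A' R' B' S' \<nu> n y \<le> ennreal (exp (- c * real n)) * P.LR \<nu> n y) sequentially" if "y \<in> G" for y
  proof -
    from that have "eventually (\<lambda>n. y \<in> En n - Bn n) sequentially" by (simp add: G_def)
    from this eventually_ge_at_top[of "CARD('d)"] show ?thesis
    proof (eventually_elim, safe)
      fix n A' R' B' S'
      assume En: "y \<in> En n" and Bn: "y \<notin> Bn n" and n: "CARD('d) \<le> n"
        and model: "linear_model A' R' B' S'" and nr: "Z.near \<rho> A' R' B' S'"
      have "linear_model.LR A' R' B' S' \<nu> n y \<le> ennreal (exp (a * real n)) * Z.weighted_LR \<eta> \<nu> n y"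
        using En by (intro near model nr n) (simp add: En_def)
      also have "ennreal (exp (a * real n)) = ennreal (exp (- c * real n)) * ennreal (exp ((a + c) * real n))"
        by (simp add: ennreal_mult[symmetric] exp_add[symmetric] algebra_simps)
      also have "\<dots> * Z.weighted_LR \<eta> \<nu> n y \<le> ennreal (exp (- c * real n)) * P.LR \<nu> n y"
        unfolding mult.assoc using En Bn by (intro mult_left_mono) (auto simp: Bn_def not_less)
      finally show "linear_model.LR A' R' B' S' \<nu> n y \<le> ennreal (exp (- c * real n)) * P.LR \<nu> n y" .
    qed
  qed
  ultimately show ?thesis using \<rho> c G_sets by blast
qed

subsection \<open>Convergence of the estimator\<close>

lemma nn_integral_pos:
  assumes "prob_space M" and [measurable]: "f \<in> borel_measurable M" and pos: "\<And>x. 0 < f x"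
  shows "0 < (\<integral>\<^sup>+x. f x \<partial>M)"
proof -
  interpret prob_space M by fact
  have "emeasure M {x \<in> space M. f x \<noteq> 0} = 1"
    using pos by (simp add: less_le emeasure_space_1)
  then show ?thesis
    using nn_integral_0_iff[of f M] by (simp add: zero_less_iff_neq_zero)
qed

lemma gauss_pdf_le_1: "gauss_pdf x \<le> 1" for x :: "'a::euclidean_space"
proof -
  have "(2 * pi) powr (- real DIM('a) / 2) \<le> 1"
    using pi_ge_two powr_mono[of "- real DIM('a) / 2" 0 "2 * pi"] by simp
  moreover have "exp (- (norm x)\<^sup>2 / 2) \<le> 1" by simp
  ultimately show ?thesis unfolding gauss_pdf_def by (intro mult_le_one) auto
qed

context linear_model
begin

abbreviation lik :: "(real^'d) measure \<Rightarrow> nat \<Rightarrow> (nat \<Rightarrow> real^'p) \<Rightarrow> ennreal" where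
  "lik \<nu> n y \<equiv> \<integral>\<^sup>+x. lik_from A R B S n y x \<partial>\<nu>"

lemma lik_eq_LR:
  assumes \<nu>: "prob_space \<nu>" "sets \<nu> = sets borel"
  shows "lik \<nu> n y = ennreal (\<Prod>k<Suc n. gauss_pdf (y k)) * LR \<nu> n y"
proof -
  let ?N = "noise :: (nat \<Rightarrow> (real^'q) \<times> (real^'p)) measure"
  interpret N: sigma_finite_measure ?N by (rule sigma_finite_noise)
  note \<nu>(2)[measurable_cong]
  let ?J = "\<lambda>x w. (\<Prod>k<Suc n. ennreal (lr (X x w k) (y k)))"
  have m1: "(\<lambda>w. ?J x w) \<in> borel_measurable ?N" for x by (measurable; simp)
  have m2: "(\<lambda>x. \<integral>\<^sup>+w. ?J x w \<partial>?N) \<in> borel_measurable \<nu>" by (measurable; simp)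
  have "ennreal (obs_density B S x v) = ennreal (gauss_pdf v) * ennreal (lr x v)" for x v
    using gauss_pdf_pos[of v] lr_pos[of x v] by (simp add: ennreal_mult[symmetric] lr_def)
  then have "(\<Prod>k\<le>n. ennreal (obs_density B S (X x w k) (y k))) = ennreal (\<Prod>k<Suc n. gauss_pdf (y k)) * ?J x w" for x w
    by (simp add: prod.distrib prod_ennreal gauss_pdf_pos less_imp_le lessThan_Suc_atMost del: prod.lessThan_Suc prod.atMost_Suc)
  then show ?thesis
    unfolding LR_def lik_from_eq by (simp only: nn_integral_cmult[OF m1] nn_integral_cmult[OF m2])
qed

lemma LR_pos:
  assumes \<nu>: "prob_space \<nu>" "sets \<nu> = sets borel"
  shows "0 < LR \<nu> n y"
proof -
  let ?N = "noise :: (nat \<Rightarrow> (real^'q) \<times> (real^'p)) measure"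
  interpret N: sigma_finite_measure ?N by (rule sigma_finite_noise)
  note \<nu>(2)[measurable_cong]
  show ?thesis
    unfolding LR_def
  proof (intro nn_integral_pos \<nu> prob_space_noise)
    show "(\<lambda>w. \<Prod>k<Suc n. ennreal (lr (X x w k) (y k))) \<in> borel_measurable ?N" for x by (measurable; simp)
    show "(\<lambda>x. \<integral>\<^sup>+w. (\<Prod>k<Suc n. ennreal (lr (X x w k) (y k))) \<partial>?N) \<in> borel_measurable \<nu>" by (measurable; simp)
    show "0 < (\<Prod>k<Suc n. ennreal (lr (X x w k) (y k)))" for x w
      using lr_pos by (subst prod_ennreal) (auto intro!: prod_pos less_imp_le simp del: prod.lessThan_Suc)
  qed
qed

text \<open>The density of one observation never exceeds \<open>1 / |det S|\<close>, whatever the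
  state. This gives finiteness, and boundedness in the parameter once \<open>|det S|\<close> is
  bounded below.\<close>

lemma lik_le:
  assumes \<nu>: "prob_space \<nu>"
  shows "lik \<nu> n y \<le> ennreal ((1 / \<bar>det S\<bar>) ^ Suc n)"
proof -
  let ?N = "noise :: (nat \<Rightarrow> (real^'q) \<times> (real^'p)) measure"
  interpret V: prob_space \<nu> by (rule \<nu>)
  have "obs_density B S x v \<le> 1 / \<bar>det S\<bar>" for x v
    unfolding obs_density_eq by (intro divide_right_mono gauss_pdf_le_1) simp
  then have "(\<Prod>k\<le>n. ennreal (obs_density B S (X x w k) (y k))) \<le> (\<Prod>k\<le>n. ennreal (1 / \<bar>det S\<bar>))" for x w
    by (intro prod_mono_ennreal ennreal_leI)
  also have "(\<Prod>k\<le>n. ennreal (1 / \<bar>det S\<bar>)) = ennreal ((1 / \<bar>det S\<bar>) ^ Suc n)"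
    by (simp add: ennreal_power del: power_Suc)
  finally have "lik \<nu> n y \<le> (\<integral>\<^sup>+x. \<integral>\<^sup>+w. ennreal ((1 / \<bar>det S\<bar>) ^ Suc n) \<partial>?N \<partial>\<nu>)"
    unfolding lik_from_eq by (intro nn_integral_mono)
  then show ?thesis by (simp add: V.emeasure_space_1)
qed

lemma LR_finite:
  assumes \<nu>: "prob_space \<nu>" "sets \<nu> = sets borel"
  shows "LR \<nu> n y < \<top>"
proof -
  have "ennreal (\<Prod>k<Suc n. gauss_pdf (y k)) * LR \<nu> n y < \<top>"
    using lik_le[OF \<nu>(1), of n y] unfolding lik_eq_LR[OF \<nu>] by (rule order_le_less_trans) simp
  moreover have "0 < (\<Prod>k<Suc n. gauss_pdf (y k))" by (intro prod_pos) (simp add: gauss_pdf_pos)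
  ultimately show ?thesis
    by (metis ennreal_mult_top ennreal_eq_0_iff less_top linorder_not_le mult.commute)
qed

lemma likelihood_pos_le:
  assumes \<nu>: "prob_space \<nu>" "sets \<nu> = sets borel"
  shows "0 < likelihood A R B S \<nu> n y" "likelihood A R B S \<nu> n y \<le> (1 / \<bar>det S\<bar>) ^ Suc n"
proof -
  have p: "0 < (\<Prod>k<Suc n. gauss_pdf (y k))" by (intro prod_pos) (simp add: gauss_pdf_pos)
  then have "0 < lik \<nu> n y"
    unfolding lik_eq_LR[OF \<nu>] using LR_pos[OF \<nu>, of n y] by (simp add: ennreal_zero_less_mult_iff)
  moreover have "lik \<nu> n y < \<top>"
    using lik_le[OF \<nu>(1), of n y] by (rule order_le_less_trans) simp
  ultimately show "0 < likelihood A R B S \<nu> n y"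
    unfolding likelihood_def by (simp add: enn2real_positive_iff)
  show "likelihood A R B S \<nu> n y \<le> (1 / \<bar>det S\<bar>) ^ Suc n"
    unfolding likelihood_def by (rule enn2real_leI[OF _ lik_le[OF \<nu>(1)]]) simp
qed

text \<open>The first summand is the same for all parameters and cancels in comparisons. Positivity
  and finiteness keep \<open>ln\<close> and \<open>enn2real\<close> away from their default
  values.\<close>

lemma log_likelihood_eq:
  assumes \<nu>: "prob_space \<nu>" "sets \<nu> = sets borel"
  shows "log_likelihood A R B S \<nu> n y = ln (\<Prod>k<Suc n. gauss_pdf (y k)) + ln (enn2real (LR \<nu> n y))"
proof -
  have p: "0 < (\<Prod>k<Suc n. gauss_pdf (y k))" by (intro prod_pos) (simp add: gauss_pdf_pos)
  have "0 < enn2real (LR \<nu> n y)"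
    using LR_pos[OF \<nu>, of n y] LR_finite[OF \<nu>, of n y] by (simp add: enn2real_positive_iff)
  with p show ?thesis
    unfolding log_likelihood_def likelihood_def lik_eq_LR[OF \<nu>]
    by (simp add: enn2real_mult ln_mult_pos less_imp_le del: prod.lessThan_Suc)
qed

lemma log_likelihood_cong:
  assumes "prob_space \<nu>" "sets \<nu> = sets borel" and eq: "\<And>k. k \<le> n \<Longrightarrow> y k = y' k"
  shows "log_likelihood A R B S \<nu> n y = log_likelihood A R B S \<nu> n y'"
proof -
  have "(\<Prod>k<Suc n. gauss_pdf (y k)) = (\<Prod>k<Suc n. gauss_pdf (y' k))"
    by (rule prod.cong) (auto simp: eq)
  with LR_cong[of n y y' \<nu>, OF eq] show ?thesis
    by (simp only: log_likelihood_eq[OF assms(1,2)])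
qed

text \<open>A statement that is almost sure from every fixed initial state can be integrated over
  the invariant law.\<close>

lemma AE_stationary_law:
  assumes G: "G \<in> sets seq_borel" and AE: "\<And>x. AE w in (noise :: (nat \<Rightarrow> (real^'q) \<times> (real^'p)) measure). Y x w \<in> G"
  shows "AE \<omega> in stationary_law A R B S. obs_path \<omega> \<in> G"
proof -
  let ?N = "noise :: (nat \<Rightarrow> (real^'q) \<times> (real^'p)) measure"
  note [measurable] = G
  have [measurable]: "- G \<in> sets seq_borel" using sets.compl_sets[OF G] by (simp add: Compl_eq_Diff_UNIV)
  have m: "obs_path \<in> measurable (\<Pi>\<^sub>M k\<in>UNIV. borel \<Otimes>\<^sub>M borel) (seq_borel :: (nat \<Rightarrow> real^'p) measure)"
    unfolding obs_path_def[abs_def] by (rule measurable_seqI) measurable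
  have "emeasure (stationary_obs_law A R B S) (- G) = (\<integral>\<^sup>+y. indicator (- G) y \<partial>stationary_obs_law A R B S)"
    by (simp add: sets_stationary_obs_law)
  also have "\<dots> = (\<integral>\<^sup>+x. \<integral>\<^sup>+w. indicator (- G) (Y x w) \<partial>?N \<partial>invariant_law A R)"
    by (rule nn_integral_stationary_obs_law) measurable
  also have "\<dots> = 0"
  proof -
    have "(\<integral>\<^sup>+w. indicator (- G) (Y x w) \<partial>?N) = 0" for x
    proof (subst nn_integral_0_iff_AE)
      show "AE w in ?N. indicator (- G) (Y x w) = (0 :: ennreal)"
        using AE[of x] by eventually_elim simp
    qed measurable
    then show ?thesis by simp
  qed
  finally have "AE y in stationary_obs_law A R B S. y \<in> G"
    by (intro AE_I[of _ _ "- G"]) (auto simp: sets_stationary_obs_law)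
  then show ?thesis
    unfolding stationary_obs_law_def by (rule AE_distrD[rotated]) (simp add: stationary_law_eq m)
qed

end

lemma continuous_on_det:
  fixes M :: "'t::topological_space \<Rightarrow> real^'n^'n"
  assumes "continuous_on T M"
  shows "continuous_on T (\<lambda>\<theta>. det (M \<theta>))"
  unfolding det_def by (intro continuous_intros assms)

text \<open>By Cramer's rule the entries of the inverse are quotients of determinants.\<close>

lemma continuous_on_matrix_inv:
  fixes M :: "'t::topological_space \<Rightarrow> real^'n^'n"
  assumes M: "continuous_on T M" and det: "\<And>\<theta>. \<theta> \<in> T \<Longrightarrow> det (M \<theta>) \<noteq> 0"
    and inv: "\<And>\<theta>. \<theta> \<in> T \<Longrightarrow> M \<theta> ** matrix_inv (M \<theta>) = mat 1"
  shows "continuous_on T (\<lambda>\<theta>. matrix_inv (M \<theta>))"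
proof -
  have eq: "matrix_inv (M \<theta>) = (\<chi> k j. det (\<chi> i l. if l = k then axis j 1 $ i else M \<theta> $ i $ l) / det (M \<theta>))"
    if "\<theta> \<in> T" for \<theta>
  proof -
    have "M \<theta> *v (matrix_inv (M \<theta>) *v axis j 1) = axis j 1" for j
      by (simp add: matrix_vector_mul_assoc inv[OF that])
    then have "matrix_inv (M \<theta>) *v axis j 1 = (\<chi> k. det (\<chi> i l. if l = k then axis j 1 $ i else M \<theta> $ i $ l) / det (M \<theta>))" for j
      using cramer[OF det[OF that]] by blast
    moreover have "matrix_inv (M \<theta>) $ k $ j = (matrix_inv (M \<theta>) *v axis j 1) $ k" for k j
      by (simp add: matrix_vector_mul_component inner_axis)
    ultimately show ?thesis by (simp add: vec_eq_iff)
  qed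
  have "continuous_on T (\<lambda>\<theta>. (\<chi> k j. det (\<chi> i l. if l = k then axis j 1 $ i else M \<theta> $ i $ l) / det (M \<theta>)) :: real^'n^'n)"
  proof (intro continuous_on_vec_lambda continuous_on_divide continuous_on_det M)
    fix i l k j
    show "continuous_on T (\<lambda>\<theta>. if l = k then axis j 1 $ i else M \<theta> $ i $ l)"
      by (cases "l = k") (auto intro!: continuous_intros M)
  qed (use det in auto)
  then show ?thesis by (rule continuous_on_eq) (simp add: eq)
qed

lemma eventually_near:
  fixes \<Theta> :: "'t::metric_space set"
    and A :: "'t \<Rightarrow> real^'d^'d" and R :: "'t \<Rightarrow> real^'q^'d" and B :: "'t \<Rightarrow> real^'d^'p" and S :: "'t \<Rightarrow> real^'p^'p"
  assumes model: "\<And>\<theta>. \<theta> \<in> \<Theta> \<Longrightarrow> linear_model (A \<theta>) (R \<theta>) (B \<theta>) (S \<theta>)"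
    and cont: "continuous_on \<Theta> A" "continuous_on \<Theta> R" "continuous_on \<Theta> B" "continuous_on \<Theta> S"
    and \<theta>0: "\<theta>0 \<in> \<Theta>" and \<rho>: "0 < \<rho>"
  shows "\<exists>r>0. \<forall>\<theta>\<in>\<Theta>. dist \<theta> \<theta>0 < r \<longrightarrow>
    linear_model.near (A \<theta>0) (R \<theta>0) (B \<theta>0) (S \<theta>0) \<rho> (A \<theta>) (R \<theta>) (B \<theta>) (S \<theta>)"
proof -
  interpret Z: linear_model "A \<theta>0" "R \<theta>0" "B \<theta>0" "S \<theta>0" by (rule model[OF \<theta>0])
  have inv: "continuous_on \<Theta> (\<lambda>\<theta>. matrix_inv (S \<theta>))"
    by (rule continuous_on_matrix_inv[OF cont(4) linear_model.S_inverse(3) linear_model.S_inverse(1)]) (erule model)+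
  have FB: "continuous_on \<Theta> (\<lambda>\<theta>. matrix_inv (S \<theta>) ** B \<theta>)"
    unfolding matrix_matrix_mult_def
    by (intro continuous_on_vec_lambda continuous_on_sum continuous_on_mult continuous_on_component inv cont(3))
  have less: "\<exists>r>0. \<forall>\<theta>\<in>\<Theta>. dist \<theta> \<theta>0 < r \<longrightarrow> g \<theta> < b" if g: "continuous_on \<Theta> g" "g \<theta>0 < b" for g :: "'t \<Rightarrow> real" and b
  proof -
    obtain r where "r > 0" "\<And>\<theta>. \<theta> \<in> \<Theta> \<Longrightarrow> dist \<theta> \<theta>0 < r \<Longrightarrow> dist (g \<theta>) (g \<theta>0) < b - g \<theta>0"
      using g \<theta>0 unfolding continuous_on_iff by (metis diff_gt_0_iff_gt)
    then show ?thesis by (intro exI[of _ r]) (force simp: dist_real_def)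
  qed
  have nearA: "\<exists>r>0. \<forall>\<theta>\<in>\<Theta>. dist \<theta> \<theta>0 < r \<longrightarrow> norm (A \<theta> - A \<theta>0) < \<rho>"
    by (rule less) (intro continuous_on_norm continuous_on_diff cont continuous_on_const, use \<rho> in simp)
  have nearR: "\<exists>r>0. \<forall>\<theta>\<in>\<Theta>. dist \<theta> \<theta>0 < r \<longrightarrow> norm (R \<theta> - R \<theta>0) < \<rho>"
    by (rule less) (intro continuous_on_norm continuous_on_diff cont continuous_on_const, use \<rho> in simp)
  have nearF: "\<exists>r>0. \<forall>\<theta>\<in>\<Theta>. dist \<theta> \<theta>0 < r \<longrightarrow> norm (matrix_inv (S \<theta>) - matrix_inv (S \<theta>0)) < \<rho>"
    by (rule less) (intro continuous_on_norm continuous_on_diff inv continuous_on_const, use \<rho> in simp)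
  have nearH: "\<exists>r>0. \<forall>\<theta>\<in>\<Theta>. dist \<theta> \<theta>0 < r \<longrightarrow> norm (matrix_inv (S \<theta>) ** B \<theta> - matrix_inv (S \<theta>0) ** B \<theta>0) < \<rho>"
    by (rule less) (intro continuous_on_norm continuous_on_diff FB continuous_on_const, use \<rho> in simp)
  have neard: "\<exists>r>0. \<forall>\<theta>\<in>\<Theta>. dist \<theta> \<theta>0 < r \<longrightarrow> \<bar>det (S \<theta>0)\<bar> - exp \<rho> * \<bar>det (S \<theta>)\<bar> < 0"
  proof (rule less)
    show "continuous_on \<Theta> (\<lambda>\<theta>. \<bar>det (S \<theta>0)\<bar> - exp \<rho> * \<bar>det (S \<theta>)\<bar>)"
      by (intro continuous_on_diff continuous_on_mult continuous_on_const continuous_on_rabs continuous_on_det cont)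
    have "1 * \<bar>det (S \<theta>0)\<bar> < exp \<rho> * \<bar>det (S \<theta>0)\<bar>"
      using \<rho> Z.S_inverse(3) by (intro mult_strict_right_mono) auto
    then show "\<bar>det (S \<theta>0)\<bar> - exp \<rho> * \<bar>det (S \<theta>0)\<bar> < 0" by simp
  qed
  obtain r1 where r1: "0 < r1" "\<And>\<theta>. \<theta> \<in> \<Theta> \<Longrightarrow> dist \<theta> \<theta>0 < r1 \<Longrightarrow> norm (A \<theta> - A \<theta>0) < \<rho>"
    using nearA by blast
  obtain r2 where r2: "0 < r2" "\<And>\<theta>. \<theta> \<in> \<Theta> \<Longrightarrow> dist \<theta> \<theta>0 < r2 \<Longrightarrow> norm (R \<theta> - R \<theta>0) < \<rho>"
    using nearR by blast
  obtain r3 where r3: "0 < r3" "\<And>\<theta>. \<theta> \<in> \<Theta> \<Longrightarrow> dist \<theta> \<theta>0 < r3 \<Longrightarrow> norm (matrix_inv (S \<theta>) - matrix_inv (S \<theta>0)) < \<rho>"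
    using nearF by blast
  obtain r4 where r4: "0 < r4" "\<And>\<theta>. \<theta> \<in> \<Theta> \<Longrightarrow> dist \<theta> \<theta>0 < r4 \<Longrightarrow> norm (matrix_inv (S \<theta>) ** B \<theta> - matrix_inv (S \<theta>0) ** B \<theta>0) < \<rho>"
    using nearH by blast
  obtain r5 where r5: "0 < r5" "\<And>\<theta>. \<theta> \<in> \<Theta> \<Longrightarrow> dist \<theta> \<theta>0 < r5 \<Longrightarrow> \<bar>det (S \<theta>0)\<bar> - exp \<rho> * \<bar>det (S \<theta>)\<bar> < 0"
    using neard by blast
  show ?thesis
  proof (intro exI[of _ "min r1 (min r2 (min r3 (min r4 r5)))"] conjI ballI impI)
    fix \<theta> assume "\<theta> \<in> \<Theta>" "dist \<theta> \<theta>0 < min r1 (min r2 (min r3 (min r4 r5)))"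
    then have d: "\<theta> \<in> \<Theta>" "dist \<theta> \<theta>0 < r1" "dist \<theta> \<theta>0 < r2" "dist \<theta> \<theta>0 < r3" "dist \<theta> \<theta>0 < r4" "dist \<theta> \<theta>0 < r5"
      by (simp_all only: min_less_iff_conj)
    show "Z.near \<rho> (A \<theta>) (R \<theta>) (B \<theta>) (S \<theta>)"
      unfolding Z.near_def
      using r1(2)[OF d(1,2)] r2(2)[OF d(1,3)] r3(2)[OF d(1,4)] r4(2)[OF d(1,5)] r5(2)[OF d(1,6)]
      by (intro conjI) linarith+
  qed (use r1 r2 r3 r4 r5 in simp)
qed

theorem mainTheorem5:
  fixes \<Theta> :: "'t::metric_space set"
    and A :: "'t \<Rightarrow> real^'d^'d"
    and R :: "'t \<Rightarrow> real^'q^'d"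
    and B :: "'t \<Rightarrow> real^'d^'p"
    and S :: "'t \<Rightarrow> real^'p^'p"
    and \<theta>star :: 't
  assumes "compact \<Theta>"
    and L1_observable: "\<And>\<theta>. \<theta> \<in> \<Theta> \<Longrightarrow> observable (A \<theta>) (B \<theta>)"
    and L1_controllable: "\<And>\<theta>. \<theta> \<in> \<Theta> \<Longrightarrow> controllable (A \<theta>) (R \<theta>)"
    and L2: "\<And>\<theta> c. \<theta> \<in> \<Theta> \<Longrightarrow> complex_eigenvalue (A \<theta>) c \<Longrightarrow> norm c < 1"
    and L3: "\<And>\<theta>. \<theta> \<in> \<Theta> \<Longrightarrow> full_rank (S \<theta>)"
    and L4: "continuous_on \<Theta> A" "continuous_on \<Theta> R" "continuous_on \<Theta> B" "continuous_on \<Theta> S"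
    and "\<theta>star \<in> \<Theta>"
  shows "\<forall>\<nu> :: (real^'d) measure. prob_space \<nu> \<and> sets \<nu> = sets borel \<longrightarrow>
    (\<forall>est :: nat \<Rightarrow> (nat \<Rightarrow> real^'p) \<Rightarrow> 't. approx_mle \<Theta> A R B S \<theta>star \<nu> est \<longrightarrow>
      (AE \<omega> in stationary_law (A \<theta>star) (R \<theta>star) (B \<theta>star) (S \<theta>star).
        (\<lambda>n. infdist (est n (obs_upto n \<omega>)) (equiv_params \<Theta> A R B S \<theta>star)) \<longlonglongrightarrow> 0))"
proof (intro allI impI, elim conjE)
  fix \<nu> :: "(real^'d) measure" and est :: "nat \<Rightarrow> (nat \<Rightarrow> real^'p) \<Rightarrow> 't"
  assume \<nu>: "prob_space \<nu>" "sets \<nu> = sets borel" and mle: "approx_mle \<Theta> A R B S \<theta>star \<nu> est"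
  have model: "linear_model (A \<theta>) (R \<theta>) (B \<theta>) (S \<theta>)" if "\<theta> \<in> \<Theta>" for \<theta>
    by unfold_locales (use that L1_observable L1_controllable L2 L3 in blast)+
  interpret P: linear_model "A \<theta>star" "R \<theta>star" "B \<theta>star" "S \<theta>star" by (rule model) fact
  let ?E = "equiv_params \<Theta> A R B S \<theta>star"
  let ?l = "\<lambda>\<theta>. log_likelihood (A \<theta>) (R \<theta>) (B \<theta>) (S \<theta>) \<nu>"
  let ?LR = "\<lambda>\<theta>. linear_model.LR (A \<theta>) (R \<theta>) (B \<theta>) (S \<theta>) \<nu>"
  have E: "\<theta>star \<in> ?E" using \<open>\<theta>star \<in> \<Theta>\<close> by (simp add: equiv_params_def)

  \<comment> \<open>Separation near a single non-equivalent parameter\<close>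
  have local: "\<exists>r>0. \<exists>c>0. \<exists>G\<in>sets (seq_borel :: (nat \<Rightarrow> real^'p) measure).
      (\<forall>x. AE w in (noise :: (nat \<Rightarrow> (real^'q) \<times> (real^'p)) measure). P.Y x w \<in> G) \<and>
      (\<forall>y\<in>G. eventually (\<lambda>n. \<forall>\<theta>\<in>\<Theta> \<inter> ball \<theta>0 r. ?LR \<theta> n y \<le> ennreal (exp (- c * real n)) * P.LR \<nu> n y) sequentially)"
    if \<theta>0: "\<theta>0 \<in> \<Theta>" "\<theta>0 \<notin> ?E" for \<theta>0
  proof -
    have ne: "stationary_obs_law (A \<theta>star) (R \<theta>star) (B \<theta>star) (S \<theta>star) \<noteq> stationary_obs_law (A \<theta>0) (R \<theta>0) (B \<theta>0) (S \<theta>0)"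
      using \<theta>0 by (auto simp: equiv_params_def)
    obtain \<rho> c G where \<rho>: "\<rho> > 0" "c > 0" "G \<in> sets (seq_borel :: (nat \<Rightarrow> real^'p) measure)"
        "\<forall>x. AE w in (noise :: (nat \<Rightarrow> (real^'q) \<times> (real^'p)) measure). P.Y x w \<in> G"
      and G: "\<And>y. y \<in> G \<Longrightarrow> eventually (\<lambda>n. \<forall>A' R' B' S'. linear_model A' R' B' S' \<longrightarrow>
        linear_model.near (A \<theta>0) (R \<theta>0) (B \<theta>0) (S \<theta>0) \<rho> A' R' B' S' \<longrightarrow>
        linear_model.LR A' R' B' S' \<nu> n y \<le> ennreal (exp (- c * real n)) * P.LR \<nu> n y) sequentially"
      using likelihood_separation[OF P.linear_model_axioms model[OF \<theta>0(1)] ne \<nu>] by blast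
    obtain r where r: "r > 0" "\<And>\<theta>. \<theta> \<in> \<Theta> \<Longrightarrow> dist \<theta> \<theta>0 < r \<Longrightarrow>
        linear_model.near (A \<theta>0) (R \<theta>0) (B \<theta>0) (S \<theta>0) \<rho> (A \<theta>) (R \<theta>) (B \<theta>) (S \<theta>)"
      using eventually_near[OF model L4 \<theta>0(1) \<rho>(1)] by blast
    have "eventually (\<lambda>n. \<forall>\<theta>\<in>\<Theta> \<inter> ball \<theta>0 r. ?LR \<theta> n y \<le> ennreal (exp (- c * real n)) * P.LR \<nu> n y) sequentially"
      if "y \<in> G" for y
      using G[OF that]
    proof eventually_elim
      case (elim n)
      then show ?case using r(2) model by (auto simp: dist_commute)
    qed
    with r(1) \<rho> show ?thesis by blast
  qed

  \<comment> \<open>Uniform separation at positive distance from the equivalence class\<close>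
  have separated: "\<exists>c>0. \<exists>G\<in>sets (seq_borel :: (nat \<Rightarrow> real^'p) measure).
      (\<forall>x. AE w in (noise :: (nat \<Rightarrow> (real^'q) \<times> (real^'p)) measure). P.Y x w \<in> G) \<and>
      (\<forall>y\<in>G. eventually (\<lambda>n. \<forall>\<theta>\<in>\<Theta>. e \<le> infdist \<theta> ?E \<longrightarrow> ?LR \<theta> n y \<le> ennreal (exp (- c * real n)) * P.LR \<nu> n y) sequentially)"
    if e: "0 < e" for e
  proof -
    define T where "T = {\<theta> \<in> \<Theta>. e \<le> infdist \<theta> ?E}"
    have "closed {\<theta>. e \<le> infdist \<theta> ?E}" by (intro closed_Collect_le continuous_intros)
    then have T: "compact T"
      unfolding T_def using compact_Int_closed[OF \<open>compact \<Theta>\<close>] by (simp add: Collect_conj_eq)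
    have "\<theta>0 \<in> \<Theta> \<and> \<theta>0 \<notin> ?E" if "\<theta>0 \<in> T" for \<theta>0
      using that e by (auto simp: T_def)
    then have "\<forall>\<theta>0\<in>T. \<exists>r c G. 0 < r \<and> 0 < c \<and> G \<in> sets (seq_borel :: (nat \<Rightarrow> real^'p) measure) \<and>
      (\<forall>x. AE w in (noise :: (nat \<Rightarrow> (real^'q) \<times> (real^'p)) measure). P.Y x w \<in> G) \<and>
      (\<forall>y\<in>G. eventually (\<lambda>n. \<forall>\<theta>\<in>\<Theta> \<inter> ball \<theta>0 r. ?LR \<theta> n y \<le> ennreal (exp (- c * real n)) * P.LR \<nu> n y) sequentially)"
      using local by meson
    then obtain r c G where loc: "\<And>\<theta>0. \<theta>0 \<in> T \<Longrightarrow> 0 < r \<theta>0" "\<And>\<theta>0. \<theta>0 \<in> T \<Longrightarrow> 0 < c \<theta>0"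
      "\<And>\<theta>0. \<theta>0 \<in> T \<Longrightarrow> G \<theta>0 \<in> sets (seq_borel :: (nat \<Rightarrow> real^'p) measure)"
      "\<And>\<theta>0 x. \<theta>0 \<in> T \<Longrightarrow> AE w in (noise :: (nat \<Rightarrow> (real^'q) \<times> (real^'p)) measure). P.Y x w \<in> G \<theta>0"
      "\<And>\<theta>0 y. \<theta>0 \<in> T \<Longrightarrow> y \<in> G \<theta>0 \<Longrightarrow> eventually (\<lambda>n. \<forall>\<theta>\<in>\<Theta> \<inter> ball \<theta>0 (r \<theta>0). ?LR \<theta> n y \<le> ennreal (exp (- c \<theta>0 * real n)) * P.LR \<nu> n y) sequentially"
      unfolding bchoice_iff by blast
    obtain D where D: "D \<subseteq> T" "finite D" "T \<subseteq> (\<Union>\<theta>0\<in>D. ball \<theta>0 (r \<theta>0))"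
    proof (rule compactE_image[OF T, of T "\<lambda>\<theta>0. ball \<theta>0 (r \<theta>0)"])
      show "T \<subseteq> (\<Union>\<theta>0\<in>T. ball \<theta>0 (r \<theta>0))" using loc(1) by force
    qed auto
    \<comment> \<open>The element 1 keeps the minimum meaningful when \<open>D\<close> is
      empty.\<close>
    define c' where "c' = Min (insert 1 (c ` D))"
    have c': "0 < c'" "\<And>\<theta>0. \<theta>0 \<in> D \<Longrightarrow> c' \<le> c \<theta>0"
      using D loc(2) by (auto simp: c'_def subset_iff)
    define G' where "G' = UNIV \<inter> (\<Inter>\<theta>0\<in>D. G \<theta>0)"
    have "G' \<in> sets (seq_borel :: (nat \<Rightarrow> real^'p) measure)"
      unfolding G'_def using D loc(3) sets.top[of "seq_borel :: (nat \<Rightarrow> real^'p) measure"]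
      by (intro sets.Int sets.countable_INT'') (auto intro: countable_finite)
    moreover have "AE w in (noise :: (nat \<Rightarrow> (real^'q) \<times> (real^'p)) measure). P.Y x w \<in> G'" for x
    proof -
      have "AE w in (noise :: (nat \<Rightarrow> (real^'q) \<times> (real^'p)) measure). \<forall>\<theta>0\<in>D. P.Y x w \<in> G \<theta>0"
        using D loc(4) by (intro AE_finite_allI) auto
      then show ?thesis by (simp add: G'_def)
    qed
    moreover have "eventually (\<lambda>n. \<forall>\<theta>\<in>\<Theta>. e \<le> infdist \<theta> ?E \<longrightarrow> ?LR \<theta> n y \<le> ennreal (exp (- c' * real n)) * P.LR \<nu> n y) sequentially"
      if "y \<in> G'" for y
    proof -
      have "eventually (\<lambda>n. \<forall>\<theta>0\<in>D. \<forall>\<theta>\<in>\<Theta> \<inter> ball \<theta>0 (r \<theta>0). ?LR \<theta> n y \<le> ennreal (exp (- c \<theta>0 * real n)) * P.LR \<nu> n y) sequentially"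
        using D loc(5) that by (intro eventually_ball_finite) (auto simp: G'_def)
      then show ?thesis
      proof eventually_elim
        case (elim n)
        show ?case
        proof (intro ballI impI)
          fix \<theta> assume \<theta>: "\<theta> \<in> \<Theta>" "e \<le> infdist \<theta> ?E"
          then have "\<theta> \<in> T" by (simp add: T_def)
          then obtain \<theta>0 where \<theta>0: "\<theta>0 \<in> D" "\<theta> \<in> ball \<theta>0 (r \<theta>0)" using D by blast
          have "?LR \<theta> n y \<le> ennreal (exp (- c \<theta>0 * real n)) * P.LR \<nu> n y" using elim \<theta> \<theta>0 by blast
          also have "\<dots> \<le> ennreal (exp (- c' * real n)) * P.LR \<nu> n y"
          proof (intro mult_right_mono ennreal_leI)
            show "exp (- c \<theta>0 * real n) \<le> exp (- c' * real n)"
              unfolding exp_le_cancel_iff using c'(2)[OF \<theta>0(1)] by (intro mult_right_mono) auto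
          qed simp
          finally show "?LR \<theta> n y \<le> ennreal (exp (- c' * real n)) * P.LR \<nu> n y" .
        qed
      qed
    qed
    ultimately show ?thesis using c'(1) by blast
  qed

  \<comment> \<open>Countably many distances \<open>1 / (j + 1)\<close> suffice for convergence and
    leave a null exceptional set.\<close>
  have "\<forall>j. \<exists>c G. 0 < c \<and> G \<in> sets (seq_borel :: (nat \<Rightarrow> real^'p) measure) \<and>
      (\<forall>x. AE w in (noise :: (nat \<Rightarrow> (real^'q) \<times> (real^'p)) measure). P.Y x w \<in> G) \<and>
      (\<forall>y\<in>G. eventually (\<lambda>n. \<forall>\<theta>\<in>\<Theta>. 1 / real (Suc j) \<le> infdist \<theta> ?E \<longrightarrow> ?LR \<theta> n y \<le> ennreal (exp (- c * real n)) * P.LR \<nu> n y) sequentially)"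
    using separated[of "1 / real (Suc j)" for j] by (meson of_nat_0_less_iff zero_less_Suc zero_less_divide_1_iff)
  then obtain c G where c: "\<And>j. 0 < c j" and G: "\<And>j. G j \<in> sets (seq_borel :: (nat \<Rightarrow> real^'p) measure)"
      "\<And>j x. AE w in (noise :: (nat \<Rightarrow> (real^'q) \<times> (real^'p)) measure). P.Y x w \<in> G j"
    and sep: "\<And>j y. y \<in> G j \<Longrightarrow> eventually (\<lambda>n. \<forall>\<theta>\<in>\<Theta>. 1 / real (Suc j) \<le> infdist \<theta> ?E \<longrightarrow>
      ?LR \<theta> n y \<le> ennreal (exp (- c j * real n)) * P.LR \<nu> n y) sequentially"
    unfolding choice_iff by blast
  have AE_G: "AE \<omega> in stationary_law (A \<theta>star) (R \<theta>star) (B \<theta>star) (S \<theta>star). \<forall>j. obs_path \<omega> \<in> G j"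
    unfolding AE_all_countable using P.AE_stationary_law[OF G] by blast

  \<comment> \<open>The values lie in \<open>\<Theta>\<close> at every point, not just almost
    everywhere: a map measurable into \<open>restrict_space borel \<Theta>\<close> takes values in
    \<open>\<Theta>\<close>, and a Dirac measure provides a completion to which universal
    measurability applies.\<close>
  have est: "est n (obs_upto n \<omega>) \<in> \<Theta>" for n and \<omega> :: "nat \<Rightarrow> (real^'d) \<times> (real^'p)"
  proof -
    let ?M = "\<Pi>\<^sub>M k\<in>{..n}. (borel :: (real^'p) measure)"
    let ?y = "obs_upto n \<omega>"
    have y: "?y \<in> space ?M" by (simp add: obs_upto_def space_PiM)
    have "universally_measurable ?M (restrict_space borel \<Theta>) (est n)"
      using mle by (simp add: approx_mle_def Let_def)
    then have "est n \<in> measurable (completion (return ?M ?y)) (restrict_space borel \<Theta>)"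
      using prob_space_return[OF y] unfolding universally_measurable_def by simp
    from measurable_space[OF this, of ?y] y show ?thesis by (simp add: space_restrict_space)
  qed

  \<comment> \<open>By compactness \<open>|det S|\<close> is bounded away from 0, so the
    log-likelihoods are bounded above in \<open>\<theta>\<close>; the real supremum in
    \<open>approx_mle\<close> therefore dominates the value at \<open>\<theta>star\<close>.\<close>
  obtain b where b: "0 < b" "\<And>\<theta>. \<theta> \<in> \<Theta> \<Longrightarrow> b \<le> \<bar>det (S \<theta>)\<bar>"
  proof -
    obtain \<theta>1 where "\<theta>1 \<in> \<Theta>" "\<And>\<theta>. \<theta> \<in> \<Theta> \<Longrightarrow> \<bar>det (S \<theta>1)\<bar> \<le> \<bar>det (S \<theta>)\<bar>"
      using continuous_attains_inf[OF \<open>compact \<Theta>\<close> _ continuous_on_rabs[OF continuous_on_det[OF L4(4)]]] \<open>\<theta>star \<in> \<Theta>\<close> by blast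
    then show ?thesis
      using linear_model.S_inverse(3)[OF model[of \<theta>1]] by (intro that[of "\<bar>det (S \<theta>1)\<bar>"]) auto
  qed
  have bdd: "bdd_above ((\<lambda>\<theta>. ?l \<theta> n y / real n) ` \<Theta>)" for n y
  proof (rule bdd_aboveI2)
    fix \<theta> assume \<theta>: "\<theta> \<in> \<Theta>"
    note m = linear_model.likelihood_pos_le[OF model[OF \<theta>] \<nu>, of n y]
    have "(1 / \<bar>det (S \<theta>)\<bar>) ^ Suc n \<le> (1 / b) ^ Suc n"
      using b(1) b(2)[OF \<theta>] by (intro power_mono divide_left_mono) auto
    with m have "?l \<theta> n y \<le> ln ((1 / b) ^ Suc n)"
      unfolding log_likelihood_def by (intro ln_mono) (auto simp del: power_Suc)
    then show "?l \<theta> n y / real n \<le> ln ((1 / b) ^ Suc n) / real n"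
      by (intro divide_right_mono) auto
  qed

  \<comment> \<open>Convergence along one path\<close>
  obtain Z where Z: "AE \<omega> in stationary_law (A \<theta>star) (R \<theta>star) (B \<theta>star) (S \<theta>star). (\<lambda>n. Z n \<omega>) \<longlonglongrightarrow> (0 :: real)"
    and opt: "AE \<omega> in stationary_law (A \<theta>star) (R \<theta>star) (B \<theta>star) (S \<theta>star). \<forall>n\<ge>1.
      ?l (est n (obs_upto n \<omega>)) n (obs_upto n \<omega>) / real n \<ge> (SUP \<theta>\<in>\<Theta>. ?l \<theta> n (obs_upto n \<omega>) / real n) - Z n \<omega>"
    using mle unfolding approx_mle_def Let_def by blast
  from AE_G Z opt
  show "AE \<omega> in stationary_law (A \<theta>star) (R \<theta>star) (B \<theta>star) (S \<theta>star). (\<lambda>n. infdist (est n (obs_upto n \<omega>)) ?E) \<longlonglongrightarrow> 0"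
  proof eventually_elim
    case (elim \<omega>)
    let ?y = "obs_path \<omega>" and ?e = "\<lambda>n. est n (obs_upto n \<omega>)"
    \<comment> \<open>\<open>obs_upto\<close> has an arbitrary default value beyond index
      \<open>n\<close>, but the likelihood reads the entries up to \<open>n\<close> only.\<close>
    have cong: "?l \<theta> n (obs_upto n \<omega>) = ?l \<theta> n ?y" if "\<theta> \<in> \<Theta>" for \<theta> n
      by (rule linear_model.log_likelihood_cong[OF model[OF that] \<nu>]) (simp add: obs_upto_def)
    note opt_n = elim(3)[rule_format]
    show ?case
    proof (rule order_tendstoI)
      fix e :: real assume "0 < e"
      then obtain j where j: "1 / real (Suc j) < e"
        using nat_approx_posE by blast
      \<comment> \<open>At distance at least \<open>1 / (j + 1)\<close> the normalised
        log-likelihood is lower than at \<open>\<theta>star\<close> by at least \<open>c j\<close>,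
        while the estimator may fall short by at most \<open>Z n \<omega>\<close>; once
        \<open>Z n \<omega> < c j\<close> the two are incompatible.\<close>
      have "eventually (\<lambda>n. Z n \<omega> < c j) sequentially"
        using elim(2) c[of j] by (rule order_tendstoD)
      from this sep[OF elim(1)[rule_format], of j] eventually_ge_at_top[of 1]
      have "eventually (\<lambda>n. infdist (?e n) ?E < 1 / real (Suc j)) sequentially"
      proof eventually_elim
        case (elim n)
        show ?case
        proof (rule ccontr)
          assume "\<not> ?thesis"
          then have LR: "?LR (?e n) n ?y \<le> ennreal (exp (- c j * real n)) * P.LR \<nu> n ?y"
            using elim(2) est[of n \<omega>] by auto
          interpret M: linear_model "A (?e n)" "R (?e n)" "B (?e n)" "S (?e n)" by (rule model[OF est])
          have fin: "M.LR \<nu> n ?y < \<top>" "P.LR \<nu> n ?y < \<top>" and pos: "0 < M.LR \<nu> n ?y" "0 < P.LR \<nu> n ?y"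
            by (rule M.LR_finite[OF \<nu>] P.LR_finite[OF \<nu>] M.LR_pos[OF \<nu>] P.LR_pos[OF \<nu>])+
          have pos': "0 < enn2real (M.LR \<nu> n ?y)" "0 < enn2real (P.LR \<nu> n ?y)"
            using fin pos by (auto simp: enn2real_positive_iff)
          have "enn2real (M.LR \<nu> n ?y) \<le> enn2real (ennreal (exp (- c j * real n)) * P.LR \<nu> n ?y)"
            using LR fin by (intro enn2real_mono) (auto simp: ennreal_mult_less_top)
          also have "\<dots> = exp (- c j * real n) * enn2real (P.LR \<nu> n ?y)" by (simp add: enn2real_mult)
          finally have "ln (enn2real (M.LR \<nu> n ?y)) \<le> ln (exp (- c j * real n) * enn2real (P.LR \<nu> n ?y))"
            using pos' by (intro ln_mono) auto
          also have "\<dots> = - c j * real n + ln (enn2real (P.LR \<nu> n ?y))"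
            using pos' by (subst ln_mult_pos) auto
          finally have "?l (?e n) n ?y \<le> ?l \<theta>star n ?y - c j * real n"
            unfolding M.log_likelihood_eq[OF \<nu>] P.log_likelihood_eq[OF \<nu>] by linarith
          then have "?l (?e n) n ?y / real n \<le> (?l \<theta>star n ?y - c j * real n) / real n"
            by (intro divide_right_mono) auto
          also have "\<dots> = ?l \<theta>star n ?y / real n - c j"
            using elim(3) by (simp add: diff_divide_distrib)
          finally have "?l (?e n) n ?y / real n \<le> ?l \<theta>star n ?y / real n - c j" .
          moreover have "?l \<theta>star n ?y / real n - Z n \<omega> \<le> ?l (?e n) n ?y / real n"
          proof -
            have "?l \<theta>star n (obs_upto n \<omega>) / real n \<le> (SUP \<theta>\<in>\<Theta>. ?l \<theta> n (obs_upto n \<omega>) / real n)"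
              by (rule cSUP_upper[OF \<open>\<theta>star \<in> \<Theta>\<close> bdd])
            with opt_n[OF elim(3)] show ?thesis
              unfolding cong[OF \<open>\<theta>star \<in> \<Theta>\<close>] cong[OF est] by linarith
          qed
          ultimately show False using elim(1) by linarith
        qed
      qed
      then show "eventually (\<lambda>n. infdist (?e n) ?E < e) sequentially"
        by eventually_elim (use j in simp)
    qed (simp add: infdist_nonneg always_eventually less_le_trans)
  qed
qed

end
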